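(* Let $V=V_0\oplus V_1$ be a $\mathbb{Z}_2$-graded complex vector space with $\dim V_0=k\ne l=\dim V_1$, let $n\ge1$, and let $S_n$ act on $V^{\otimes n}$ by the sign permutation action $\varphi^*:\mathbb{C}S_n\to\mathrm{End}(V^{\otimes n})$. With the notation of the context: (a) $\varphi^*(\mathbb{C}S_n)=P\oplus Q$ and $\varphi^*(\mathbb{C}A_n)=P'\oplus Q'$, where $Q'=Q$, $P'\subseteq P$ and $\dim P=2\dim P'$. (b) $V^{\otimes n}=W_P\oplus W_Q$, every element of $\mathcal{A}_n=\mathrm{End}_{\mathbb{C}A_n}(V^{\otimes n})$ (and hence of $\mathcal{B}_n=\mathrm{End}_{\mathbb{C}S_n}(V^{\otimes n})$) preserves $W_P$ and $W_Q$, and restriction gives decompositions $\mathcal{A}_n=\mathcal{A}_P\oplus\mathcal{A}_Q$ and $\mathcal{B}_n=\mathcal{B}_P\oplus\mathcal{B}_Q$, where $\mathcal{A}_P=\mathrm{End}_{\mathbb{C}A_n}(W_P)$, $\mathcal{A}_Q=\mathrm{End}_{\mathbb{C}A_n}(W_Q)$, $\mathcal{B}_P=\mathrm{End}_{\mathbb{C}S_n}(W_P)$, $\mathcal{B}_Q=\mathrm{End}_{\mathbb{C}S_n}(W_Q)$; these satisfy $\mathcal{B}_P\subseteq\mathcal{A}_P$ and $\mathcal{B}_Q=\mathcal{A}_Q$.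
   Context: Elements of $V_0$ have degree $0$ and nonzero elements of $V_1$ degree $1$. The sign permutation action: for $\sigma\in S_n$ and homogeneous $v_i$, $\varphi^*_\sigma(v_1\otimes\cdots\otimes v_n)=\epsilon\, v_{\sigma^{-1}(1)}\otimes\cdots\otimes v_{\sigma^{-1}(n)}$ with $\epsilon=\prod_{i<j,\ \sigma(i)>\sigma(j)}(-1)^{\deg v_i\deg v_j}$, extended linearly. $A_n$ is the alternating group; $\mathrm{End}_{\mathbb{C}G}(W)$ denotes linear maps commuting with $\varphi^*_\sigma$ for all $\sigma\in G$. For $\lambda\vdash n$, $\lambda'$ is the conjugate partition, and $I_\lambda\subseteq\mathbb{C}S_n$ is the minimal two-sided ideal (simple component) of $\mathbb{C}S_n$ corresponding to the irreducible $S_n$-module (Specht module) $S^\lambda$. Let $H(k,l;n)=\{\lambda\vdash n:\lambda_{k+1}\le l\}$, $H_0(k,l;n)=\{\lambda\in H(k,l;n):\lambda'\in H(k,l;n)\}$, $H_1(k,l;n)=H(k,l;n)\setminus H_0(k,l;n)$. Every irreducible $\mathbb{C}A_n$-module is a constituent of the restriction of some $S^\lambda$ to $A_n$ ($\lambda$ unique up to conjugation); for a set $X$ of partitions of $n$ let $\bar J(X)$ be the sum of the simple two-sided ideals of $\mathbb{C}A_n$ whose irreducible module is a constituent of the restriction of $S^\lambda$ to $A_n$ for some $\lambda\in X$. Set $P=\sum_{\lambda\in H_0(k,l;n)}\varphi^*(I_\lambda)$, $Q=\sum_{\lambda\in H_1(k,l;n)}\varphi^*(I_\lambda)$, $P'=\varphi^*(\bar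 J(H_0(k,l;n)))$, $Q'=\varphi^*(\bar J(H_1(k,l;n)))$. For $\lambda\vdash n$ let $W_\lambda=\varphi^*(I_\lambda)V^{\otimes n}$ (the $S^\lambda$-isotypic component of $V^{\otimes n}$), and $W_P=\bigoplus_{\lambda\in H_0(k,l;n)}W_\lambda$, $W_Q=\bigoplus_{\lambda\in H_1(k,l;n)}W_\lambda$.
   Formalization: The equality dim P = 2 dim P' is claimed only for n ≥ 2, since for n = 1 one has A_1 = S_1 and P = P' is one-dimensional, so the equality fails; all other assertions are kept for every n ≥ 1. *)

theory Defs
  imports
    Complex_Main
    "HOL-Library.Function_Algebras"
    "HOL-Combinatorics.Permutations"
    "HOL-Algebra.Ideal"
    "HOL-Algebra.Sym_Groups"
begin

section \<open>Vector spaces\<close>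

definition has_dimension ::
  "(complex \<Rightarrow> 'a::ab_group_add \<Rightarrow> 'a) \<Rightarrow> 'a set \<Rightarrow> nat \<Rightarrow> bool" where
  "has_dimension s W d \<longleftrightarrow>
     (\<exists>B. finite B \<and> card B = d \<and> \<not> Modules.module.dependent s B \<and> Modules.module.span s B = W)"

definition direct_sum_of ::
  "(complex \<Rightarrow> 'a::ab_group_add \<Rightarrow> 'a) \<Rightarrow> 'a set \<Rightarrow> 'a set \<Rightarrow> 'a set \<Rightarrow> bool" where
  "direct_sum_of s W A B \<longleftrightarrow>
     Modules.module.subspace s A \<and> Modules.module.subspace s B \<and>
     A \<inter> B = {0} \<and> W = {a + b |a b. a \<in> A \<and> b \<in> B}"

definition sum_of_subspaces ::
  "(complex \<Rightarrow> 'a::ab_group_add \<Rightarrow> 'a) \<Rightarrow> 'a set set \<Rightarrow> 'a set" where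
  "sum_of_subspaces s \<W> = Modules.module.span s (\<Union>\<W>)"

text \<open>Pointwise scaling, for linear maps and for elements of the group algebra.\<close>

definition fun_scale :: "(complex \<Rightarrow> 'b \<Rightarrow> 'b) \<Rightarrow> complex \<Rightarrow> ('a \<Rightarrow> 'b) \<Rightarrow> 'a \<Rightarrow> 'b" where
  "fun_scale s c f = (\<lambda>x. s c (f x))"

lemma vector_space_fun_scale:
  assumes "vector_space s"
  shows "vector_space (fun_scale s)"
proof -
  interpret vector_space s by fact
  show ?thesis
    by unfold_locales
      (auto simp: fun_scale_def fun_eq_iff scale_right_distrib scale_left_distrib)
qed


section \<open>Tensor powers\<close>

text \<open>
  A family $(v_1,\dots,v_n)$ is a function on \<^typ>\<open>nat\<close> of which only the values on
  \<open>{1..n}\<close> count.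
\<close>

definition multilinear_map ::
  "nat \<Rightarrow> (complex \<Rightarrow> 'v::ab_group_add \<Rightarrow> 'v) \<Rightarrow> (complex \<Rightarrow> 'w::ab_group_add \<Rightarrow> 'w)
     \<Rightarrow> ((nat \<Rightarrow> 'v) \<Rightarrow> 'w) \<Rightarrow> bool" where
  "multilinear_map n s s' f \<longleftrightarrow>
     (\<forall>v w. (\<forall>i\<in>{1..n}. v i = w i) \<longrightarrow> f v = f w) \<and>
     (\<forall>v. \<forall>i\<in>{1..n}. Vector_Spaces.linear s s' (\<lambda>x. f (v(i := x))))"

text \<open>
  The type \<open>'t\<close> with the map \<open>\<tau>\<close>, written $(v_1,\dots,v_n)\mapsto v_1\otimes\cdots\otimes v_n$,
  is the \<open>n\<close>-th tensor power of \<open>'v\<close>. The universal property is required for multilinear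
  forms only, since one cannot quantify over types. Over a field this loses nothing: the
  canonical map from the tensor power to \<open>'t\<close> has a bijective dual, hence is bijective.
\<close>

definition is_tensor_power ::
  "nat \<Rightarrow> (complex \<Rightarrow> 'v::ab_group_add \<Rightarrow> 'v) \<Rightarrow> (complex \<Rightarrow> 't::ab_group_add \<Rightarrow> 't)
     \<Rightarrow> ((nat \<Rightarrow> 'v) \<Rightarrow> 't) \<Rightarrow> bool" where
  "is_tensor_power n sV sT \<tau> \<longleftrightarrow>
     multilinear_map n sV sT \<tau> \<and>
     (\<forall>f::(nat \<Rightarrow> 'v) \<Rightarrow> complex. multilinear_map n sV (*) f \<longrightarrow>
        (\<exists>!g. Vector_Spaces.linear sT (*) g \<and> (\<forall>v. g (\<tau> v) = f v)))"


section \<open>The group algebras of the symmetric and the alternating group\<close>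

text \<open>
  Elements are functions vanishing outside the group. $\mathbb{C}A_n$ is a subring of
  $\mathbb{C}S_n$, so a $\mathbb{C}S_n$-module is restricted to $A_n$ without change of the
  underlying set.
\<close>

definition CS :: "nat \<Rightarrow> ((nat \<Rightarrow> nat) \<Rightarrow> complex) ring" where
  "CS n = \<lparr>carrier = {a. \<forall>g. g \<notin> carrier (sym_group n) \<longrightarrow> a g = 0},
           monoid.mult = (\<lambda>a b g. if g \<in> carrier (sym_group n)
                      then (\<Sum>h\<in>carrier (sym_group n). a h * b (inv\<^bsub>sym_group n\<^esub> h \<otimes>\<^bsub>sym_group n\<^esub> g))
                      else 0),
           one = (\<lambda>g. if g = \<one>\<^bsub>sym_group n\<^esub> then 1 else 0),
           zero = 0,
           add = (+)\<rparr>"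

definition CA :: "nat \<Rightarrow> ((nat \<Rightarrow> nat) \<Rightarrow> complex) ring" where
  "CA n = CS n \<lparr>carrier := {a. \<forall>g. g \<notin> carrier (alt_group n) \<longrightarrow> a g = 0}\<rparr>"

lemma ring_CS: "ring (CS n)"
proof -
  interpret G: group "sym_group n" by (rule sym_group_is_group)
  let ?S = "carrier (sym_group n)"
  have fin: "finite ?S" by (simp add: sym_group_def finite_permutations)
  have assoc: "(a \<otimes>\<^bsub>CS n\<^esub> b) \<otimes>\<^bsub>CS n\<^esub> c = a \<otimes>\<^bsub>CS n\<^esub> (b \<otimes>\<^bsub>CS n\<^esub> c)" for a b c
  proof
    fix g
    show "((a \<otimes>\<^bsub>CS n\<^esub> b) \<otimes>\<^bsub>CS n\<^esub> c) g = (a \<otimes>\<^bsub>CS n\<^esub> (b \<otimes>\<^bsub>CS n\<^esub> c)) g"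
    proof (cases "g \<in> ?S")
      case g: True
      have "(\<Sum>h\<in>?S. (\<Sum>u\<in>?S. a u * b (inv\<^bsub>sym_group n\<^esub> u \<otimes>\<^bsub>sym_group n\<^esub> h)) * c (inv\<^bsub>sym_group n\<^esub> h \<otimes>\<^bsub>sym_group n\<^esub> g))
          = (\<Sum>u\<in>?S. \<Sum>h\<in>?S. a u * b (inv\<^bsub>sym_group n\<^esub> u \<otimes>\<^bsub>sym_group n\<^esub> h) * c (inv\<^bsub>sym_group n\<^esub> h \<otimes>\<^bsub>sym_group n\<^esub> g))"
        by (subst sum.swap) (simp add: sum_distrib_right)
      also have "\<dots> = (\<Sum>u\<in>?S. \<Sum>h\<in>?S. a u * b h * c (inv\<^bsub>sym_group n\<^esub> h \<otimes>\<^bsub>sym_group n\<^esub> (inv\<^bsub>sym_group n\<^esub> u \<otimes>\<^bsub>sym_group n\<^esub> g)))"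
      proof (rule sum.cong[OF refl])
        fix u assume u: "u \<in> ?S"
        have key: "inv\<^bsub>sym_group n\<^esub> (inv\<^bsub>sym_group n\<^esub> u \<otimes>\<^bsub>sym_group n\<^esub> h) \<otimes>\<^bsub>sym_group n\<^esub> (inv\<^bsub>sym_group n\<^esub> u \<otimes>\<^bsub>sym_group n\<^esub> g)
            = inv\<^bsub>sym_group n\<^esub> h \<otimes>\<^bsub>sym_group n\<^esub> g" if h: "h \<in> ?S" for h
          using u g h
          by (metis G.inv_closed G.inv_inv G.inv_mult_group G.m_assoc G.m_closed G.l_one G.r_inv)
        have cancel: "u \<otimes>\<^bsub>sym_group n\<^esub> (inv\<^bsub>sym_group n\<^esub> u \<otimes>\<^bsub>sym_group n\<^esub> h) = h"
          "inv\<^bsub>sym_group n\<^esub> u \<otimes>\<^bsub>sym_group n\<^esub> (u \<otimes>\<^bsub>sym_group n\<^esub> h) = h" if "h \<in> ?S" for h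
          using u that by (simp_all add: G.m_assoc[symmetric] del: sym_group_inv_equality)
        show "(\<Sum>h\<in>?S. a u * b (inv\<^bsub>sym_group n\<^esub> u \<otimes>\<^bsub>sym_group n\<^esub> h) * c (inv\<^bsub>sym_group n\<^esub> h \<otimes>\<^bsub>sym_group n\<^esub> g))
            = (\<Sum>h\<in>?S. a u * b h * c (inv\<^bsub>sym_group n\<^esub> h \<otimes>\<^bsub>sym_group n\<^esub> (inv\<^bsub>sym_group n\<^esub> u \<otimes>\<^bsub>sym_group n\<^esub> g)))"
          by (rule sum.reindex_bij_witness[of _ "\<lambda>h. u \<otimes>\<^bsub>sym_group n\<^esub> h" "\<lambda>h. inv\<^bsub>sym_group n\<^esub> u \<otimes>\<^bsub>sym_group n\<^esub> h"])
            (use u g in \<open>auto simp: key cancel simp del: sym_group_inv_equality\<close>)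
      qed
      finally show ?thesis
        using g by (simp add: CS_def sum_distrib_left mult.assoc del: sym_group_inv_equality)
    qed (simp add: CS_def)
  qed
  have one_l: "\<one>\<^bsub>CS n\<^esub> \<otimes>\<^bsub>CS n\<^esub> a = a" if "a \<in> carrier (CS n)" for a
  proof
    fix g
    show "(\<one>\<^bsub>CS n\<^esub> \<otimes>\<^bsub>CS n\<^esub> a) g = a g"
      using that fin
      by (auto simp: CS_def if_distrib[of "\<lambda>x. x * _"] sum.delta
               simp del: sym_group_inv_equality cong: if_cong)
  qed
  have one_r: "a \<otimes>\<^bsub>CS n\<^esub> \<one>\<^bsub>CS n\<^esub> = a" if "a \<in> carrier (CS n)" for a
  proof
    fix g
    have "inv\<^bsub>sym_group n\<^esub> h \<otimes>\<^bsub>sym_group n\<^esub> g = \<one>\<^bsub>sym_group n\<^esub> \<longleftrightarrow> h = g" if "h \<in> ?S" "g \<in> ?S" for h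
      using that by (metis G.inv_closed G.inv_equality G.inv_inv G.l_inv)
    then show "(a \<otimes>\<^bsub>CS n\<^esub> \<one>\<^bsub>CS n\<^esub>) g = a g"
      using that fin
      by (auto simp: CS_def if_distrib[of "\<lambda>x. _ * x"] sum.delta
               simp del: sym_group_inv_equality cong: if_cong)
  qed
  show ?thesis
  proof (rule ringI)
    show "abelian_group (CS n)"
    proof (rule abelian_groupI)
      fix x assume "x \<in> carrier (CS n)"
      then show "\<exists>y\<in>carrier (CS n). y \<oplus>\<^bsub>CS n\<^esub> x = \<zero>\<^bsub>CS n\<^esub>"
        by (intro bexI[of _ "- x"]) (auto simp: CS_def)
    qed (auto simp: CS_def)
    show "monoid (CS n)"
      using assoc one_l one_r by unfold_locales (auto simp: CS_def)
  qed (auto simp: CS_def fun_eq_iff algebra_simps sum.distrib)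
qed

lemma ring_CA: "ring (CA n)"
proof -
  interpret R: ring "CS n" by (rule ring_CS)
  interpret G: group "sym_group n" by (rule sym_group_is_group)
  interpret H: group "alt_group n" by (rule alt_group_is_group)
  have sub: "carrier (CA n) \<subseteq> carrier (CS n)"
    by (auto simp: CA_def CS_def sym_group_def alt_group_def)
  have closed: "a \<otimes>\<^bsub>CS n\<^esub> b \<in> carrier (CA n)"
    if a: "a \<in> carrier (CA n)" and b: "b \<in> carrier (CA n)" for a b
  proof -
    have "a h * b (inv\<^bsub>sym_group n\<^esub> h \<otimes>\<^bsub>sym_group n\<^esub> g) = 0"
      if g: "g \<in> carrier (sym_group n)" "g \<notin> carrier (alt_group n)"
        and h: "h \<in> carrier (sym_group n)" for g h
    proof (rule ccontr)
      assume nz: "\<not> ?thesis"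
      let ?k = "inv\<^bsub>sym_group n\<^esub> h \<otimes>\<^bsub>sym_group n\<^esub> g"
      have k: "h \<in> carrier (alt_group n)" "?k \<in> carrier (alt_group n)"
        using nz a b by (auto simp: CA_def)
      have "h \<otimes>\<^bsub>sym_group n\<^esub> ?k \<in> carrier (alt_group n)"
        using H.m_closed[OF k] by (simp add: alt_group_def)
      moreover have "h \<otimes>\<^bsub>sym_group n\<^esub> ?k = g"
        using g(1) h by (simp add: G.m_assoc[symmetric] del: sym_group_inv_equality)
      ultimately show False using g(2) by simp
    qed
    moreover have "a \<otimes>\<^bsub>CS n\<^esub> b \<in> carrier (CS n)"
      using a b sub by blast
    ultimately show ?thesis
      by (auto simp: CA_def CS_def intro!: sum.neutral)
  qed
  show ?thesis
  proof (rule ringI)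
    show "abelian_group (CA n)"
    proof (rule abelian_groupI)
      fix x assume "x \<in> carrier (CA n)"
      then show "\<exists>y\<in>carrier (CA n). y \<oplus>\<^bsub>CA n\<^esub> x = \<zero>\<^bsub>CA n\<^esub>"
        by (intro bexI[of _ "- x"]) (auto simp: CA_def CS_def)
    qed (auto simp: CA_def CS_def)
    have one: "\<one>\<^bsub>CS n\<^esub> \<in> carrier (CA n)"
      using H.one_closed by (auto simp: CA_def CS_def alt_group_def)
    show "monoid (CA n)"
      using one closed sub R.m_assoc
      by unfold_locales (auto simp: CA_def subset_iff)
  qed (use sub R.l_distr R.r_distr in \<open>auto simp: CA_def subset_iff\<close>)
qed


subsection \<open>Modules and simple components\<close>

text \<open>
  Here \<open>R\<close> is $\mathbb{C}S_n$ and \<open>A\<close> is $\mathbb{C}S_n$ or $\mathbb{C}A_n$; the modules are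
  subsets of \<open>R\<close> on which \<open>A\<close> acts by left multiplication. As \<open>A\<close> contains the scalars,
  additive subgroups closed under \<open>A\<close> are subspaces and \<open>A\<close>-equivariant additive maps
  are linear.
\<close>

definition left_submodule :: "('a, 'm) ring_scheme \<Rightarrow> 'a set \<Rightarrow> 'a set \<Rightarrow> bool" where
  "left_submodule R A U \<longleftrightarrow>
     additive_subgroup U R \<and> (\<forall>a\<in>A. \<forall>u\<in>U. a \<otimes>\<^bsub>R\<^esub> u \<in> U)"

definition irreducible_submodule :: "('a, 'm) ring_scheme \<Rightarrow> 'a set \<Rightarrow> 'a set \<Rightarrow> bool" where
  "irreducible_submodule R A U \<longleftrightarrow>
     left_submodule R A U \<and> U \<noteq> {\<zero>\<^bsub>R\<^esub>} \<and>
     (\<forall>U'. left_submodule R A U' \<and> U' \<subseteq> U \<longrightarrow> U' = {\<zero>\<^bsub>R\<^esub>} \<or> U' = U)"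

definition isomorphic_submodules ::
  "('a, 'm) ring_scheme \<Rightarrow> 'a set \<Rightarrow> 'a set \<Rightarrow> 'a set \<Rightarrow> bool" where
  "isomorphic_submodules R A U U' \<longleftrightarrow>
     (\<exists>f. bij_betw f U U' \<and>
          (\<forall>u\<in>U. \<forall>w\<in>U. f (u \<oplus>\<^bsub>R\<^esub> w) = f u \<oplus>\<^bsub>R\<^esub> f w) \<and>
          (\<forall>a\<in>A. \<forall>u\<in>U. f (a \<otimes>\<^bsub>R\<^esub> u) = a \<otimes>\<^bsub>R\<^esub> f u))"

definition simple_ideal :: "'a set \<Rightarrow> ('a, 'm) ring_scheme \<Rightarrow> bool" where
  "simple_ideal J A \<longleftrightarrow>
     ideal J A \<and> J \<noteq> {\<zero>\<^bsub>A\<^esub>} \<and>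
     (\<forall>J'. ideal J' A \<and> J' \<subseteq> J \<longrightarrow> J' = {\<zero>\<^bsub>A\<^esub>} \<or> J' = J)"

text \<open>
  The irreducible module of a simple two-sided ideal is any of the minimal left ideals
  contained in it.
\<close>

definition irreducible_module_of :: "'a set \<Rightarrow> ('a, 'm) ring_scheme \<Rightarrow> 'a set \<Rightarrow> bool" where
  "irreducible_module_of J A L \<longleftrightarrow> L \<subseteq> J \<and> irreducible_submodule A (carrier A) L"


section \<open>Partitions and Specht modules\<close>

text \<open>
  Rows, columns and parts are indexed from \<open>0\<close>: the part $\mu_i$ of the usual notation
  is \<open>\<mu> (i - 1)\<close>.
\<close>

definition partitions_of :: "nat \<Rightarrow> (nat \<Rightarrow> nat) set" where
  "partitions_of n =
     {\<mu>. antimono \<mu> \<and> finite {i. \<mu> i \<noteq> 0} \<and> (\<Sum>i | \<mu> i \<noteq> 0. \<mu> i) = n}"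

definition conjugate :: "(nat \<Rightarrow> nat) \<Rightarrow> nat \<Rightarrow> nat" where
  "conjugate \<mu> j = card {i. j < \<mu> i}"

definition diagram :: "(nat \<Rightarrow> nat) \<Rightarrow> (nat \<times> nat) set" where
  "diagram \<mu> = {(i, j). j < \<mu> i}"

text \<open>The tableau filled with $1,\dots,n$ row by row.\<close>

definition tableau :: "(nat \<Rightarrow> nat) \<Rightarrow> nat \<times> nat \<Rightarrow> nat" where
  "tableau \<mu> = (\<lambda>(i, j). (\<Sum>r<i. \<mu> r) + j + 1)"

definition row_group :: "nat \<Rightarrow> (nat \<Rightarrow> nat) \<Rightarrow> (nat \<Rightarrow> nat) set" where
  "row_group n \<mu> = {g \<in> carrier (sym_group n).
     \<forall>i j. (i, j) \<in> diagram \<mu> \<longrightarrow>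
       (\<exists>j'. (i, j') \<in> diagram \<mu> \<and> g (tableau \<mu> (i, j)) = tableau \<mu> (i, j'))}"

definition column_group :: "nat \<Rightarrow> (nat \<Rightarrow> nat) \<Rightarrow> (nat \<Rightarrow> nat) set" where
  "column_group n \<mu> = {g \<in> carrier (sym_group n).
     \<forall>i j. (i, j) \<in> diagram \<mu> \<longrightarrow>
       (\<exists>i'. (i', j) \<in> diagram \<mu> \<and> g (tableau \<mu> (i, j)) = tableau \<mu> (i', j))}"

definition young_symmetrizer :: "nat \<Rightarrow> (nat \<Rightarrow> nat) \<Rightarrow> (nat \<Rightarrow> nat) \<Rightarrow> complex" where
  "young_symmetrizer n \<mu> =
     (\<lambda>g. if g \<in> row_group n \<mu> then 1 else 0) \<otimes>\<^bsub>CS n\<^esub>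
     (\<lambda>g. if g \<in> column_group n \<mu> then of_int (sign g) else 0)"

text \<open>
  $S^\mu=\mathbb{C}S_n\,c_\mu$. In this convention $S^{(n)}$ is the trivial and
  $S^{(1^n)}$ the sign representation.
\<close>

definition specht :: "nat \<Rightarrow> (nat \<Rightarrow> nat) \<Rightarrow> ((nat \<Rightarrow> nat) \<Rightarrow> complex) set" where
  "specht n \<mu> = {a \<otimes>\<^bsub>CS n\<^esub> young_symmetrizer n \<mu> |a. a \<in> carrier (CS n)}"

definition I_comp :: "nat \<Rightarrow> (nat \<Rightarrow> nat) \<Rightarrow> ((nat \<Rightarrow> nat) \<Rightarrow> complex) set" where
  "I_comp n \<mu> = (THE I. simple_ideal I (CS n) \<and>
     (\<exists>L. irreducible_module_of I (CS n) L \<and>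
          isomorphic_submodules (CS n) (carrier (CS n)) L (specht n \<mu>)))"

text \<open>
  By semisimplicity, the constituents of a module are its irreducible submodules up to
  isomorphism.
\<close>

definition J_bar :: "nat \<Rightarrow> (nat \<Rightarrow> nat) set \<Rightarrow> ((nat \<Rightarrow> nat) \<Rightarrow> complex) set" where
  "J_bar n X = sum_of_subspaces (fun_scale (*))
     {J. simple_ideal J (CA n) \<and>
         (\<exists>\<mu>\<in>X. \<exists>L U. irreducible_module_of J (CA n) L \<and>
            U \<subseteq> specht n \<mu> \<and> irreducible_submodule (CS n) (carrier (CA n)) U \<and>
            isomorphic_submodules (CS n) (carrier (CA n)) L U)}"

text \<open>\<open>\<mu> k\<close> is the part $\mu_{k+1}$.\<close>

definition hook :: "nat \<Rightarrow> nat \<Rightarrow> nat \<Rightarrow> (nat \<Rightarrow> nat) set" where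
  "hook k l n = {\<mu> \<in> partitions_of n. \<mu> k \<le> l}"

definition hook0 :: "nat \<Rightarrow> nat \<Rightarrow> nat \<Rightarrow> (nat \<Rightarrow> nat) set" where
  "hook0 k l n = {\<mu> \<in> hook k l n. conjugate \<mu> \<in> hook k l n}"

definition hook1 :: "nat \<Rightarrow> nat \<Rightarrow> nat \<Rightarrow> (nat \<Rightarrow> nat) set" where
  "hook1 k l n = hook k l n - hook0 k l n"


section \<open>The sign permutation action\<close>

definition super_degree :: "'v set \<Rightarrow> 'v \<Rightarrow> nat" where
  "super_degree V0 v = (if v \<in> V0 then 0 else 1)"

definition koszul_sign :: "nat \<Rightarrow> 'v set \<Rightarrow> (nat \<Rightarrow> nat) \<Rightarrow> (nat \<Rightarrow> 'v) \<Rightarrow> complex" where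
  "koszul_sign n V0 \<sigma> v =
     (\<Prod>(i, j) \<in> {(i, j). i \<in> {1..n} \<and> j \<in> {1..n} \<and> i < j \<and> \<sigma> i > \<sigma> j}.
        (-1) ^ (super_degree V0 (v i) * super_degree V0 (v j)))"

definition sign_perm ::
  "nat \<Rightarrow> (complex \<Rightarrow> 't::ab_group_add \<Rightarrow> 't) \<Rightarrow> ((nat \<Rightarrow> 'v) \<Rightarrow> 't) \<Rightarrow> 'v set \<Rightarrow> 'v set
     \<Rightarrow> (nat \<Rightarrow> nat) \<Rightarrow> 't \<Rightarrow> 't" where
  "sign_perm n sT \<tau> V0 V1 \<sigma> = (THE F. Vector_Spaces.linear sT sT F \<and>
     (\<forall>v. (\<forall>i\<in>{1..n}. v i \<in> V0 \<union> V1) \<longrightarrow>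
        F (\<tau> v) = sT (koszul_sign n V0 \<sigma> v) (\<tau> (\<lambda>i. v (Hilbert_Choice.inv \<sigma> i)))))"

definition sign_rep ::
  "nat \<Rightarrow> (complex \<Rightarrow> 't::ab_group_add \<Rightarrow> 't) \<Rightarrow> ((nat \<Rightarrow> 'v) \<Rightarrow> 't) \<Rightarrow> 'v set \<Rightarrow> 'v set
     \<Rightarrow> ((nat \<Rightarrow> nat) \<Rightarrow> complex) \<Rightarrow> 't \<Rightarrow> 't" where
  "sign_rep n sT \<tau> V0 V1 a =
     (\<lambda>w. \<Sum>\<sigma>\<in>carrier (sym_group n). sT (a \<sigma>) (sign_perm n sT \<tau> V0 V1 \<sigma> w))"

text \<open>
  The linear endomorphisms of the subspace \<open>W\<close> that commute with \<open>\<rho> g\<close> for all \<open>g \<in> G\<close>,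
  as functions with the conventional value \<^term>\<open>undefined\<close> outside \<open>W\<close>.
\<close>

definition equivariant_End ::
  "(complex \<Rightarrow> 't::ab_group_add \<Rightarrow> 't) \<Rightarrow> ('g \<Rightarrow> 't \<Rightarrow> 't) \<Rightarrow> 'g set \<Rightarrow> 't set \<Rightarrow> ('t \<Rightarrow> 't) set"
  where
  "equivariant_End s \<rho> G W =
     {f \<in> extensional W. f ` W \<subseteq> W \<and>
        (\<forall>x\<in>W. \<forall>y\<in>W. f (x + y) = f x + f y) \<and>
        (\<forall>c. \<forall>x\<in>W. f (s c x) = s c (f x)) \<and>
        (\<forall>g\<in>G. \<forall>x\<in>W. f (\<rho> g x) = \<rho> g (f x))}"

definition isotypic_sum ::
  "(complex \<Rightarrow> 't::ab_group_add \<Rightarrow> 't) \<Rightarrow> ('a \<Rightarrow> 't \<Rightarrow> 't) \<Rightarrow> ('p \<Rightarrow> 'a set) \<Rightarrow> 'p set \<Rightarrow> 't set"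
  where
  "isotypic_sum s \<phi> I X =
     sum_of_subspaces s ((\<lambda>p. Modules.module.span s {\<phi> a w |a w. a \<in> I p}) ` X)"

text \<open>
  Restriction to invariant subspaces is compatible with sums, scalars and composition, so
  bijectivity makes it an isomorphism of algebras from \<open>E\<close> onto \<open>EP \<times> EQ\<close>.
\<close>

definition restricts_to_sum ::
  "('t \<Rightarrow> 't) set \<Rightarrow> 't set \<Rightarrow> ('t \<Rightarrow> 't) set \<Rightarrow> 't set \<Rightarrow> ('t \<Rightarrow> 't) set \<Rightarrow> bool" where
  "restricts_to_sum E WP EP WQ EQ \<longleftrightarrow>
     bij_betw (\<lambda>f. (restrict f WP, restrict f WQ)) E (EP \<times> EQ)"

end

theory Submission
  imports Defs
begin

text \<open>
  The ideals generated by the Young symmetrizers are the simple components of $\mathbb{C}S_n$;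
  twisting by the sign character exchanges the components of $\lambda$ and $\lambda'$, and
  $\bar J(X)$ consists of the elements of $\mathbb{C}A_n$ lying in the components of
  $X\cup X'$.

  If $\lambda$ contains the cell in row $k+1$ and column $l+1$, straightening with Garnir
  relations moves the even symbols of a tensor into the first $k$ rows, so that some row has two
  equal odd symbols and the symmetrizer kills the tensor. Otherwise the tensor with the even
  symbol $e_i$ throughout row $i\le k$ and the odd symbol $f_j$ in the cells of column $j$ below
  is not killed. Hence $\varphi^*$ is faithful on the components of $H_0$, which is closed under
  conjugation, and these split evenly over $A_n$. For $\lambda\in H_1$ it kills the component of
  $\lambda'$, so an element of $I_\lambda$ and its sum with its twist have the same image; this
  gives $Q'=Q$. The central idempotent of $H_0$ lies in $\mathbb{C}A_n$ and projects
  $V^{\otimes n}$ onto $W_P$ along $W_Q$, which yields part (b).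
\<close>


section \<open>The group algebra\<close>

text \<open>That there are no simple components beyond those of the partitions is usually read off
  from a count of conjugacy classes. Here it rests on a numerical squeeze: on a minimal ideal the
  sum of all transpositions acts by a scalar that can be computed from a row colouring and, after
  the sign twist, from a column colouring. Two inequalities between these colourings add up to the
  resulting identity, so both are equalities. Completeness makes the idempotents sum to 1, and hence
  makes the two hook idempotents act as complementary projections.

  Nondegeneracy comes from positivity: over the complex numbers, the product of the adjoint of x
  with x vanishes only for x = 0. This yields nonzero squares of Young symmetrizers and irreducible
  Specht modules without traces or dimensions.

  Isomorphism classes of modules enter only through the definitions of \<open>I_comp\<close> and
  \<open>J_bar\<close>. The first is replaced by the ideal of a Young symmetrizer, the second by an
  equation with a central idempotent; from then on everything is computation with
  idempotents.\<close>

locale sym_algebra = fixes n :: nat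
begin

definition Sym :: "(nat \<Rightarrow> nat) set" where
  "Sym = {p. p permutes {1..n}}"

abbreviation scaled (infixr "\<odot>" 75) where
  "c \<odot> x \<equiv> fun_scale (*) (c::complex) x"

definition star (infixl "\<star>" 70) where
  "x \<star> y = x \<otimes>\<^bsub>CS n\<^esub> y"

definition delta :: "(nat \<Rightarrow> nat) \<Rightarrow> (nat \<Rightarrow> nat) \<Rightarrow> complex" where
  "delta g = (\<lambda>h. if h = g then 1 else 0)"

definition supp :: "(nat \<Rightarrow> nat) set \<Rightarrow> ((nat \<Rightarrow> nat) \<Rightarrow> complex) set" where
  "supp H = {x. \<forall>g. g \<notin> H \<longrightarrow> x g = 0}"

text \<open>Left multiplication by \<open>adj x\<close> is the adjoint of left multiplication by
  \<open>x\<close> for the Hermitian form in which the permutations are orthonormal.\<close>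

definition adj :: "((nat \<Rightarrow> nat) \<Rightarrow> complex) \<Rightarrow> (nat \<Rightarrow> nat) \<Rightarrow> complex" where
  "adj x = (\<lambda>g. if g \<in> Sym then cnj (x (inv' g)) else 0)"

definition twist :: "((nat \<Rightarrow> nat) \<Rightarrow> complex) \<Rightarrow> (nat \<Rightarrow> nat) \<Rightarrow> complex" where
  "twist x = (\<lambda>g. of_int (sign g) * x g)"

sublocale FV: vector_space "fun_scale ((*) :: complex \<Rightarrow> complex \<Rightarrow> complex)"
  by (rule vector_space_fun_scale) (unfold_locales, auto simp: algebra_simps)

lemma finite_Sym [simp]: "finite Sym"
  by (simp add: Sym_def finite_permutations)

lemma carrier_sym: "carrier (sym_group n) = Sym"
  by (simp add: Sym_def sym_group_def)

lemma CS_carrier: "carrier (CS n) = supp Sym"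
  by (simp add: CS_def supp_def carrier_sym)

lemma CA_carrier: "carrier (CA n) = supp (carrier (alt_group n))"
  by (simp add: CA_def CS_def supp_def)

lemma star_eval:
  "(x \<star> y) g = (if g \<in> Sym then \<Sum>h\<in>Sym. x h * y (inv' h \<circ> g) else 0)"
  by (auto simp: star_def CS_def carrier_sym sym_group_mult intro!: sum.cong)

lemma star_supp [simp]: "x \<star> y \<in> supp Sym"
  by (simp add: supp_def star_eval)

lemma Sym_inv [simp]: "g \<in> Sym \<Longrightarrow> inv' g \<in> Sym"
  by (simp add: Sym_def permutes_inv)

lemma Sym_comp [simp]: "g \<in> Sym \<Longrightarrow> h \<in> Sym \<Longrightarrow> g \<circ> h \<in> Sym"
  by (simp add: Sym_def permutes_compose)

lemma Sym_id [simp]: "id \<in> Sym"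
  by (simp add: Sym_def permutes_id)

lemma Sym_inv_inv [simp]: "g \<in> Sym \<Longrightarrow> inv' (inv' g) = g"
  by (simp add: Sym_def permutes_inv_inv)

lemma Sym_inv_comp [simp]:
  "g \<in> Sym \<Longrightarrow> inv' g \<circ> g = id" "g \<in> Sym \<Longrightarrow> g \<circ> inv' g = id"
  by (auto simp: Sym_def permutes_inv_o)

lemma Sym_cancel [simp]:
  "g \<in> Sym \<Longrightarrow> inv' g \<circ> (g \<circ> h) = h" "g \<in> Sym \<Longrightarrow> g \<circ> (inv' g \<circ> h) = h"
  by (auto simp: Sym_def permutes_inv_o comp_assoc[symmetric])

lemma Sym_cancel_app [simp]:
  "g \<in> Sym \<Longrightarrow> inv' g (g x) = x" "g \<in> Sym \<Longrightarrow> g (inv' g x) = x"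
  by (auto simp: Sym_def permutes_inverses)

lemma Sym_inv_distrib:
  "g \<in> Sym \<Longrightarrow> h \<in> Sym \<Longrightarrow> inv' (g \<circ> h) = inv' h \<circ> inv' g"
  by (metis Sym_def mem_Collect_eq o_inv_distrib permutes_bij)

lemma Sym_permutation: "g \<in> Sym \<Longrightarrow> permutation g"
  unfolding Sym_def permutation_permutes by auto

text \<open>No carrier conditions occur: \<open>\<star>\<close> reads its arguments only on
  \<open>Sym\<close>, which is closed under products and inverses. Rewriting with associativity is
  therefore unconditional.\<close>

lemma star_assoc: "x \<star> y \<star> z = x \<star> (y \<star> z)"
proof
  fix g
  show "(x \<star> y \<star> z) g = (x \<star> (y \<star> z)) g"
  proof (cases "g \<in> Sym")
    case g: True
    have "(x \<star> y \<star> z) g = (\<Sum>h\<in>Sym. \<Sum>u\<in>Sym. x u * y (inv' u \<circ> h) * z (inv' h \<circ> g))"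
      using g by (auto simp: star_eval sum_distrib_right intro!: sum.cong)
    also have "\<dots> = (\<Sum>u\<in>Sym. \<Sum>h\<in>Sym. x u * y (inv' u \<circ> h) * z (inv' h \<circ> g))"
      by (rule sum.swap)
    also have "\<dots> = (\<Sum>u\<in>Sym. \<Sum>h\<in>Sym. x u * y h * z (inv' h \<circ> (inv' u \<circ> g)))"
    proof (rule sum.cong[OF refl])
      fix u assume u: "u \<in> Sym"
      show "(\<Sum>h\<in>Sym. x u * y (inv' u \<circ> h) * z (inv' h \<circ> g))
          = (\<Sum>h\<in>Sym. x u * y h * z (inv' h \<circ> (inv' u \<circ> g)))"
        by (rule sum.reindex_bij_witness[of _ "\<lambda>h. u \<circ> h" "\<lambda>h. inv' u \<circ> h"])
          (use u in \<open>auto simp: Sym_inv_distrib comp_assoc\<close>)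
    qed
    also have "\<dots> = (x \<star> (y \<star> z)) g"
      using g by (auto simp: star_eval sum_distrib_left mult.assoc intro!: sum.cong)
    finally show ?thesis .
  qed (simp add: star_eval)
qed

lemma star_add_left: "(x + y) \<star> z = x \<star> z + y \<star> z"
  by (rule ext) (simp add: star_eval algebra_simps sum.distrib)

lemma star_add_right: "z \<star> (x + y) = z \<star> x + z \<star> y"
  by (rule ext) (simp add: star_eval algebra_simps sum.distrib)

lemma star_scale_left [simp]: "(c \<odot> x) \<star> z = c \<odot> (x \<star> z)"
  by (rule ext) (simp add: star_eval fun_scale_def sum_distrib_left mult.assoc)

lemma star_scale_right [simp]: "z \<star> (c \<odot> x) = c \<odot> (z \<star> x)"
  by (rule ext) (simp add: star_eval fun_scale_def sum_distrib_left algebra_simps)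

lemma star_zero [simp]: "0 \<star> z = 0" "z \<star> 0 = 0"
  by (rule ext, simp add: star_eval)+

lemma star_minus_left: "(- x) \<star> z = - (x \<star> z)"
  by (rule ext) (simp add: star_eval sum_negf)

lemma star_minus_right: "z \<star> (- x) = - (z \<star> x)"
  by (rule ext) (simp add: star_eval sum_negf)

lemma star_diff_left: "(x - y) \<star> z = x \<star> z - y \<star> z"
  using star_add_left[of x "- y"] star_minus_left by simp

lemma star_diff_right: "z \<star> (x - y) = z \<star> x - z \<star> y"
  using star_add_right[of z x "- y"] star_minus_right by simp

lemma star_sum_left: "(\<Sum>i\<in>A. f i) \<star> z = (\<Sum>i\<in>A. f i \<star> z)"
  by (induction A rule: infinite_finite_induct) (simp_all only: sum.infinite sum.empty sum.insert star_zero star_add_left not_False_eq_True)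

lemma star_sum_right: "z \<star> (\<Sum>i\<in>A. f i) = (\<Sum>i\<in>A. z \<star> f i)"
  by (induction A rule: infinite_finite_induct) (simp_all only: sum.infinite sum.empty sum.insert star_zero star_add_right not_False_eq_True)

lemma delta_star_eval:
  assumes "g \<in> Sym"
  shows "(delta g \<star> x) k = (if k \<in> Sym then x (inv' g \<circ> k) else 0)"
proof -
  have "(\<Sum>h\<in>Sym. delta g h * x (inv' h \<circ> k)) = (\<Sum>h\<in>Sym. if h = g then x (inv' g \<circ> k) else 0)"
    by (intro sum.cong) (auto simp: delta_def)
  also have "\<dots> = x (inv' g \<circ> k)"
    using assms by (simp add: sum.delta)
  finally show ?thesis by (simp add: star_eval)
qed

lemma star_delta_eval:
  assumes "g \<in> Sym"
  shows "(x \<star> delta g) k = (if k \<in> Sym then x (k \<circ> inv' g) else 0)"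
proof (cases "k \<in> Sym")
  case k: True
  have eq: "inv' h \<circ> k = g \<longleftrightarrow> h = k \<circ> inv' g" if "h \<in> Sym" for h
  proof
    assume "inv' h \<circ> k = g"
    then have "g \<circ> inv' k = inv' h"
      using k by (metis Sym_inv_comp(2) comp_assoc comp_id)
    then show "h = k \<circ> inv' g"
      using k that assms by (metis Sym_inv Sym_inv_distrib Sym_inv_inv)
  next
    assume "h = k \<circ> inv' g"
    then show "inv' h \<circ> k = g"
      using k assms by (simp add: Sym_inv_distrib comp_assoc)
  qed
  have "(\<Sum>h\<in>Sym. x h * delta g (inv' h \<circ> k)) = (\<Sum>h\<in>Sym. if h = k \<circ> inv' g then x (k \<circ> inv' g) else 0)"
    by (intro sum.cong) (auto simp: delta_def eq)
  also have "\<dots> = x (k \<circ> inv' g)"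
    using assms k by (simp add: sum.delta)
  finally show ?thesis by (simp add: star_eval)
qed (simp add: star_eval)

lemma delta_star_delta:
  assumes "g \<in> Sym" "h \<in> Sym"
  shows "delta g \<star> delta h = delta (g \<circ> h)"
proof
  fix k
  have "inv' g \<circ> k = h \<longleftrightarrow> k = g \<circ> h"
    using assms(1) by (metis Sym_cancel)
  then show "(delta g \<star> delta h) k = delta (g \<circ> h) k"
    using assms by (simp add: delta_star_eval) (auto simp: delta_def)
qed

lemma star_one [simp]:
  assumes "x \<in> supp Sym"
  shows "delta id \<star> x = x" "x \<star> delta id = x"
  using assms by (auto simp: delta_star_eval[OF Sym_id] star_delta_eval[OF Sym_id] supp_def fun_eq_iff)

lemma delta_supp: "g \<in> H \<Longrightarrow> delta g \<in> supp H"
  by (auto simp: supp_def delta_def)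

lemma supp_mono: "H \<subseteq> K \<Longrightarrow> supp H \<subseteq> supp K"
  by (auto simp: supp_def)

lemma supp_subspace: "FV.subspace (supp H)"
  by (auto simp: FV.subspace_def supp_def fun_scale_def)

lemma supp_zero [simp]: "0 \<in> supp H"
  by (simp add: supp_def)

lemma supp_add: "x \<in> supp H \<Longrightarrow> y \<in> supp H \<Longrightarrow> x + y \<in> supp H"
  by (simp add: supp_def)

lemma supp_diff: "x \<in> supp H \<Longrightarrow> y \<in> supp H \<Longrightarrow> x - y \<in> supp H"
  by (simp add: supp_def)

lemma supp_sum: "(\<And>i. i \<in> A \<Longrightarrow> f i \<in> supp H) \<Longrightarrow> sum f A \<in> supp H"
  by (rule FV.subspace_sum[OF supp_subspace])

lemma sum_fun_apply: "(\<Sum>i\<in>A. f i) x = (\<Sum>i\<in>A. f i x)"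
  for f :: "'i \<Rightarrow> 'j \<Rightarrow> complex"
  by (induction A rule: infinite_finite_induct) auto

lemma supp_expand:
  assumes "x \<in> supp H" "finite H"
  shows "x = (\<Sum>g\<in>H. x g \<odot> delta g)"
proof
  fix k
  have "(\<Sum>g\<in>H. x g \<odot> delta g) k = (\<Sum>g\<in>H. if k = g then x k else 0)"
    unfolding sum_fun_apply by (intro sum.cong) (auto simp: fun_scale_def delta_def)
  also have "\<dots> = x k"
    using assms by (auto simp: sum.delta' supp_def)
  finally show "x k = (\<Sum>g\<in>H. x g \<odot> delta g) k" ..
qed

section \<open>The conjugate-linear anti-involution and positivity\<close>

lemma adj_star:
  assumes "x \<in> supp Sym"
  shows "adj (x \<star> y) = adj y \<star> adj x"
proof
  fix g
  show "adj (x \<star> y) g = (adj y \<star> adj x) g"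
  proof (cases "g \<in> Sym")
    case g: True
    have "(\<Sum>h\<in>Sym. cnj (x h) * cnj (y (inv' h \<circ> inv' g))) = (\<Sum>h\<in>Sym. cnj (y (inv' h)) * cnj (x (inv' (inv' h \<circ> g))))"
      by (rule sum.reindex_bij_witness[of _ "\<lambda>h. inv' g \<circ> h" "\<lambda>h. g \<circ> h"])
        (use g in \<open>auto simp: Sym_inv_distrib comp_assoc\<close>)
    then show ?thesis
      using g by (simp add: adj_def star_eval cnj_sum)
  qed (simp add: adj_def star_eval)
qed

lemma adj_supp [simp]: "adj x \<in> supp Sym"
  by (simp add: adj_def supp_def)

lemma adj_adj: "x \<in> supp Sym \<Longrightarrow> adj (adj x) = x"
  by (auto simp: adj_def supp_def fun_eq_iff)

text \<open>The coefficient of the identity in \<open>adj x \<star> x\<close> is the sum of the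
  squared moduli of the values of \<open>x\<close>.\<close>

lemma adj_star_self_eq_0:
  assumes "x \<in> supp Sym" "adj x \<star> x = 0"
  shows "x = 0"
proof -
  have "(adj x \<star> x) id = (\<Sum>h\<in>Sym. cnj (x (inv' h)) * x (inv' h))"
    by (simp add: star_eval adj_def)
  also have "\<dots> = (\<Sum>h\<in>Sym. cnj (x h) * x h)"
    by (rule sum.reindex_bij_witness[of _ "\<lambda>h. inv' h" "\<lambda>h. inv' h"]) auto
  also have "\<dots> = complex_of_real (\<Sum>h\<in>Sym. (cmod (x h))\<^sup>2)"
    by (simp only: of_real_sum complex_norm_square mult.commute)
  finally have "(\<Sum>h\<in>Sym. (cmod (x h))\<^sup>2) = 0"
    by (simp only: assms(2) zero_fun_apply of_real_eq_0_iff[symmetric, where ?'a = complex])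
  then have "\<forall>h\<in>Sym. x h = 0"
    by (simp add: sum_nonneg_eq_0_iff)
  then show ?thesis
    using assms(1) by (auto simp: supp_def fun_eq_iff)
qed

lemma star_adj_self_eq_0:
  assumes "x \<in> supp Sym" "x \<star> adj x = 0"
  shows "x = 0"
proof -
  have "adj x = 0"
    by (rule adj_star_self_eq_0) (use assms in \<open>auto simp: adj_adj\<close>)
  then have "adj (adj x) = 0"
    by (simp add: adj_def fun_eq_iff)
  then show ?thesis using assms(1) by (simp add: adj_adj)
qed

section \<open>The sign twist and the even subalgebra\<close>

lemma twist_star: "twist (x \<star> y) = twist x \<star> twist y"
proof
  fix g
  show "twist (x \<star> y) g = (twist x \<star> twist y) g"
  proof (cases "g \<in> Sym")
    case g: True
    have "sign g = sign h * sign (inv' h \<circ> g)" if "h \<in> Sym" for h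
      using g that sign_compose[of h "inv' h \<circ> g"] Sym_permutation by simp
    then have "of_int (sign g) * (x h * y (inv' h \<circ> g)) = of_int (sign h) * x h * (of_int (sign (inv' h \<circ> g)) * y (inv' h \<circ> g))"
      if "h \<in> Sym" for h
      using that by (simp add: mult_ac)
    then have "(\<Sum>h\<in>Sym. of_int (sign g) * (x h * y (inv' h \<circ> g)))
        = (\<Sum>h\<in>Sym. of_int (sign h) * x h * (of_int (sign (inv' h \<circ> g)) * y (inv' h \<circ> g)))"
      by (rule sum.cong[OF refl])
    then show ?thesis
      using g by (simp only: twist_def star_eval sum_distrib_left if_True)
  qed (simp add: twist_def star_eval)
qed

lemma twist_add: "twist (x + y) = twist x + twist y"
  by (simp add: twist_def fun_eq_iff algebra_simps)

lemma twist_scale: "twist (c \<odot> x) = c \<odot> twist x"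
  by (simp add: twist_def fun_eq_iff fun_scale_def)

lemma twist_zero [simp]: "twist 0 = 0"
  by (simp add: twist_def fun_eq_iff)

lemma twist_sum: "twist (\<Sum>i\<in>A. f i) = (\<Sum>i\<in>A. twist (f i))"
  by (induction A rule: infinite_finite_induct)
    (simp_all only: sum.infinite sum.empty sum.insert twist_zero twist_add not_False_eq_True)

lemma twist_twist [simp]: "twist (twist x) = x"
  by (simp add: twist_def fun_eq_iff mult.assoc[symmetric] flip: of_int_mult)

lemma twist_delta: "twist (delta g) = of_int (sign g) \<odot> delta g"
  by (rule ext) (simp add: twist_def fun_scale_def delta_def)

lemma twist_supp [simp]: "twist x \<in> supp H \<longleftrightarrow> x \<in> supp H"
  by (auto simp: twist_def supp_def)

definition Alt :: "(nat \<Rightarrow> nat) set" where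
  "Alt = carrier (alt_group n)"

lemma Alt_iff: "g \<in> Alt \<longleftrightarrow> g \<in> Sym \<and> sign g = 1"
  by (simp add: Alt_def Sym_def alt_group_carrier sign_def)

text \<open>A fixed point of the twist must vanish wherever the sign is -1. Evenness thus becomes an
  equation compatible with products, which is how even elements are recognised later.\<close>

lemma supp_Alt_iff: "x \<in> supp Alt \<longleftrightarrow> x \<in> supp Sym \<and> twist x = x"
proof
  assume x: "x \<in> supp Alt"
  then have "of_int (sign g) * x g = x g" for g
    by (cases "g \<in> Alt") (auto simp: Alt_iff supp_def)
  then show "x \<in> supp Sym \<and> twist x = x"
    using x by (auto simp: twist_def supp_def Alt_iff)
next
  assume x: "x \<in> supp Sym \<and> twist x = x"
  have "x g = 0" if "g \<notin> Alt" for g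
  proof (cases "g \<in> Sym")
    case True
    then have "sign g = - 1"
      using that by (simp add: Alt_iff sign_def split: if_splits)
    moreover have "twist x g = x g" using x by simp
    ultimately show ?thesis by (simp add: twist_def)
  qed (use x in \<open>auto simp: supp_def\<close>)
  then show "x \<in> supp Alt" by (simp add: supp_def)
qed

section \<open>Subgroup algebras, their submodules and their ideals\<close>

definition subgrp :: "(nat \<Rightarrow> nat) set \<Rightarrow> bool" where
  "subgrp H \<longleftrightarrow> H \<subseteq> Sym \<and> id \<in> H \<and> (\<forall>g\<in>H. \<forall>h\<in>H. g \<circ> h \<in> H) \<and> (\<forall>g\<in>H. inv' g \<in> H)"

lemma subgrp_Sym [simp]: "subgrp Sym"
  by (simp add: subgrp_def)

lemma subgrp_Alt [simp]: "subgrp Alt"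
  by (auto simp: subgrp_def Alt_iff sign_id sign_compose sign_inverse Sym_permutation)

lemma subgrp_supp_Sym: "subgrp H \<Longrightarrow> x \<in> supp H \<Longrightarrow> x \<in> supp Sym"
  using supp_mono by (auto simp: subgrp_def)

lemma subgrp_finite: "subgrp H \<Longrightarrow> finite H"
  using finite_subset[OF _ finite_Sym] by (auto simp: subgrp_def)

lemma supp_star:
  assumes "subgrp H" "x \<in> supp H" "y \<in> supp H"
  shows "x \<star> y \<in> supp H"
proof -
  have "x h * y (inv' h \<circ> g) = 0" if "g \<notin> H" "g \<in> Sym" "h \<in> Sym" for g h
  proof (rule ccontr)
    assume "\<not> ?thesis"
    then have "h \<in> H" "inv' h \<circ> g \<in> H" using assms by (auto simp: supp_def)
    then have "h \<circ> (inv' h \<circ> g) \<in> H" using assms(1) unfolding subgrp_def by blast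
    then show False using that by simp
  qed
  then have "(\<Sum>h\<in>Sym. x h * y (inv' h \<circ> g)) = 0" if "g \<notin> H" "g \<in> Sym" for g
    using that by (intro sum.neutral) blast
  then show ?thesis by (auto simp: supp_def star_eval)
qed

text \<open>Left \<open>\<complex>H\<close>-submodules of \<open>\<complex>S\<^sub>n\<close>, and two-sided ideals of \<open>\<complex>H\<close>, without record notation.\<close>

definition lsub :: "(nat \<Rightarrow> nat) set \<Rightarrow> ((nat \<Rightarrow> nat) \<Rightarrow> complex) set \<Rightarrow> bool" where
  "lsub H U \<longleftrightarrow> U \<subseteq> supp Sym \<and> 0 \<in> U \<and> (\<forall>x\<in>U. \<forall>y\<in>U. x + y \<in> U) \<and>
     (\<forall>a\<in>supp H. \<forall>x\<in>U. a \<star> x \<in> U)"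

definition tsid :: "(nat \<Rightarrow> nat) set \<Rightarrow> ((nat \<Rightarrow> nat) \<Rightarrow> complex) set \<Rightarrow> bool" where
  "tsid H I \<longleftrightarrow> I \<subseteq> supp H \<and> lsub H I \<and> (\<forall>a\<in>supp H. \<forall>x\<in>I. x \<star> a \<in> I)"

lemma lsub_subspace:
  assumes "subgrp H" "lsub H U"
  shows "FV.subspace U"
proof -
  have "c \<odot> x \<in> U" if "x \<in> U" for c x
  proof -
    have "(c \<odot> delta id) \<star> x \<in> U"
      using assms that FV.subspace_scale[OF supp_subspace, of "delta id" H c]
      by (auto simp: lsub_def subgrp_def delta_supp)
    then show ?thesis using that assms(2) by (auto simp: lsub_def subset_iff)
  qed
  then show ?thesis using assms(2) by (auto simp: FV.subspace_def lsub_def)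
qed


lemma additive_subgroup_supp_iff:
  assumes "ring R" "add R = (+)" "zero R = 0" "carrier R = supp H" "U \<subseteq> supp H"
  shows "additive_subgroup U R \<longleftrightarrow> 0 \<in> U \<and> (\<forall>x\<in>U. \<forall>y\<in>U. x + y \<in> U) \<and> (\<forall>x\<in>U. - x \<in> U)"
proof -
  interpret R: ring R by fact
  have "x \<in> supp H \<Longrightarrow> - x \<in> supp H" for x by (simp add: supp_def)
  then have inv: "inv\<^bsub>add_monoid R\<^esub> x = - x" if "x \<in> supp H" for x
    using that assms(2-4) R.add.inv_equality[of "- x" x]
    by (simp add: a_inv_def)
  then show ?thesis
    using assms(2-5)
    unfolding additive_subgroup_def subgroup_def
    by (auto simp: subset_iff)
qed

lemma CS_simps:
  "add (CS n) = (+)" "zero (CS n) = 0" "x \<otimes>\<^bsub>CS n\<^esub> y = x \<star> y"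
  "add (CA n) = (+)" "zero (CA n) = 0" "x \<otimes>\<^bsub>CA n\<^esub> y = x \<star> y"
  "carrier (CS n) = supp Sym" "carrier (CA n) = supp Alt"
  by (simp_all add: CS_carrier CA_carrier Alt_def star_def) (simp_all add: CS_def CA_def)

lemma supp_Alt_Sym: "supp Alt \<subseteq> supp Sym"
  by (rule supp_mono) (auto simp: Alt_iff)

lemma lsub_uminus:
  assumes "subgrp H" "lsub H U" "x \<in> U"
  shows "- x \<in> U"
  using FV.subspace_neg[OF lsub_subspace[OF assms(1,2)] assms(3)] .

lemma left_submodule_CS_iff:
  assumes "subgrp H"
  shows "left_submodule (CS n) (supp H) U \<longleftrightarrow> lsub H U"
proof -
  have "additive_subgroup U (CS n) \<Longrightarrow> U \<subseteq> supp Sym"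
    using additive_subgroup.a_subset CS_simps by metis
  moreover have "U \<subseteq> supp Sym \<Longrightarrow> additive_subgroup U (CS n) \<longleftrightarrow> 0 \<in> U \<and> (\<forall>x\<in>U. \<forall>y\<in>U. x + y \<in> U) \<and> (\<forall>x\<in>U. - x \<in> U)"
    by (rule additive_subgroup_supp_iff[OF ring_CS]) (simp_all add: CS_simps)
  ultimately show ?thesis
    using lsub_uminus[OF assms]
    by (auto simp: left_submodule_def CS_simps lsub_def)
qed

lemma left_submodule_CA_iff:
  "left_submodule (CA n) (supp Alt) U \<longleftrightarrow> lsub Alt U \<and> U \<subseteq> supp Alt"
proof -
  have "additive_subgroup U (CA n) \<Longrightarrow> U \<subseteq> supp Alt"
    using additive_subgroup.a_subset CS_simps by metis
  moreover have "U \<subseteq> supp Alt \<Longrightarrow> additive_subgroup U (CA n) \<longleftrightarrow> 0 \<in> U \<and> (\<forall>x\<in>U. \<forall>y\<in>U. x + y \<in> U) \<and> (\<forall>x\<in>U. - x \<in> U)"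
    by (rule additive_subgroup_supp_iff[OF ring_CA]) (simp_all add: CS_simps)
  moreover have "U \<subseteq> supp Alt \<Longrightarrow> U \<subseteq> supp Sym"
    using supp_Alt_Sym by blast
  ultimately show ?thesis
    using lsub_uminus[OF subgrp_Alt]
    by (auto simp: left_submodule_def CS_simps lsub_def)
qed

lemma ideal_iff_tsid:
  assumes "ring R" "add R = (+)" "zero R = 0" "carrier R = supp H" "\<And>x y. x \<otimes>\<^bsub>R\<^esub> y = x \<star> y"
    and H: "subgrp H"
  shows "ideal J R \<longleftrightarrow> tsid H J"
proof
  assume J: "ideal J R"
  interpret ideal J R by fact
  have sub: "J \<subseteq> supp H" using a_subset assms by simp
  moreover have "supp H \<subseteq> supp Sym" using H by (simp add: subgrp_def supp_mono)
  moreover have "additive_subgroup J R" by (rule is_additive_subgroup)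
  ultimately show "tsid H J"
    using additive_subgroup_supp_iff[OF assms(1-4) sub] I_l_closed I_r_closed assms
    by (auto simp: tsid_def lsub_def)
next
  assume J: "tsid H J"
  then have sub: "J \<subseteq> supp H" by (simp add: tsid_def)
  have "additive_subgroup J R"
    using additive_subgroup_supp_iff[OF assms(1-4) sub] J lsub_uminus[OF H]
    by (auto simp: tsid_def lsub_def)
  then show "ideal J R"
    using J assms by (intro ideal.intro ideal_axioms.intro) (auto simp: tsid_def lsub_def)
qed

lemma ideal_CS_iff: "ideal J (CS n) \<longleftrightarrow> tsid Sym J"
  by (rule ideal_iff_tsid[OF ring_CS]) (simp_all add: CS_simps)

lemma ideal_CA_iff: "ideal J (CA n) \<longleftrightarrow> tsid Alt J"
  by (rule ideal_iff_tsid[OF ring_CA]) (simp_all add: CS_simps)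

text \<open>The common shape of simple ideals and irreducible submodules. The predicate stays a
  parameter so that one existence proof serves left submodules and two-sided ideals alike.\<close>

definition minimal_among :: "('x set \<Rightarrow> bool) \<Rightarrow> 'x::zero set \<Rightarrow> bool" where
  "minimal_among Q U \<longleftrightarrow> Q U \<and> U \<noteq> {0} \<and> (\<forall>U'. Q U' \<and> U' \<subseteq> U \<longrightarrow> U' = {0} \<or> U' = U)"

lemma simple_ideal_CS_iff: "simple_ideal J (CS n) \<longleftrightarrow> minimal_among (tsid Sym) J"
  by (simp add: simple_ideal_def minimal_among_def ideal_CS_iff CS_simps)

lemma simple_ideal_CA_iff: "simple_ideal J (CA n) \<longleftrightarrow> minimal_among (tsid Alt) J"
  by (simp add: simple_ideal_def minimal_among_def ideal_CA_iff CS_simps)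

lemma irreducible_submodule_CS_iff:
  "subgrp H \<Longrightarrow> irreducible_submodule (CS n) (supp H) U \<longleftrightarrow> minimal_among (lsub H) U"
  by (simp add: irreducible_submodule_def minimal_among_def left_submodule_CS_iff CS_simps)

lemma irreducible_submodule_CA_iff:
  "irreducible_submodule (CA n) (supp Alt) U \<longleftrightarrow> minimal_among (lsub Alt) U \<and> U \<subseteq> supp Alt"
  by (auto simp: irreducible_submodule_def minimal_among_def left_submodule_CA_iff CS_simps)

section \<open>Minimal submodules and identity elements of ideals\<close>

lemma finite_dim_Sym:
  assumes "FV.independent B" "B \<subseteq> supp Sym"
  shows "finite B \<and> card B \<le> card Sym"
proof -
  have "supp Sym \<subseteq> FV.span (delta ` Sym)"
  proof
    fix x assume "x \<in> supp Sym"
    then have "x = (\<Sum>g\<in>Sym. x g \<odot> delta g)" by (rule supp_expand) simp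
    also have "\<dots> \<in> FV.span (delta ` Sym)"
      by (intro FV.span_sum FV.span_scale FV.span_base) auto
    finally show "x \<in> FV.span (delta ` Sym)" .
  qed
  then have "finite B \<and> card B \<le> card (delta ` Sym)"
    using assms by (intro FV.independent_span_bound) auto
  then show ?thesis
    using card_image_le[OF finite_Sym, of delta] by linarith
qed

text \<open>A nonzero member of least dimension below \<open>U\<close> works: a basis of a strictly
  smaller member could be enlarged by a vector outside it, so that member would have smaller
  dimension.\<close>

lemma exists_minimal:
  assumes "Q U" "U \<noteq> {0}" and sub: "\<And>U. Q U \<Longrightarrow> FV.subspace U \<and> U \<subseteq> supp Sym"
  obtains W where "minimal_among Q W" "W \<subseteq> U"
proof -
  define P where "P W \<longleftrightarrow> Q W \<and> W \<noteq> {0} \<and> W \<subseteq> U" for W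
  have "P U" using assms by (simp add: P_def)
  then obtain W where W: "P W" and min: "\<And>W'. P W' \<Longrightarrow> FV.dim W \<le> FV.dim W'"
    using ex_has_least_nat[of P U FV.dim] by blast
  have "W' = W" if W': "Q W'" "W' \<subseteq> W" "W' \<noteq> {0}" for W'
  proof (rule ccontr)
    assume "W' \<noteq> W"
    then obtain x where x: "x \<in> W" "x \<notin> W'" using W' by blast
    obtain B where B: "B \<subseteq> W'" "FV.independent B" "W' \<subseteq> FV.span B" "card B = FV.dim W'"
      using FV.basis_exists by blast
    have sW: "FV.subspace W" "W \<subseteq> supp Sym" and sW': "FV.subspace W'" using sub W W' by (auto simp: P_def)
    have "FV.span B = W'"
      using B sW' by (metis FV.span_minimal subset_antisym)
    then have "x \<notin> FV.span B" using x by simp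
    then have "FV.independent (insert x B)" using B(2) by (rule FV.independent_insertI)
    moreover have "insert x B \<subseteq> W" using B x W' by auto
    ultimately obtain C where C: "insert x B \<subseteq> C" "C \<subseteq> W" "FV.independent C" "W \<subseteq> FV.span C"
      using FV.maximal_independent_subset_extend by blast
    have "card C = FV.dim W" using C by (intro FV.basis_card_eq_dim) auto
    moreover have "finite C" using finite_dim_Sym C sW by blast
    then have "card (insert x B) \<le> card C" using C by (intro card_mono)
    moreover have "finite B" using \<open>finite C\<close> C finite_subset by auto
    moreover have "x \<notin> B" using x B by auto
    ultimately have "FV.dim W' < FV.dim W" using B(4) by simp
    moreover have "P W'" using W W' by (auto simp: P_def)
    ultimately show False using min by fastforce
  qed
  then have "minimal_among Q W"
    using W by (auto simp: minimal_among_def P_def)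
  then show ?thesis using that W by (auto simp: P_def)
qed

lemma tsid_subspace:
  assumes "subgrp H" "tsid H I"
  shows "FV.subspace I" "I \<subseteq> supp Sym"
  using assms lsub_subspace by (auto simp: tsid_def lsub_def)

text \<open>Maschke: averaging a linear projection onto a right ideal makes it left multiplication by
  an element of the ideal.\<close>

lemma right_ideal_left_identity:
  assumes H: "subgrp H" and I: "FV.subspace I" "I \<subseteq> supp H"
    and r: "\<And>x a. x \<in> I \<Longrightarrow> a \<in> supp H \<Longrightarrow> x \<star> a \<in> I"
  shows "\<exists>e\<in>I. \<forall>x\<in>I. e \<star> x = x"
proof -
  interpret FP: vector_space_pair "fun_scale ((*) :: complex \<Rightarrow> complex \<Rightarrow> complex)" "fun_scale ((*) :: complex \<Rightarrow> complex \<Rightarrow> complex)"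
    by unfold_locales
  note [simp] = subgrp_finite[OF H]
  have HS: "h \<in> Sym" "inv' h \<in> H" if "h \<in> H" for h using H that by (auto simp: subgrp_def)
  have Hc: "h \<circ> k \<in> H" if "h \<in> H" "k \<in> H" for h k using H that by (auto simp: subgrp_def)
  have "inj_on id I" by simp
  then obtain \<pi> where \<pi>: "\<pi> ` UNIV \<subseteq> I" "\<And>x. x \<in> I \<Longrightarrow> \<pi> x = x"
      and lin: "Vector_Spaces.linear (fun_scale (*)) (fun_scale (*)) \<pi>"
    using FP.linear_exists_left_inverse_on[OF FV.linear_id I(1)] by auto
  interpret \<pi>: Vector_Spaces.linear "fun_scale ((*) :: complex \<Rightarrow> complex \<Rightarrow> complex)" "fun_scale ((*) :: complex \<Rightarrow> complex \<Rightarrow> complex)" \<pi> by fact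
  define c where "c = 1 / complex_of_nat (card H)"
  have cH: "c * of_nat (card H) = 1"
    using H by (auto simp: c_def subgrp_def card_gt_0_iff)
  \<comment> \<open>This is the value at the identity of the averaged projection sending
    \<open>x\<close> to \<open>c\<close> times the sum of
    \<open>\<pi> (x \<star> delta h) \<star> delta (inv' h)\<close>. The averaged map commutes with
    right multiplication by elements of \<open>H\<close>, so it is left multiplication by
    \<open>e\<close>; on \<open>I\<close> it is still the identity.\<close>
  define e where "e = c \<odot> (\<Sum>h\<in>H. \<pi> (delta h) \<star> delta (inv' h))"
  have "e \<in> I"
    unfolding e_def using \<pi>(1) HS
    by (intro FV.subspace_scale[OF I(1)] FV.subspace_sum[OF I(1)] r) (auto intro!: delta_supp)
  moreover have "e \<star> x = x" if x: "x \<in> I" for x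
  proof -
    have xH: "x \<in> supp H" using x I by blast
    have ek: "e \<star> delta k = c \<odot> (\<Sum>h\<in>H. \<pi> (delta k \<star> delta h) \<star> delta (inv' h))" if k: "k \<in> H" for k
    proof -
      have "(\<Sum>h\<in>H. \<pi> (delta h) \<star> delta (inv' h) \<star> delta k) = (\<Sum>h\<in>H. \<pi> (delta k \<star> delta h) \<star> delta (inv' h))"
        by (rule sum.reindex_bij_witness[of _ "\<lambda>h. k \<circ> h" "\<lambda>h. inv' k \<circ> h"])
          (use k in \<open>auto simp: HS Hc star_assoc delta_star_delta Sym_inv_distrib\<close>)
      then show ?thesis by (simp add: e_def star_sum_left)
    qed
    have "e \<star> x = e \<star> (\<Sum>k\<in>H. x k \<odot> delta k)"
      using supp_expand[OF xH] by simp
    also have "\<dots> = (\<Sum>k\<in>H. x k \<odot> (c \<odot> (\<Sum>h\<in>H. \<pi> (delta k \<star> delta h) \<star> delta (inv' h))))"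
      by (simp add: star_sum_right ek)
    also have "\<dots> = c \<odot> (\<Sum>h\<in>H. \<Sum>k\<in>H. \<pi> ((x k \<odot> delta k) \<star> delta h) \<star> delta (inv' h))"
      by (subst sum.swap) (simp add: FV.scale_sum_right \<pi>.scale mult.commute)
    also have "\<dots> = c \<odot> (\<Sum>h\<in>H. \<pi> ((\<Sum>k\<in>H. x k \<odot> delta k) \<star> delta h) \<star> delta (inv' h))"
      by (simp only: star_sum_left \<pi>.sum)
    also have "\<dots> = c \<odot> (\<Sum>h\<in>H. \<pi> (x \<star> delta h) \<star> delta (inv' h))"
      using supp_expand[OF xH] by simp
    also have "\<dots> = c \<odot> (\<Sum>h\<in>H. x)"
    proof -
      have "\<pi> (x \<star> delta h) \<star> delta (inv' h) = x" if "h \<in> H" for h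
        using that x xH H
        by (simp add: \<pi>(2) r delta_supp star_assoc delta_star_delta HS subgrp_supp_Sym)
      then show ?thesis by simp
    qed
    also have "\<dots> = (c * of_nat (card H)) \<odot> x"
      by (simp add: fun_scale_def fun_eq_iff sum_fun_apply)
    finally show ?thesis by (simp add: cH)
  qed
  ultimately show ?thesis by blast
qed

lemma adj_subspace: "FV.subspace I \<Longrightarrow> FV.subspace (adj ` I)"
proof (unfold FV.subspace_def, safe)
  fix x y c assume *: "\<forall>x\<in>I. \<forall>y\<in>I. x + y \<in> I" "\<forall>c. \<forall>x\<in>I. c \<odot> x \<in> I" "x \<in> I" "y \<in> I"
  have "adj x + adj y = adj (x + y)" by (simp add: adj_def fun_eq_iff)
  then show "adj x + adj y \<in> adj ` I" using * by simp
  have "c \<odot> adj x = adj (cnj c \<odot> x)" by (simp add: adj_def fun_eq_iff fun_scale_def)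
  then show "c \<odot> adj x \<in> adj ` I" using * by simp
next
  assume "0 \<in> I" 
  moreover have "adj 0 = 0" by (simp add: adj_def fun_eq_iff)
  ultimately show "0 \<in> adj ` I" by (metis image_eqI)
qed

lemma adj_supp_subgrp: "subgrp H \<Longrightarrow> x \<in> supp H \<Longrightarrow> adj x \<in> supp H"
  unfolding supp_def adj_def subgrp_def by (auto simp: subset_iff) (metis Sym_inv_inv)

text \<open>Averaging gives a left identity \<open>e\<close> of \<open>I\<close>, and applied to the
  image of \<open>I\<close> under \<open>adj\<close>, which is a right ideal too, it gives a right
  identity \<open>f\<close>. Then \<open>e = e \<star> f = f\<close>. Centrality holds because
  \<open>a \<star> e\<close> and \<open>e \<star> a\<close> both equal
  \<open>e \<star> a \<star> e\<close>.\<close>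

lemma tsid_identity:
  assumes H: "subgrp H" and I: "tsid H I"
  obtains e where "e \<in> I" "\<And>x. x \<in> I \<Longrightarrow> e \<star> x = x" "\<And>x. x \<in> I \<Longrightarrow> x \<star> e = x"
    "\<And>a. a \<in> supp H \<Longrightarrow> a \<star> e = e \<star> a"
proof -
  note sub = tsid_subspace[OF H I]
  have IH: "I \<subseteq> supp H" using I by (simp add: tsid_def)
  obtain e where e: "e \<in> I" "\<And>x. x \<in> I \<Longrightarrow> e \<star> x = x"
    using right_ideal_left_identity[OF H sub(1) IH] I by (auto simp: tsid_def)
  have "adj x \<star> a \<in> adj ` I" if "x \<in> I" "a \<in> supp H" for x a
  proof -
    have "adj (adj a \<star> x) = adj x \<star> a"
      using that H by (simp add: adj_star adj_adj subgrp_supp_Sym)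
    moreover have "adj a \<star> x \<in> I"
      using I that adj_supp_subgrp[OF H] by (auto simp: tsid_def lsub_def)
    ultimately show ?thesis by (metis image_eqI)
  qed
  then have "\<exists>e\<in>adj ` I. \<forall>x\<in>adj ` I. e \<star> x = x"
    using IH adj_supp_subgrp[OF H]
    by (intro right_ideal_left_identity[OF H adj_subspace[OF sub(1)]]) auto
  then obtain f where f: "f \<in> I" "\<And>x. x \<in> I \<Longrightarrow> adj f \<star> adj x = adj x"
    by auto
  have f': "x \<star> f = x" if "x \<in> I" for x
    using f(2)[OF that] that sub by (metis adj_adj adj_star star_supp subset_eq)
  have "e = f" using e f' f(1) by metis
  then have e': "x \<star> e = x" if "x \<in> I" for x using f' that by simp
  moreover have "a \<star> e = e \<star> a" if "a \<in> supp H" for a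
  proof -
    have "a \<star> e \<in> I" "e \<star> a \<in> I" using I that e by (auto simp: tsid_def lsub_def)
    then show ?thesis using e(2) e' by (metis star_assoc)
  qed
  ultimately show ?thesis using that e by blast
qed


subsection \<open>Young symmetrizers\<close>

definition N :: "nat set" where
  "N = {1..n}"

lemma finite_N [simp]: "finite N"
  by (simp add: N_def)

text \<open>The Young subgroup of an arbitrary colouring. Row and column groups of a tableau are
  special cases, but Garnir relations and the completeness argument need colourings that do not come
  from a tableau.\<close>

definition stab :: "(nat \<Rightarrow> 'c) \<Rightarrow> (nat \<Rightarrow> nat) set" where
  "stab f = {g \<in> Sym. \<forall>x\<in>N. f (g x) = f x}"

definition rsym :: "(nat \<Rightarrow> 'c) \<Rightarrow> (nat \<Rightarrow> nat) \<Rightarrow> complex" where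
  "rsym f = (\<lambda>g. if g \<in> stab f then 1 else 0)"

definition csym :: "(nat \<Rightarrow> 'c) \<Rightarrow> (nat \<Rightarrow> nat) \<Rightarrow> complex" where
  "csym f = twist (rsym f)"

text \<open>A tableau is recorded by the row and the column of each entry rather than by the entry
  of each cell: relabelling is then composition with a permutation, and transposing exchanges the
  two functions.\<close>

definition tab :: "(nat \<Rightarrow> nat) \<Rightarrow> (nat \<Rightarrow> nat) \<Rightarrow> (nat \<Rightarrow> nat) \<Rightarrow> bool" where
  "tab \<mu> f h \<longleftrightarrow> bij_betw (\<lambda>x. (f x, h x)) N (diagram \<mu>)"

lemma Sym_image_iff: "g \<in> Sym \<Longrightarrow> g x \<in> N \<longleftrightarrow> x \<in> N"
  unfolding Sym_def N_def by (simp only: mem_Collect_eq permutes_in_image)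

lemma Sym_image: "g \<in> Sym \<Longrightarrow> x \<in> N \<Longrightarrow> g x \<in> N"
  using Sym_image_iff by blast

lemma stab_Sym: "g \<in> stab f \<Longrightarrow> g \<in> Sym"
  by (simp add: stab_def)

lemma stab_app: "g \<in> stab f \<Longrightarrow> x \<in> N \<Longrightarrow> f (g x) = f x"
  unfolding stab_def by blast

lemma id_stab [simp]: "id \<in> stab f"
  by (simp add: stab_def)

lemma stab_comp: "g \<in> stab f \<Longrightarrow> h \<in> stab f \<Longrightarrow> g \<circ> h \<in> stab f"
  by (auto simp: stab_def Sym_image)

lemma stab_inv: "g \<in> stab f \<Longrightarrow> inv' g \<in> stab f"
proof -
  assume g: "g \<in> stab f"
  have "f (inv' g x) = f x" if "x \<in> N" for x
    using stab_app[OF g, of "inv' g x"] stab_Sym[OF g] Sym_image[OF Sym_inv[OF stab_Sym[OF g]] that] by simp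
  then show ?thesis using stab_Sym[OF g] by (simp add: stab_def)
qed

lemma stab_comp_iff: "p \<in> stab f \<Longrightarrow> k \<in> Sym \<Longrightarrow> p \<circ> k \<in> stab f \<longleftrightarrow> k \<in> stab f"
  using stab_comp[of p f k] stab_comp[OF stab_inv, of p f "p \<circ> k"] stab_Sym[of p f] by auto

lemma stab_comp_iff': "p \<in> stab f \<Longrightarrow> k \<in> Sym \<Longrightarrow> k \<circ> p \<in> stab f \<longleftrightarrow> k \<in> stab f"
  using stab_comp[of k f p] stab_comp[OF _ stab_inv, of "k \<circ> p" f p] stab_Sym[of p f]
  by (auto simp: comp_assoc)

lemma rsym_supp [simp]: "rsym f \<in> supp Sym"
  by (auto simp: supp_def rsym_def stab_def)

lemma csym_supp [simp]: "csym f \<in> supp Sym"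
  by (simp add: csym_def)

lemma delta_star_rsym: "p \<in> stab f \<Longrightarrow> delta p \<star> rsym f = rsym f"
  by (auto simp: fun_eq_iff delta_star_eval rsym_def stab_comp_iff stab_inv stab_Sym)

lemma rsym_star_delta: "p \<in> stab f \<Longrightarrow> rsym f \<star> delta p = rsym f"
  by (auto simp: fun_eq_iff star_delta_eval rsym_def stab_comp_iff' stab_inv stab_Sym)

lemma delta_star_csym: "p \<in> stab f \<Longrightarrow> delta p \<star> csym f = of_int (sign p) \<odot> csym f"
proof -
  assume p: "p \<in> stab f"
  have "of_int (sign p) \<odot> (delta p \<star> csym f) = csym f"
    using arg_cong[OF delta_star_rsym[OF p], of twist] by (simp add: twist_star twist_delta csym_def)
  then have "of_int (sign p) \<odot> csym f = of_int (sign p * sign p) \<odot> (delta p \<star> csym f)"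
    by (metis FV.scale_scale of_int_mult)
  then show ?thesis by simp
qed

lemma finite_stab [simp]: "finite (stab f)"
  by (rule finite_subset[OF _ finite_Sym]) (auto simp: stab_Sym)

lemma rsym_expand: "rsym f = (\<Sum>p\<in>stab f. delta p)"
proof -
  have "rsym f \<in> supp (stab f)" by (simp add: supp_def rsym_def)
  from supp_expand[OF this finite_stab] show ?thesis
    by (simp add: rsym_def)
qed

lemma csym_expand: "csym f = (\<Sum>p\<in>stab f. of_int (sign p) \<odot> delta p)"
  by (simp add: csym_def rsym_expand twist_sum twist_delta)

lemma sum_const_scale: "(\<Sum>p\<in>A. x) = of_nat (card A) \<odot> x"
  by (simp add: fun_scale_def fun_eq_iff sum_fun_apply)

lemma rsym_idem: "rsym f \<star> rsym f = of_nat (card (stab f)) \<odot> rsym f"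
proof -
  have "(\<Sum>p\<in>stab f. delta p) \<star> rsym f = (\<Sum>p\<in>stab f. rsym f)"
    unfolding star_sum_left by (rule sum.cong) (simp_all add: delta_star_rsym)
  then show ?thesis by (simp only: rsym_expand[symmetric] sum_const_scale)
qed

lemma csym_idem: "csym f \<star> csym f = of_nat (card (stab f)) \<odot> csym f"
  by (simp add: csym_def rsym_idem twist_scale flip: twist_star)

lemma adj_rsym [simp]: "adj (rsym f) = rsym f"
proof
  fix g
  have "g \<in> Sym \<Longrightarrow> inv' g \<in> stab f \<longleftrightarrow> g \<in> stab f"
    using stab_inv Sym_inv_inv by metis
  then show "adj (rsym f) g = rsym f g"
    by (auto simp: adj_def rsym_def stab_Sym)
qed

lemma adj_twist: "adj (twist x) = twist (adj x)"
  by (auto simp: adj_def twist_def fun_eq_iff sign_inverse Sym_permutation)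

lemma adj_csym [simp]: "adj (csym f) = csym f"
  by (simp add: csym_def adj_twist)

lemma rsym_conj:
  assumes g: "g \<in> Sym"
  shows "rsym (f \<circ> g) = delta (inv' g) \<star> rsym f \<star> delta g"
proof
  fix k
  have "k \<in> stab (f \<circ> g) \<longleftrightarrow> g \<circ> (k \<circ> inv' g) \<in> stab f" if k: "k \<in> Sym"
  proof
    assume *: "k \<in> stab (f \<circ> g)"
    have "f (g (k (inv' g x))) = f x" if "x \<in> N" for x
      using stab_app[OF *, of "inv' g x"] Sym_image[OF Sym_inv[OF g] that] g by simp
    then show "g \<circ> (k \<circ> inv' g) \<in> stab f"
      using g k by (simp add: stab_def)
  next
    assume *: "g \<circ> (k \<circ> inv' g) \<in> stab f"
    have "f (g (k x)) = f (g x)" if "x \<in> N" for x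
      using stab_app[OF *, of "g x"] Sym_image[OF g that] g by simp
    then show "k \<in> stab (f \<circ> g)"
      using g k by (simp add: stab_def)
  qed
  then show "rsym (f \<circ> g) k = (delta (inv' g) \<star> rsym f \<star> delta g) k"
    using g by (auto simp: star_delta_eval delta_star_eval rsym_def stab_Sym)
qed

lemma csym_conj:
  assumes g: "g \<in> Sym"
  shows "csym (f \<circ> g) = delta (inv' g) \<star> csym f \<star> delta g"
proof -
  have "sign (inv' g) * sign g = 1"
    using g by (simp add: sign_inverse Sym_permutation)
  then have "complex_of_int (sign (inv' g)) * of_int (sign g) = 1"
    by (metis of_int_1 of_int_mult)
  then show ?thesis
    using g by (simp add: csym_def rsym_conj twist_star twist_delta mult.commute)
qed

lemma stab_cong:
  assumes "\<And>x y. x \<in> N \<Longrightarrow> y \<in> N \<Longrightarrow> f x = f y \<longleftrightarrow> f' x = f' y"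
  shows "stab f = stab f'"
proof -
  have "f (g x) = f x \<longleftrightarrow> f' (g x) = f' x" if "g \<in> Sym" "x \<in> N" for g x
    using assms Sym_image that by blast
  then show ?thesis by (auto simp: stab_def)
qed

lemma rsym_cong:
  assumes "\<And>x y. x \<in> N \<Longrightarrow> y \<in> N \<Longrightarrow> f x = f y \<longleftrightarrow> f' x = f' y"
  shows "rsym f = rsym f'" "csym f = csym f'"
  using stab_cong[OF assms] by (simp_all add: rsym_def csym_def)

lemma transpose_Sym: "x \<in> N \<Longrightarrow> y \<in> N \<Longrightarrow> transpose x y \<in> Sym"
  unfolding Sym_def N_def by (simp add: permutes_swap_id)

lemma transpose_stab: "x \<in> N \<Longrightarrow> y \<in> N \<Longrightarrow> f x = f y \<Longrightarrow> transpose x y \<in> stab f"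
  using transpose_Sym by (auto simp: stab_def transpose_def)

lemma eq_neg_imp_zero:
  fixes x :: "'i \<Rightarrow> complex"
  assumes "x = - x" shows "x = 0"
proof
  fix g
  have "x g = (- x) g" using assms by (rule fun_cong)
  then show "x g = 0 g" by simp
qed

text \<open>The transposition of \<open>x\<close> and \<open>y\<close> is absorbed by
  \<open>rsym f\<close> without sign. Moved past \<open>delta g\<close> it becomes the transposition
  of the preimages, which \<open>csym h\<close> absorbs with sign -1. So the product equals its
  negative.\<close>

lemma rsym_delta_csym_zero:
  assumes g: "g \<in> Sym" and x: "x \<in> N" "y \<in> N" "x \<noteq> y"
    and eq: "f x = f y" "h (inv' g x) = h (inv' g y)"
  shows "rsym f \<star> delta g \<star> csym h = 0"
proof (rule eq_neg_imp_zero)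
  let ?t = "transpose x y" and ?t' = "transpose (inv' g x) (inv' g y)"
  have in': "inv' g x \<in> N" "inv' g y \<in> N" using g x Sym_image by auto
  have ne: "inv' g x \<noteq> inv' g y" using x(3) g by (metis Sym_cancel_app(2))
  have t: "?t \<in> stab f" "?t' \<in> stab h" using transpose_stab x eq in' by auto
  have "?t \<circ> g = g \<circ> ?t'"
    using g by (auto simp: fun_eq_iff transpose_def)
  then have tg: "delta ?t \<star> delta g = delta g \<star> delta ?t'"
    using g stab_Sym[OF t(1)] stab_Sym[OF t(2)] by (simp add: delta_star_delta)
  have "rsym f \<star> delta g \<star> csym h = rsym f \<star> delta ?t \<star> delta g \<star> csym h"
    by (simp only: rsym_star_delta[OF t(1)])
  also have "\<dots> = rsym f \<star> (delta ?t \<star> delta g) \<star> csym h"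
    by (simp only: star_assoc)
  also have "\<dots> = rsym f \<star> delta g \<star> (delta ?t' \<star> csym h)"
    by (simp only: tg star_assoc)
  also have "\<dots> = - (rsym f \<star> delta g \<star> csym h)"
    using ne by (simp add: delta_star_csym[OF t(2)] sign_swap_id star_minus_right)
  finally show "rsym f \<star> delta g \<star> csym h = - (rsym f \<star> delta g \<star> csym h)" .
qed

section \<open>Tableaux, dominance and von Neumann's lemma\<close>

lemma tab_inj: "tab \<mu> f h \<Longrightarrow> inj_on (\<lambda>x. (f x, h x)) N"
  by (simp add: tab_def bij_betw_def)

lemma card_split: "card {x \<in> N. P x} = (\<Sum>i\<in>f ` N. card {x \<in> N. f x = i \<and> P x})"
proof -
  have "{x \<in> N. P x} = (\<Union>i\<in>f ` N. {x \<in> N. f x = i \<and> P x})" by auto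
  moreover have "card (\<Union>i\<in>f ` N. {x \<in> N. f x = i \<and> P x}) = (\<Sum>i\<in>f ` N. card {x \<in> N. f x = i \<and> P x})"
    by (rule card_UN_disjoint) auto
  ultimately show ?thesis by simp
qed

lemma tab_row:
  assumes "tab \<mu> f h"
  shows "bij_betw h {x \<in> N. f x = i} {..<\<mu> i}"
proof -
  have "h ` {x \<in> N. f x = i} = {..<\<mu> i}"
  proof (rule equalityI; rule subsetI)
    fix j assume "j \<in> h ` {x \<in> N. f x = i}"
    then obtain x where "x \<in> N" "f x = i" "h x = j" by auto
    then have "(i, j) \<in> diagram \<mu>"
      using assms by (auto simp: tab_def bij_betw_def)
    then show "j \<in> {..<\<mu> i}" by (simp add: diagram_def)
  next
    fix j assume "j \<in> {..<\<mu> i}"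
    then have "(i, j) \<in> (\<lambda>x. (f x, h x)) ` N"
      using assms by (simp add: tab_def bij_betw_def diagram_def)
    then show "j \<in> h ` {x \<in> N. f x = i}" by auto
  qed
  moreover have "inj_on h {x \<in> N. f x = i}"
    using tab_inj[OF assms] by (auto simp: inj_on_def)
  ultimately show ?thesis by (simp add: bij_betw_def)
qed

lemma tab_row_count:
  assumes "tab \<mu> f h"
  shows "card {x \<in> N. f x = i \<and> h x < j} = min (\<mu> i) j"
proof -
  have inj: "inj_on h {x \<in> N. f x = i \<and> h x < j}"
    using tab_row[OF assms, of i] by (auto simp: bij_betw_def inj_on_def)
  have "h ` {x \<in> N. f x = i \<and> h x < j} = h ` {x \<in> N. f x = i} \<inter> {..<j}" by auto
  also have "\<dots> = {..<min (\<mu> i) j}"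
    using tab_row[OF assms, of i] by (auto simp: bij_betw_def)
  finally show ?thesis using card_image[OF inj] by simp
qed

lemma row_count_le:
  assumes "tab \<mu> f h" and inj: "inj_on (\<lambda>x. (f x, h' x)) N"
  shows "card {x \<in> N. f x = i \<and> h' x < j} \<le> min (\<mu> i) j"
proof -
  let ?A = "{x \<in> N. f x = i \<and> h' x < j}"
  have "card ?A \<le> card {x \<in> N. f x = i}" by (rule card_mono) auto
  also have "\<dots> = \<mu> i" using bij_betw_same_card[OF tab_row[OF assms(1), of i]] by simp
  finally have 1: "card ?A \<le> \<mu> i" .
  have "inj_on h' ?A" using inj by (auto simp: inj_on_def)
  moreover have "h' ` ?A \<subseteq> {..<j}" by auto
  ultimately have "card ?A \<le> card {..<j}" by (rule card_inj_on_le) simp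
  then show ?thesis using 1 by simp
qed

text \<open>Within one row an injective \<open>h'\<close> has at most min(\<open>\<mu> i\<close>,
  \<open>j\<close>) values below \<open>j\<close>, and a tableau attains this bound. Summed over the
  rows this is the dominance inequality.\<close>

lemma column_count_le:
  assumes "tab \<mu> f h" and inj: "inj_on (\<lambda>x. (f x, h' x)) N"
  shows "card {x \<in> N. h' x < j} \<le> card {x \<in> N. h x < j}"
  unfolding card_split[where f = f and P = "\<lambda>x. h' x < j"] card_split[where f = f and P = "\<lambda>x. h x < j"]
  using row_count_le[OF assms] by (intro sum_mono) (simp add: tab_row_count[OF assms(1)])

text \<open>Equal totals force equality in the bound of every single row. Taking \<open>j\<close> to
  be the length of a row shows that all its entries have columns inside the diagram; injectivity and
  counting do the rest.\<close>

lemma tab_of_counts: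
  assumes t: "tab \<mu> f h" and inj: "inj_on (\<lambda>x. (f x, h' x)) N"
    and eq: "\<And>j. card {x \<in> N. h' x < j} = card {x \<in> N. h x < j}"
  shows "tab \<mu> f h'"
proof -
  have "h' x < \<mu> (f x)" if x: "x \<in> N" for x
  proof -
    let ?j = "\<mu> (f x)"
    have "card {y \<in> N. f y = f x \<and> h' y < ?j} = card {y \<in> N. f y = f x \<and> h y < ?j}"
    proof (rule sum_mono_inv[of "\<lambda>i. card {y \<in> N. f y = i \<and> h' y < ?j}" "f ` N" "\<lambda>i. card {y \<in> N. f y = i \<and> h y < ?j}"])
      show "(\<Sum>i\<in>f ` N. card {y \<in> N. f y = i \<and> h' y < ?j}) = (\<Sum>i\<in>f ` N. card {y \<in> N. f y = i \<and> h y < ?j})"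
        using eq[of ?j] card_split[where f = f and P = "\<lambda>x. h' x < ?j"] card_split[where f = f and P = "\<lambda>x. h x < ?j"] by simp
      show "f x \<in> f ` N" using x by blast
    qed (use row_count_le[OF t inj] tab_row_count[OF t] in auto)
    also have "\<dots> = card {y \<in> N. f y = f x}"
      using tab_row_count[OF t] bij_betw_same_card[OF tab_row[OF t, of "f x"]] by simp
    finally have "{y \<in> N. f y = f x \<and> h' y < ?j} = {y \<in> N. f y = f x}"
      by (intro card_subset_eq) auto
    then show ?thesis using x by blast
  qed
  then have sub: "(\<lambda>x. (f x, h' x)) ` N \<subseteq> diagram \<mu>" by (auto simp: diagram_def)
  moreover have "card ((\<lambda>x. (f x, h' x)) ` N) = card (diagram \<mu>)"
    using card_image[OF inj] bij_betw_same_card[OF t[unfolded tab_def]] by simp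
  moreover have "finite (diagram \<mu>)" using bij_betw_finite[OF t[unfolded tab_def]] by simp
  ultimately have "(\<lambda>x. (f x, h' x)) ` N = diagram \<mu>" by (metis card_subset_eq)
  then show ?thesis using inj by (simp add: tab_def bij_betw_def)
qed

lemma tab_perm:
  assumes "tab \<mu> f h" "tab \<mu> f' h'"
  obtains p where "p \<in> Sym" "\<And>x. x \<in> N \<Longrightarrow> f' x = f (p x)" "\<And>x. x \<in> N \<Longrightarrow> h' x = h (p x)"
proof -
  let ?T = "\<lambda>x. (f x, h x)" and ?T' = "\<lambda>x. (f' x, h' x)"
  let ?q = "inv_into N ?T \<circ> ?T'"
  define p where "p x = (if x \<in> N then ?q x else x)" for x
  have q: "bij_betw ?q N N"
    by (rule bij_betw_trans[of _ _ "diagram \<mu>"])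
      (use assms in \<open>auto simp: tab_def intro: bij_betw_inv_into\<close>)
  have "bij_betw p N N"
    by (subst bij_betw_cong[of _ _ ?q]) (use q in \<open>auto simp: p_def\<close>)
  then have "p permutes N"
    unfolding N_def[symmetric] by (rule bij_imp_permutes) (simp add: p_def)
  moreover have "?T (p x) = ?T' x" if "x \<in> N" for x
  proof -
    have "?T' x \<in> ?T ` N" using assms that by (auto simp: tab_def bij_betw_def)
    then have "?T (inv_into N ?T (?T' x)) = ?T' x" by (rule f_inv_into_f)
    then show ?thesis using that by (simp add: p_def)
  qed
  ultimately show ?thesis using that[of p] by (auto simp: Sym_def N_def)
qed

lemma card_Sym_reindex:
  assumes "g \<in> Sym"
  shows "card {x \<in> N. P (g x)} = card {x \<in> N. P x}"
  by (rule bij_betw_same_card[of g], rule bij_betwI[of _ _ _ "inv' g"])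
    (use assms Sym_image[OF assms] Sym_image[OF Sym_inv[OF assms]] in \<open>auto\<close>)

text \<open>Permuting entries does not change the column counts, so \<open>f\<close> together with
  \<open>h\<close> precomposed with the inverse of \<open>g\<close> is again a tableau of shape
  \<open>\<mu>\<close>. The permutation \<open>p\<close> matching it with the original tableau
  preserves rows, and \<open>p \<circ> g\<close> preserves columns.\<close>

lemma von_neumann_factor:
  assumes t: "tab \<mu> f h" and g: "g \<in> Sym" and inj: "inj_on (\<lambda>x. (f x, h (inv' g x))) N"
  obtains p q where "p \<in> stab f" "q \<in> stab h" "g = p \<circ> q"
proof -
  have "tab \<mu> f (\<lambda>x. h (inv' g x))"
    using card_Sym_reindex[OF Sym_inv[OF g]] by (intro tab_of_counts[OF t inj])
  from tab_perm[OF t this] obtain p where p: "p \<in> Sym"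
      "\<And>x. x \<in> N \<Longrightarrow> f x = f (p x)" "\<And>x. x \<in> N \<Longrightarrow> h (inv' g x) = h (p x)"
    by blast
  have "p \<in> stab f" using p by (simp add: stab_def)
  moreover have "p \<circ> g \<in> stab h"
  proof -
    have "h (p (g x)) = h x" if "x \<in> N" for x
      using p(3)[OF Sym_image[OF g that]] g by simp
    then show ?thesis using p(1) g by (simp add: stab_def)
  qed
  moreover have "g = inv' p \<circ> (p \<circ> g)" using p by simp
  ultimately show ?thesis using that stab_inv by blast
qed

text \<open>By linearity a single permutation in the middle suffices. Either it factors into a row
  and a column permutation and contributes a sign, or two entries share a row and a column and the
  product vanishes.\<close>

lemma rsym_star_csym_scalar:
  assumes t: "tab \<mu> f h" and x: "x \<in> supp Sym"
  shows "\<exists>c. rsym f \<star> x \<star> csym h = c \<odot> (rsym f \<star> csym h)"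
proof -
  have "\<exists>c. rsym f \<star> delta g \<star> csym h = c \<odot> (rsym f \<star> csym h)" if g: "g \<in> Sym" for g
  proof (cases "inj_on (\<lambda>x. (f x, h (inv' g x))) N")
    case True
    then obtain p q where pq: "p \<in> stab f" "q \<in> stab h" "g = p \<circ> q"
      using von_neumann_factor[OF t g] by metis
    then have "delta g = delta p \<star> delta q"
      using stab_Sym[OF pq(1)] stab_Sym[OF pq(2)] by (simp add: delta_star_delta)
    then have "rsym f \<star> delta g \<star> csym h = rsym f \<star> delta p \<star> (delta q \<star> csym h)"
      by (simp add: star_assoc)
    then show ?thesis
      using pq by (auto simp: rsym_star_delta delta_star_csym)
  next
    case False
    then have "rsym f \<star> delta g \<star> csym h = 0"
      using rsym_delta_csym_zero[OF g, of _ _ f h] unfolding inj_on_def by blast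
    then show ?thesis using FV.scale_zero_left by metis
  qed
  then obtain c where c: "\<And>g. g \<in> Sym \<Longrightarrow> rsym f \<star> delta g \<star> csym h = c g \<odot> (rsym f \<star> csym h)"
    by metis
  have "rsym f \<star> x \<star> csym h = (\<Sum>g\<in>Sym. x g \<odot> (rsym f \<star> delta g \<star> csym h))"
    by (subst supp_expand[OF x]) (simp_all add: star_sum_right star_sum_left)
  also have "\<dots> = (\<Sum>g\<in>Sym. (x g * c g) \<odot> (rsym f \<star> csym h))"
    by (intro sum.cong) (simp_all add: c)
  also have "\<dots> = (\<Sum>g\<in>Sym. x g * c g) \<odot> (rsym f \<star> csym h)"
    by (simp add: FV.scale_sum_left)
  finally show ?thesis by blast
qed

text \<open>Row and column group meet only in the identity, so the coefficient of \<open>id\<close>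
  is 1.\<close>

lemma rsym_star_csym_nonzero:
  assumes t: "tab \<mu> f h"
  shows "rsym f \<star> csym h \<noteq> 0"
proof -
  have "p = id" if p: "p \<in> stab f" "inv' p \<in> stab h" for p
  proof -
    have "p \<in> stab h" using stab_inv[OF p(2)] stab_Sym[OF p(1)] by simp
    then have "p x = x" if "x \<in> N" for x
      using inj_onD[OF tab_inj[OF t], of "p x" x] p(1) that Sym_image[OF stab_Sym[OF p(1)] that]
        stab_app[of p f x] stab_app[of p h x]
      by simp
    moreover have "p x = x" if "x \<notin> N" for x
      using that stab_Sym[OF p(1)] by (auto simp: Sym_def N_def permutes_def)
    ultimately show ?thesis by (auto simp: fun_eq_iff)
  qed
  then have "(\<Sum>p\<in>Sym. rsym f p * csym h (inv' p)) = (\<Sum>p\<in>Sym. if p = id then 1 else 0)"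
    by (intro sum.cong) (auto simp: rsym_def csym_def twist_def sign_id)
  then have "(rsym f \<star> csym h) id = 1"
    by (simp add: star_eval sum.delta)
  then show ?thesis by (metis zero_fun_apply zero_neq_one)
qed

text \<open>Write \<open>a\<close> and \<open>b\<close> for the two factors; both are self-adjoint
  and idempotent up to a scalar. If \<open>c\<close> were 0, then \<open>aba\<close> times its
  adjoint, a multiple of \<open>ababa\<close>, would vanish, so \<open>aba = 0\<close> by
  positivity. But \<open>ab\<close> times its adjoint is a multiple of \<open>aba\<close>, so
  \<open>ab\<close> would vanish too.\<close>

lemma rsym_csym_rsym_csym:
  assumes t: "tab \<mu> f h"
  obtains c where "c \<noteq> 0" "rsym f \<star> csym h \<star> (rsym f \<star> csym h) = c \<odot> (rsym f \<star> csym h)"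
proof -
  let ?a = "rsym f" and ?b = "csym h"
  have aba: "?a \<star> ?b \<star> ?a \<noteq> 0"
  proof
    assume 0: "?a \<star> ?b \<star> ?a = 0"
    have "?a \<star> ?b \<star> adj (?a \<star> ?b) = ?a \<star> (?b \<star> ?b) \<star> ?a"
      by (simp add: adj_star star_assoc)
    also have "\<dots> = 0" using 0 by (simp add: csym_idem)
    finally have "?a \<star> ?b = 0" by (rule star_adj_self_eq_0[OF star_supp])
    then show False using rsym_star_csym_nonzero[OF t] by contradiction
  qed
  obtain c where c: "?a \<star> (?b \<star> ?a) \<star> ?b = c \<odot> (?a \<star> ?b)"
    using rsym_star_csym_scalar[OF t, of "?b \<star> ?a"] by auto
  have "c \<noteq> 0"
  proof
    assume "c = 0"
    then have 0: "?a \<star> (?b \<star> (?a \<star> ?b)) = 0" using c by (simp add: star_assoc)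
    have "?a \<star> ?b \<star> ?a \<star> adj (?a \<star> ?b \<star> ?a) = ?a \<star> ?b \<star> (?a \<star> ?a) \<star> (?b \<star> ?a)"
      by (simp add: adj_star star_assoc)
    also have "\<dots> = of_nat (card (stab f)) \<odot> (?a \<star> (?b \<star> (?a \<star> ?b)) \<star> ?a)"
      by (simp add: rsym_idem star_assoc)
    also have "\<dots> = 0" using 0 by simp
    finally have "?a \<star> ?b \<star> ?a = 0" by (rule star_adj_self_eq_0[OF star_supp])
    then show False using aba by contradiction
  qed
  then show ?thesis
    by (rule that) (use c in \<open>simp add: star_assoc\<close>)
qed

end


section \<open>Simple components of the group algebra\<close>

lemma partition_of_down_set:
  assumes fin: "finite D" and down: "\<And>i j i' j'. (i, j) \<in> D \<Longrightarrow> i' \<le> i \<Longrightarrow> j' \<le> j \<Longrightarrow> (i', j') \<in> D"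
  defines "\<mu> \<equiv> \<lambda>i. card {j. (i, j) \<in> D}"
  shows "\<mu> \<in> partitions_of (card D)" "diagram \<mu> = D"
proof -
  have fin_row: "finite {j. (i, j) \<in> D}" for i
    by (rule finite_subset[of _ "snd ` D"]) (use fin in \<open>auto intro: image_eqI[where x = "(i, _)"]\<close>)
  have row: "{j. (i, j) \<in> D} = {..<\<mu> i}" for i
  proof -
    have "\<exists>m. {j. (i, j) \<in> D} = {..<m}"
    proof -
      define m where "m = (LEAST m. (i, m) \<notin> D)"
      have "\<exists>m. (i, m) \<notin> D" using fin_row[of i] ex_new_if_finite[OF infinite_UNIV_nat fin_row[of i]] by auto
      then have m: "(i, m) \<notin> D" unfolding m_def by (rule LeastI_ex)
      have "(i, j) \<in> D \<longleftrightarrow> j < m" for j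
      proof
        assume "(i, j) \<in> D"
        then show "j < m" using m down[of i j i m] by (meson not_le order_refl)
      next
        assume "j < m"
        then show "(i, j) \<in> D" unfolding m_def using not_less_Least by blast
      qed
      then have "{j. (i, j) \<in> D} = {..<m}" by (simp only: lessThan_def)
      then show ?thesis by blast
    qed
    then show ?thesis unfolding \<mu>_def by force
  qed
  show D: "diagram \<mu> = D"
    using row by (auto simp: diagram_def)
  have "antimono \<mu>"
  proof (rule antimonoI)
    fix i i' :: nat assume "i \<le> i'"
    then have "{j. (i', j) \<in> D} \<subseteq> {j. (i, j) \<in> D}" using down by auto
    then show "\<mu> i' \<le> \<mu> i" unfolding \<mu>_def using fin_row by (rule card_mono[rotated])
  qed
  moreover have fs: "finite {i. \<mu> i \<noteq> 0}"
  proof (rule finite_subset[of _ "fst ` D"])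
    show "{i. \<mu> i \<noteq> 0} \<subseteq> fst ` D"
    proof
      fix i assume "i \<in> {i. \<mu> i \<noteq> 0}"
      then have "(i, 0) \<in> D" using D by (auto simp: diagram_def)
      then show "i \<in> fst ` D" by force
    qed
  qed (use fin in simp)
  moreover have "(\<Sum>i | \<mu> i \<noteq> 0. \<mu> i) = card D"
  proof -
    have "D = Sigma {i. \<mu> i \<noteq> 0} (\<lambda>i. {..<\<mu> i})"
      using D by (auto simp: diagram_def)
    then have "card D = card (Sigma {i. \<mu> i \<noteq> 0} (\<lambda>i. {..<\<mu> i}))" by simp
    also have "\<dots> = (\<Sum>i | \<mu> i \<noteq> 0. card {..<\<mu> i})"
      using fs by (intro card_SigmaI) auto
    finally show ?thesis by simp
  qed
  ultimately show "\<mu> \<in> partitions_of (card D)" by (simp add: partitions_of_def)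
qed

lemma diagram_down: "antimono \<mu> \<Longrightarrow> (i, j) \<in> diagram \<mu> \<Longrightarrow> i' \<le> i \<Longrightarrow> j' \<le> j \<Longrightarrow> (i', j') \<in> diagram \<mu>"
  unfolding diagram_def antimono_def by (auto dest: spec[where x = i'] intro: le_less_trans less_le_trans)

lemma diagram_partition:
  assumes "\<mu> \<in> partitions_of m"
  shows "finite (diagram \<mu>)" "card (diagram \<mu>) = m"
proof -
  have *: "diagram \<mu> = Sigma {i. \<mu> i \<noteq> 0} (\<lambda>i. {..<\<mu> i})"
    by (auto simp: diagram_def)
  have fin: "finite {i. \<mu> i \<noteq> 0}" "(\<Sum>i | \<mu> i \<noteq> 0. \<mu> i) = m"
    using assms by (auto simp: partitions_of_def)
  show "finite (diagram \<mu>)" unfolding * using fin by auto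
  have "card (diagram \<mu>) = (\<Sum>i | \<mu> i \<noteq> 0. card {..<\<mu> i})"
    unfolding * using fin by (intro card_SigmaI) auto
  then show "card (diagram \<mu>) = m" using fin by simp
qed

lemma diagram_eq_imp_eq: "diagram \<mu> = diagram \<nu> \<Longrightarrow> \<mu> = \<nu>"
proof
  fix i assume "diagram \<mu> = diagram \<nu>"
  then have "{j. (i, j) \<in> diagram \<mu>} = {j. (i, j) \<in> diagram \<nu>}" by simp
  then have "{..<\<mu> i} = {..<\<nu> i}" by (auto simp: diagram_def lessThan_def)
  then show "\<mu> i = \<nu> i" by simp
qed

lemma conjugate_partition:
  assumes "\<mu> \<in> partitions_of m"
  shows "conjugate \<mu> \<in> partitions_of m" "diagram (conjugate \<mu>) = prod.swap ` diagram \<mu>"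
proof -
  have anti: "antimono \<mu>" using assms by (simp add: partitions_of_def)
  let ?D = "prod.swap ` diagram \<mu>"
  have in_D: "(i, j) \<in> ?D \<longleftrightarrow> (j, i) \<in> diagram \<mu>" for i j
    by (auto intro: image_eqI[where x = "(j, i)"])
  have eq: "(\<lambda>i. card {j. (i, j) \<in> ?D}) = conjugate \<mu>"
    by (rule ext) (simp add: in_D conjugate_def diagram_def)
  have "card ?D = m"
    using diagram_partition[OF assms] by (subst card_image) auto
  moreover have "finite ?D" using diagram_partition[OF assms] by simp
  ultimately show "conjugate \<mu> \<in> partitions_of m" "diagram (conjugate \<mu>) = ?D"
    using partition_of_down_set[of ?D, unfolded eq] diagram_down[OF anti] unfolding in_D by blast+
qed

lemma conjugate_conjugate:
  assumes "\<mu> \<in> partitions_of m"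
  shows "conjugate (conjugate \<mu>) = \<mu>"
  by (rule diagram_eq_imp_eq)
    (simp add: conjugate_partition(2)[OF conjugate_partition(1)[OF assms]] conjugate_partition(2)[OF assms] image_image)

text \<open>Row \<open>i\<close> occupies the \<open>\<mu> i\<close> numbers following those of the
  earlier rows, so entries of different rows are strictly ordered. Surjectivity follows by
  counting.\<close>

lemma tableau_bij:
  assumes "\<mu> \<in> partitions_of m"
  shows "bij_betw (tableau \<mu>) (diagram \<mu>) {1..m}"
proof -
  have le: "(\<Sum>r<i. \<mu> r) \<le> m" for i
  proof -
    have "(\<Sum>r<i. \<mu> r) = (\<Sum>r | r < i \<and> \<mu> r \<noteq> 0. \<mu> r)"
      by (rule sum.mono_neutral_right) auto
    also have "\<dots> \<le> (\<Sum>r | \<mu> r \<noteq> 0. \<mu> r)"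
      by (rule sum_mono2) (use assms in \<open>auto simp: partitions_of_def\<close>)
    finally show ?thesis using assms by (simp add: partitions_of_def)
  qed
  have lt: "tableau \<mu> (i, j) < tableau \<mu> (i', j')" if "j < \<mu> i" "i < i'" for i j i' j'
  proof -
    have "(\<Sum>r<i. \<mu> r) + \<mu> i = (\<Sum>r<Suc i. \<mu> r)" by simp
    also have "\<dots> \<le> (\<Sum>r<i'. \<mu> r)" using that by (intro sum_mono2) auto
    finally show ?thesis using that by (simp add: tableau_def)
  qed
  have inj: "inj_on (tableau \<mu>) (diagram \<mu>)"
  proof (rule inj_onI, clarify)
    fix i j i' j' assume *: "(i, j) \<in> diagram \<mu>" "(i', j') \<in> diagram \<mu>" "tableau \<mu> (i, j) = tableau \<mu> (i', j')"
    have "i = i'" using lt[of j i i' j'] lt[of j' i' i j] * by (cases i i' rule: linorder_cases) (auto simp: diagram_def)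
    then show "i = i' \<and> j = j'" using * by (simp add: tableau_def)
  qed
  moreover have "tableau \<mu> ` diagram \<mu> \<subseteq> {1..m}"
  proof clarify
    fix i j assume "(i, j) \<in> diagram \<mu>"
    then have "tableau \<mu> (i, j) \<le> (\<Sum>r<Suc i. \<mu> r)" by (simp add: tableau_def diagram_def)
    also have "\<dots> \<le> m" by (rule le)
    finally show "tableau \<mu> (i, j) \<in> {1..m}" by (simp add: tableau_def)
  qed
  moreover have "card (tableau \<mu> ` diagram \<mu>) = card {1..m}"
    using card_image[OF inj] diagram_partition[OF assms] by simp
  ultimately show ?thesis
    by (simp add: bij_betw_def card_subset_eq)
qed

context sym_algebra begin

definition row_of :: "(nat \<Rightarrow> nat) \<Rightarrow> nat \<Rightarrow> nat" where
  "row_of \<mu> x = fst (inv_into (diagram \<mu>) (tableau \<mu>) x)"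

definition col_of :: "(nat \<Rightarrow> nat) \<Rightarrow> nat \<Rightarrow> nat" where
  "col_of \<mu> x = snd (inv_into (diagram \<mu>) (tableau \<mu>) x)"

lemma tab_canonical:
  assumes "\<mu> \<in> partitions_of n"
  shows "tab \<mu> (row_of \<mu>) (col_of \<mu>)"
  using bij_betw_inv_into[OF tableau_bij[OF assms]]
  by (simp add: tab_def row_of_def col_of_def N_def)

lemma row_col_tableau:
  assumes "\<mu> \<in> partitions_of n" "(i, j) \<in> diagram \<mu>"
  shows "row_of \<mu> (tableau \<mu> (i, j)) = i" "col_of \<mu> (tableau \<mu> (i, j)) = j" "tableau \<mu> (i, j) \<in> N"
  using tableau_bij[OF assms(1)] assms(2)
  by (auto simp: row_of_def col_of_def N_def bij_betw_def)

lemma tableau_row_col: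
  assumes "\<mu> \<in> partitions_of n" "x \<in> N"
  shows "tableau \<mu> (row_of \<mu> x, col_of \<mu> x) = x" "(row_of \<mu> x, col_of \<mu> x) \<in> diagram \<mu>"
proof -
  have "x \<in> tableau \<mu> ` diagram \<mu>"
    using tableau_bij[OF assms(1)] assms(2) by (simp add: bij_betw_def N_def)
  then show "tableau \<mu> (row_of \<mu> x, col_of \<mu> x) = x" "(row_of \<mu> x, col_of \<mu> x) \<in> diagram \<mu>"
    by (auto simp: row_of_def col_of_def f_inv_into_f inv_into_into)
qed

lemma row_group_eq:
  assumes mu: "\<mu> \<in> partitions_of n"
  shows "row_group n \<mu> = stab (row_of \<mu>)"
proof (intro equalityI subsetI)
  fix g assume g: "g \<in> row_group n \<mu>"
  then have S: "g \<in> Sym" by (simp add: row_group_def carrier_sym)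
  have "row_of \<mu> (g x) = row_of \<mu> x" if x: "x \<in> N" for x
  proof -
    have "\<And>i j. (i, j) \<in> diagram \<mu> \<Longrightarrow> \<exists>j'. (i, j') \<in> diagram \<mu> \<and> g (tableau \<mu> (i, j)) = tableau \<mu> (i, j')"
      using g by (simp add: row_group_def)
    from this[OF tableau_row_col(2)[OF mu x]] obtain j' where "(row_of \<mu> x, j') \<in> diagram \<mu>" "g x = tableau \<mu> (row_of \<mu> x, j')"
      using tableau_row_col(1)[OF mu x] by auto
    then show ?thesis using row_col_tableau[OF mu] by simp
  qed
  then show "g \<in> stab (row_of \<mu>)" using S by (simp add: stab_def)
next
  fix g assume g: "g \<in> stab (row_of \<mu>)"
  have "\<exists>j'. (i, j') \<in> diagram \<mu> \<and> g (tableau \<mu> (i, j)) = tableau \<mu> (i, j')" if ij: "(i, j) \<in> diagram \<mu>" for i j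
  proof -
    let ?x = "g (tableau \<mu> (i, j))"
    have x: "?x \<in> N" using Sym_image[OF stab_Sym[OF g]] row_col_tableau[OF mu ij] by simp
    have "row_of \<mu> ?x = i" using stab_app[OF g] row_col_tableau[OF mu ij] by simp
    then have "(i, col_of \<mu> ?x) \<in> diagram \<mu> \<and> ?x = tableau \<mu> (i, col_of \<mu> ?x)"
      using tableau_row_col[OF mu x] by simp
    then show ?thesis by blast
  qed
  then show "g \<in> row_group n \<mu>" using stab_Sym[OF g] by (simp add: row_group_def carrier_sym)
qed

lemma column_group_eq:
  assumes mu: "\<mu> \<in> partitions_of n"
  shows "column_group n \<mu> = stab (col_of \<mu>)"
proof (intro equalityI subsetI)
  fix g assume g: "g \<in> column_group n \<mu>"
  then have S: "g \<in> Sym" by (simp add: column_group_def carrier_sym)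
  have "col_of \<mu> (g x) = col_of \<mu> x" if x: "x \<in> N" for x
  proof -
    have "\<And>i j. (i, j) \<in> diagram \<mu> \<Longrightarrow> \<exists>i'. (i', j) \<in> diagram \<mu> \<and> g (tableau \<mu> (i, j)) = tableau \<mu> (i', j)"
      using g by (simp add: column_group_def)
    from this[OF tableau_row_col(2)[OF mu x]] obtain i' where "(i', col_of \<mu> x) \<in> diagram \<mu>" "g x = tableau \<mu> (i', col_of \<mu> x)"
      using tableau_row_col(1)[OF mu x] by auto
    then show ?thesis using row_col_tableau[OF mu] by simp
  qed
  then show "g \<in> stab (col_of \<mu>)" using S by (simp add: stab_def)
next
  fix g assume g: "g \<in> stab (col_of \<mu>)"
  have "\<exists>i'. (i', j) \<in> diagram \<mu> \<and> g (tableau \<mu> (i, j)) = tableau \<mu> (i', j)" if ij: "(i, j) \<in> diagram \<mu>" for i j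
  proof -
    let ?x = "g (tableau \<mu> (i, j))"
    have x: "?x \<in> N" using Sym_image[OF stab_Sym[OF g]] row_col_tableau[OF mu ij] by simp
    have "col_of \<mu> ?x = j" using stab_app[OF g] row_col_tableau[OF mu ij] by simp
    then have "(row_of \<mu> ?x, j) \<in> diagram \<mu> \<and> ?x = tableau \<mu> (row_of \<mu> ?x, j)"
      using tableau_row_col[OF mu x] by simp
    then show ?thesis by blast
  qed
  then show "g \<in> column_group n \<mu>" using stab_Sym[OF g] by (simp add: column_group_def carrier_sym)
qed

lemma young_symmetrizer_eq:
  assumes "\<mu> \<in> partitions_of n"
  shows "young_symmetrizer n \<mu> = rsym (row_of \<mu>) \<star> csym (col_of \<mu>)"
proof -
  have "(\<lambda>g. if g \<in> column_group n \<mu> then of_int (sign g) else 0) = csym (col_of \<mu>)"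
    by (auto simp: csym_def rsym_def twist_def column_group_eq[OF assms])
  moreover have "(\<lambda>g. if g \<in> row_group n \<mu> then 1 else 0) = rsym (row_of \<mu>)"
    by (simp add: rsym_def row_group_eq[OF assms])
  ultimately show ?thesis by (simp add: young_symmetrizer_def star_def)
qed

section \<open>Ideals generated by Young symmetrizers\<close>

definition gen :: "((nat \<Rightarrow> nat) \<Rightarrow> complex) \<Rightarrow> ((nat \<Rightarrow> nat) \<Rightarrow> complex) set" where
  "gen c = FV.span {x \<star> c \<star> y |x y. x \<in> supp Sym \<and> y \<in> supp Sym}"

lemma tsid_gen: "tsid Sym (gen c)"
proof -
  have 1: "a \<star> x \<in> gen c" if "x \<in> gen c" "a \<in> supp Sym" for a x
    using that(1) unfolding gen_def
  proof (induction x rule: FV.span_induct_alt)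
    case (step s x y)
    then obtain u v where "x = u \<star> c \<star> v" "u \<in> supp Sym" "v \<in> supp Sym" by blast
    then have "a \<star> x = a \<star> u \<star> c \<star> v" "v \<in> supp Sym" by (simp_all add: star_assoc)
    then have "a \<star> x \<in> FV.span {x \<star> c \<star> y |x y. x \<in> supp Sym \<and> y \<in> supp Sym}"
      by (intro FV.span_base CollectI exI[of _ "a \<star> u"] exI[of _ v]) simp
    then show ?case
      unfolding star_add_right star_scale_right by (intro FV.span_add FV.span_scale step.IH)
  qed (simp only: star_zero FV.span_zero)
  have 2: "x \<star> a \<in> gen c" if "x \<in> gen c" "a \<in> supp Sym" for a x
    using that(1) unfolding gen_def
  proof (induction x rule: FV.span_induct_alt)
    case (step s x y)
    then obtain u v where "x = u \<star> c \<star> v" "u \<in> supp Sym" "v \<in> supp Sym" by blast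
    then have "x \<star> a = u \<star> c \<star> (v \<star> a)" "u \<in> supp Sym" by (simp_all add: star_assoc)
    then have "x \<star> a \<in> FV.span {x \<star> c \<star> y |x y. x \<in> supp Sym \<and> y \<in> supp Sym}"
      by (intro FV.span_base CollectI exI[of _ u] exI[of _ "v \<star> a"]) simp
    then show ?case
      unfolding star_add_left star_scale_left by (intro FV.span_add FV.span_scale step.IH)
  qed (simp only: star_zero FV.span_zero)
  have "gen c \<subseteq> supp Sym"
    unfolding gen_def by (rule FV.span_minimal) (auto simp: supp_subspace)
  then show ?thesis
    using 1 2 by (auto simp: tsid_def lsub_def gen_def FV.span_zero FV.span_add)
qed

lemma gen_base:
  assumes "c \<in> supp Sym" shows "c \<in> gen c"
  unfolding gen_def
  by (rule FV.span_base) (use assms in \<open>auto intro!: exI[of _ "delta id"] delta_supp\<close>)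

lemma tsid_lmult: "tsid H J \<Longrightarrow> x \<in> J \<Longrightarrow> a \<in> supp H \<Longrightarrow> a \<star> x \<in> J"
  by (simp add: tsid_def lsub_def)

lemma tsid_rmult: "tsid H J \<Longrightarrow> x \<in> J \<Longrightarrow> a \<in> supp H \<Longrightarrow> x \<star> a \<in> J"
  by (simp add: tsid_def)

lemma tsid_lrmult: "tsid H J \<Longrightarrow> x \<in> J \<Longrightarrow> a \<in> supp H \<Longrightarrow> b \<in> supp H \<Longrightarrow> a \<star> x \<star> b \<in> J"
  by (simp add: tsid_lmult tsid_rmult)

lemma tsid_supp: "tsid H J \<Longrightarrow> x \<in> J \<Longrightarrow> x \<in> supp H"
  by (auto simp: tsid_def)

lemma tsid_zero: "tsid H J \<Longrightarrow> 0 \<in> J"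
  by (simp add: tsid_def lsub_def)

lemma tsid_Int: "tsid H J \<Longrightarrow> tsid H K \<Longrightarrow> tsid H (J \<inter> K)"
  by (auto simp: tsid_def lsub_def)

lemma gen_subset:
  assumes "tsid Sym J" "c \<in> J"
  shows "gen c \<subseteq> J"
  unfolding gen_def
proof (rule FV.span_minimal)
  show "FV.subspace J" using tsid_subspace[OF subgrp_Sym assms(1)] by simp
  show "{x \<star> c \<star> y |x y. x \<in> supp Sym \<and> y \<in> supp Sym} \<subseteq> J"
    using assms tsid_lmult tsid_rmult by blast
qed

lemma minimal_tsid_meet:
  assumes "minimal_among (tsid H) J" "minimal_among (tsid H) K" "x \<in> J" "x \<in> K" "x \<noteq> 0"
  shows "J = K"
proof -
  have "tsid H (J \<inter> K)" using assms(1,2) tsid_Int by (auto simp: minimal_among_def)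
  moreover have "J \<inter> K \<noteq> {0}" using assms(3-5) by blast
  ultimately have "J \<inter> K = J" "J \<inter> K = K"
    using assms(1,2) unfolding minimal_among_def by blast+
  then show ?thesis by simp
qed

text \<open>Let \<open>J\<close> be an ideal inside that misses the symmetrizer \<open>?c\<close>.
  Every \<open>?c \<star> x \<star> ?c\<close> with \<open>x\<close> in \<open>J\<close> is a
  multiple of \<open>?c\<close> lying in \<open>J\<close>, hence 0, so \<open>J\<close> is killed
  between any two elements of \<open>gen ?c\<close>. The identity \<open>e\<close> of
  \<open>J\<close> then satisfies \<open>e = e \<star> e \<star> e = 0\<close>.\<close>

lemma gen_tab_simple:
  assumes t: "tab \<mu> f h"
  shows "minimal_among (tsid Sym) (gen (rsym f \<star> csym h))"
proof -
  let ?c = "rsym f \<star> csym h"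
  have nz: "gen ?c \<noteq> {0}"
    using gen_base[of ?c] rsym_star_csym_nonzero[OF t] by auto
  have "J = {0} \<or> J = gen ?c" if J: "tsid Sym J" "J \<subseteq> gen ?c" for J
  proof (cases "?c \<in> J")
    case True
    then show ?thesis using gen_subset[OF J(1)] J(2) by blast
  next
    case False
    have cxc: "?c \<star> x \<star> ?c = 0" if x: "x \<in> J" for x
    proof -
      \<comment> \<open>The product \<open>?c \<star> x \<star> ?c\<close> is bracketed so that the
        row symmetrizer stands first, the column symmetrizer last, and this element in the
        middle.\<close>
      have "csym h \<star> x \<star> rsym f \<in> J"
        using x by (rule tsid_lrmult[OF J(1)]) simp_all
      then have m: "rsym f \<star> (csym h \<star> x \<star> rsym f) \<star> csym h \<in> J"
        by (rule tsid_lrmult[OF J(1)]) simp_all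
      obtain s where s: "rsym f \<star> (csym h \<star> x \<star> rsym f) \<star> csym h = s \<odot> ?c"
        using rsym_star_csym_scalar[OF t, of "csym h \<star> x \<star> rsym f"] by auto
      have "s = 0"
      proof (rule ccontr)
        assume "s \<noteq> 0"
        have "(1 / s) \<odot> (s \<odot> ?c) \<in> J"
          using m unfolding s by (rule FV.subspace_scale[OF tsid_subspace(1)[OF subgrp_Sym J(1)]])
        then show False using False \<open>s \<noteq> 0\<close> by simp
      qed
      then show ?thesis using s by (simp add: star_assoc)
    qed
    have *: "u \<star> z \<star> v = 0" if u: "u \<in> gen ?c" and v: "v \<in> gen ?c" and z: "z \<in> J" for u v z
      using u unfolding gen_def
    proof (induction u rule: FV.span_induct_alt)
      case (step s x y)
      then obtain p q where x: "x = p \<star> ?c \<star> q" "p \<in> supp Sym" "q \<in> supp Sym" by blast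
      have "x \<star> z \<star> v = 0"
        using v unfolding gen_def
      proof (induction v rule: FV.span_induct_alt)
        case (step s' x' y')
        then obtain p' q' where x': "x' = p' \<star> ?c \<star> q'" "p' \<in> supp Sym" "q' \<in> supp Sym" by blast
        have "q \<star> z \<star> p' \<in> J"
          using z x(3) x'(2) by (rule tsid_lrmult[OF J(1)])
        then have "p \<star> (?c \<star> (q \<star> z \<star> p') \<star> ?c) \<star> q' = 0" by (simp add: cxc)
        then have "x \<star> z \<star> x' = 0" by (simp only: x x' star_assoc)
        then show ?case by (simp only: star_add_right star_scale_right step.IH FV.scale_zero_right add_0)
      qed (simp only: star_zero)
      then show ?case by (simp only: star_add_left star_scale_left step.IH FV.scale_zero_right add_0)
    qed (simp only: star_zero)
    obtain e where e: "e \<in> J" "\<And>x. x \<in> J \<Longrightarrow> e \<star> x = x"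
      using tsid_identity[OF subgrp_Sym J(1)] by metis
    have "e \<star> e \<star> e = 0" using e(1) J(2) by (intro *) auto
    then have "e = 0" using e by simp
    then have "x = 0" if "x \<in> J" for x using e(2)[OF that] by simp
    then show ?thesis using tsid_zero[OF J(1)] by blast
  qed
  then show ?thesis using nz tsid_gen by (simp add: minimal_among_def)
qed

text \<open>A submodule \<open>V\<close> missing \<open>?c\<close> is killed by left multiplication
  with \<open>?c\<close>, by the scalar rule. Positivity then shows \<open>V = {0}\<close>: for
  \<open>u\<close> in \<open>V\<close> the self-adjoint element \<open>adj u \<star> u\<close> has
  square 0.\<close>

lemma left_ideal_irreducible:
  assumes t: "tab \<mu> f h"
  shows "minimal_among (lsub Sym) {x \<star> (rsym f \<star> csym h) |x. x \<in> supp Sym}" (is "minimal_among _ ?U")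
proof -
  let ?c = "rsym f \<star> csym h"
  have c: "?c \<in> ?U" by (auto intro!: exI[of _ "delta id"] delta_supp)
  have U: "lsub Sym ?U"
    unfolding lsub_def
  proof (intro conjI ballI)
    show "0 \<in> ?U" by (auto intro!: exI[of _ 0])
  next
    fix x y assume "x \<in> ?U" "y \<in> ?U"
    then show "x + y \<in> ?U"
      by clarify (metis star_add_left supp_add)
  next
    fix a x assume "a \<in> supp Sym" "x \<in> ?U"
    then show "a \<star> x \<in> ?U" by clarify (metis star_assoc star_supp)
  qed auto
  have "V = {0} \<or> V = ?U" if V: "lsub Sym V" "V \<subseteq> ?U" for V
  proof (cases "?c \<in> V")
    case True
    then have "?U \<subseteq> V" using V(1) by (auto simp: lsub_def)
    then show ?thesis using V by blast
  next
    case False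
    have cu: "?c \<star> u = 0" if u: "u \<in> V" for u
    proof -
      obtain x where x: "x \<in> supp Sym" "u = x \<star> ?c" using u V by blast
      obtain s where s: "rsym f \<star> (csym h \<star> x \<star> rsym f) \<star> csym h = s \<odot> ?c"
        using rsym_star_csym_scalar[OF t, of "csym h \<star> x \<star> rsym f"] by auto
      then have cu: "?c \<star> u = s \<odot> ?c" by (simp add: x star_assoc)
      have "s = 0"
      proof (rule ccontr)
        assume "s \<noteq> 0"
        have "s \<odot> ?c \<in> V" using V(1) u by (simp add: lsub_def flip: cu)
        then have "(1 / s) \<odot> (s \<odot> ?c) \<in> V"
          by (rule FV.subspace_scale[OF lsub_subspace[OF subgrp_Sym V(1)]])
        then show False using False \<open>s \<noteq> 0\<close> by simp
      qed
      then show ?thesis using cu by simp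
    qed
    have "u = 0" if u: "u \<in> V" for u
    proof -
      have uS: "u \<in> supp Sym" using u V(1) by (auto simp: lsub_def)
      \<comment> \<open>Being in \<open>V\<close>, the element \<open>?z\<close> has the form
        \<open>x \<star> ?c\<close>; since \<open>?c\<close> annihilates \<open>?z\<close>, its
        square is 0.\<close>
      let ?z = "adj u \<star> u"
      have zV: "?z \<in> V" using u V(1) by (simp add: lsub_def)
      then obtain x where x: "?z = x \<star> ?c" using V by blast
      have "adj ?z \<star> ?z = ?z \<star> ?z" using uS by (simp add: adj_star adj_adj)
      also have "\<dots> = x \<star> (?c \<star> ?z)" by (metis x star_assoc)
      also have "\<dots> = 0" by (simp add: cu[OF zV])
      finally have "?z = 0" by (rule adj_star_self_eq_0[OF star_supp])
      then show ?thesis using adj_star_self_eq_0[OF uS] by simp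
    qed
    then show ?thesis using V(1) by (auto simp: lsub_def)
  qed
  moreover have "?U \<noteq> {0}" using c rsym_star_csym_nonzero[OF t] by blast
  ultimately show ?thesis using U by (simp add: minimal_among_def)
qed

text \<open>Two tableaux of the same shape differ by a relabelling, which conjugates the symmetrizer
  by a permutation.\<close>

lemma gen_tab_eq:
  assumes "tab \<mu> f h" "tab \<mu> f' h'"
  shows "gen (rsym f' \<star> csym h') = gen (rsym f \<star> csym h)"
proof -
  have sub: "gen (rsym f' \<star> csym h') \<subseteq> gen (rsym f \<star> csym h)"
    if t: "tab \<mu> f h" "tab \<mu> f' h'" for f h f' h'
  proof -
    obtain p where p: "p \<in> Sym" "\<And>x. x \<in> N \<Longrightarrow> f' x = f (p x)" "\<And>x. x \<in> N \<Longrightarrow> h' x = h (p x)"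
      using tab_perm[OF t] by metis
    have 1: "rsym f' = rsym (f \<circ> p)" "csym h' = csym (h \<circ> p)"
      using p by (auto intro!: rsym_cong)
    have "delta p \<star> (delta (inv' p) \<star> csym h) = csym h"
      using p(1) by (simp add: star_assoc[symmetric] delta_star_delta)
    then have "rsym f' \<star> csym h' = delta (inv' p) \<star> (rsym f \<star> csym h) \<star> delta p"
      by (simp add: 1 rsym_conj[OF p(1)] csym_conj[OF p(1)] star_assoc) (simp add: star_assoc[symmetric])
    also have "\<dots> \<in> gen (rsym f \<star> csym h)"
      using p(1) by (intro tsid_lrmult[OF tsid_gen gen_base] delta_supp) simp_all
    finally show ?thesis by (rule gen_subset[OF tsid_gen])
  qed
  show ?thesis using sub[OF assms] sub[OF assms(2,1)] by blast
qed

text \<open>For uniqueness in the description of \<open>I_comp\<close>: if \<open>I\<close> contains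
  a copy of the Specht module and \<open>u\<close> corresponds to the symmetrizer \<open>?c\<close>,
  then \<open>?c \<star> u\<close> corresponds to \<open>?c \<star> ?c\<close>, a nonzero multiple
  of \<open>?c\<close>. So \<open>?c \<star> u\<close> is a nonzero common element of
  \<open>I\<close> and \<open>gen ?c\<close>, and minimal ideals that meet coincide.\<close>

lemma I_comp_eq:
  assumes mu: "\<mu> \<in> partitions_of n" and t: "tab \<mu> f h"
  shows "I_comp n \<mu> = gen (rsym f \<star> csym h)"
proof -
  let ?c = "rsym (row_of \<mu>) \<star> csym (col_of \<mu>)"
  note t0 = tab_canonical[OF mu]
  have sp: "specht n \<mu> = {x \<star> ?c |x. x \<in> supp Sym}"
    by (simp add: specht_def young_symmetrizer_eq[OF mu] CS_simps)
  have cS: "?c \<in> specht n \<mu>"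
    unfolding sp by (auto intro!: exI[of _ "delta id"] delta_supp)
  have "I_comp n \<mu> = gen ?c"
    unfolding I_comp_def
  proof (rule the_equality)
    have "minimal_among (lsub Sym) (specht n \<mu>)"
      unfolding sp by (rule left_ideal_irreducible[OF t0])
    moreover have "specht n \<mu> \<subseteq> gen ?c"
      unfolding sp using tsid_lmult[OF tsid_gen gen_base] by auto
    moreover have "isomorphic_submodules (CS n) (supp Sym) (specht n \<mu>) (specht n \<mu>)"
      unfolding isomorphic_submodules_def by (rule exI[of _ id]) simp
    ultimately show "simple_ideal (gen ?c) (CS n) \<and>
        (\<exists>L. irreducible_module_of (gen ?c) (CS n) L \<and>
          isomorphic_submodules (CS n) (carrier (CS n)) L (specht n \<mu>))"
      using gen_tab_simple[OF t0]
      by (auto simp: simple_ideal_CS_iff irreducible_module_of_def irreducible_submodule_CS_iff CS_simps)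
  next
    fix I assume I: "simple_ideal I (CS n) \<and>
        (\<exists>L. irreducible_module_of I (CS n) L \<and>
          isomorphic_submodules (CS n) (carrier (CS n)) L (specht n \<mu>))"
    then obtain L where L: "L \<subseteq> I" and "isomorphic_submodules (CS n) (supp Sym) L (specht n \<mu>)"
      by (auto simp: irreducible_module_of_def CS_simps)
    then obtain F where F: "bij_betw F L (specht n \<mu>)" "\<And>a u. a \<in> supp Sym \<Longrightarrow> u \<in> L \<Longrightarrow> F (a \<star> u) = a \<star> F u"
      by (auto simp: isomorphic_submodules_def CS_simps)
    have "?c \<in> F ` L" using F(1) cS by (simp add: bij_betw_def)
    then obtain u where u: "u \<in> L" "F u = ?c" by (metis imageE)
    obtain s where s: "s \<noteq> 0" "?c \<star> ?c = s \<odot> ?c" using rsym_csym_rsym_csym[OF t0] by metis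
    have nz: "?c \<star> u \<noteq> 0"
    proof
      assume "?c \<star> u = 0"
      \<comment> \<open>Writing zero as \<open>0 \<star> u\<close> lets equivariance of
        \<open>F\<close> supply \<open>F 0 = 0\<close>.\<close>
      then have "F (?c \<star> u) = F (0 \<star> u)" by simp
      then have "?c \<star> ?c = 0" using F(2)[of ?c u] F(2)[of 0 u] u by simp
      then show False using s rsym_star_csym_nonzero[OF t0] by simp
    qed
    have I: "minimal_among (tsid Sym) I" using I by (simp add: simple_ideal_CS_iff)
    then have tI: "tsid Sym I" by (simp add: minimal_among_def)
    have uI: "u \<in> I" using u L by blast
    have "?c \<star> u \<in> I"
      by (rule tsid_lmult[OF tI uI]) simp
    moreover have "?c \<star> u \<in> gen ?c"
      by (rule tsid_rmult[OF tsid_gen gen_base tsid_supp[OF tI uI]]) simp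
    ultimately show "I = gen ?c"
      using minimal_tsid_meet[OF I gen_tab_simple[OF t0]] nz by blast
  qed
  then show ?thesis using gen_tab_eq[OF t0 t] by simp
qed

lemma I_comp_minimal: "\<mu> \<in> partitions_of n \<Longrightarrow> minimal_among (tsid Sym) (I_comp n \<mu>)"
  using gen_tab_simple tab_canonical I_comp_eq by metis

text \<open>The elements of \<open>J\<close> that annihilate every \<open>g \<star> b\<close> from
  the left form a two-sided ideal. If \<open>a \<star> z \<star> b\<close> always vanished, this
  ideal would contain the nonzero \<open>a \<star> x\<close>, hence be all of \<open>J\<close>, and
  \<open>y \<star> b\<close> would be 0.\<close>

lemma minimal_tsid_prime:
  assumes J: "minimal_among (tsid Sym) J"
    and x: "x \<in> J" "a \<star> x \<noteq> 0" and y: "y \<in> J" "y \<star> b \<noteq> 0" and a: "a \<in> supp Sym"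
  shows "\<exists>z\<in>J. a \<star> z \<star> b \<noteq> 0"
proof (rule ccontr)
  assume "\<not> ?thesis"
  then have 0: "a \<star> z \<star> b = 0" if "z \<in> J" for z using that by blast
  have t: "tsid Sym J" using J by (simp add: minimal_among_def)
  define K where "K = {w \<in> J. \<forall>g\<in>supp Sym. w \<star> g \<star> b = 0}"
  have "tsid Sym K"
  proof -
    have "a \<star> x \<star> g \<star> b = 0" if "x \<star> g \<star> b = 0" for a x g
      using that by (simp add: star_assoc)
    moreover have "x \<star> a \<star> g \<star> b = 0" if "\<forall>g\<in>supp Sym. x \<star> g \<star> b = 0" for a x g
      using bspec[OF that star_supp[of a g]] by (simp add: star_assoc)
    ultimately show ?thesis
      using t by (auto simp: K_def tsid_def lsub_def star_add_left)
  qed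
  moreover have "a \<star> x \<in> K"
  proof -
    have "a \<star> (x \<star> g) \<star> b = 0" if "g \<in> supp Sym" for g
      using 0 tsid_rmult[OF t x(1) that] by blast
    then show ?thesis using tsid_lmult[OF t x(1) a] by (simp add: K_def star_assoc)
  qed
  moreover have "K \<subseteq> J" by (auto simp: K_def)
  ultimately have "K = J" using J x(2) unfolding minimal_among_def by blast
  then have "y \<in> K" using y(1) by simp
  then have "y \<star> delta id \<star> b = 0" by (simp add: K_def delta_supp)
  then show False using y tsid_supp[OF t y(1)] by simp
qed

text \<open>If the components coincide, primeness yields a permutation with nonzero product between
  the row symmetrizer of one shape and the column symmetrizer of the other. Such rows and columns
  separate the entries, which gives a dominance inequality; by symmetry the two shapes dominate each
  other.\<close>

lemma I_comp_inj:
  assumes mu: "\<mu> \<in> partitions_of n" and nu: "\<nu> \<in> partitions_of n" and eq: "I_comp n \<mu> = I_comp n \<nu>"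
  shows "\<mu> = \<nu>"
proof -
  have le: "card {x \<in> N. col_of \<nu> x < j} \<le> card {x \<in> N. col_of \<mu> x < j}"
    if mu: "\<mu> \<in> partitions_of n" and nu: "\<nu> \<in> partitions_of n" and eq: "I_comp n \<mu> = I_comp n \<nu>" for \<mu> \<nu> j
  proof -
    let ?a = "rsym (row_of \<mu>)" and ?b = "csym (col_of \<mu>)" and ?a' = "rsym (row_of \<nu>)" and ?b' = "csym (col_of \<nu>)"
    note t = tab_canonical[OF mu] and t' = tab_canonical[OF nu]
    obtain s where s: "s \<noteq> 0" "?a \<star> ?b \<star> (?a \<star> ?b) = s \<odot> (?a \<star> ?b)"
      using rsym_csym_rsym_csym[OF t] by metis
    obtain s' where s': "s' \<noteq> 0" "?a' \<star> ?b' \<star> (?a' \<star> ?b') = s' \<odot> (?a' \<star> ?b')"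
      using rsym_csym_rsym_csym[OF t'] by metis
    \<comment> \<open>The elements \<open>bab\<close> and \<open>a'b'a'\<close> lie in the common
      component and are not killed by \<open>a\<close> on the left and by \<open>b'\<close> on the
      right, because the symmetrizers have nonzero squares.\<close>
    have "?a \<star> (?b \<star> (?a \<star> ?b)) \<noteq> 0"
      using s rsym_star_csym_nonzero[OF t] by (simp add: star_assoc)
    moreover have "(?a' \<star> ?b' \<star> ?a') \<star> ?b' \<noteq> 0"
      using s' rsym_star_csym_nonzero[OF t'] by (simp add: star_assoc)
    moreover have "?b \<star> (?a \<star> ?b) \<in> I_comp n \<mu>"
      unfolding I_comp_eq[OF mu t] by (intro tsid_lmult[OF tsid_gen] gen_base) auto
    moreover have "?a' \<star> ?b' \<star> ?a' \<in> I_comp n \<mu>"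
      unfolding eq I_comp_eq[OF nu t'] by (intro tsid_rmult[OF tsid_gen] gen_base) auto
    ultimately obtain z where z: "z \<in> I_comp n \<mu>" "?a \<star> z \<star> ?b' \<noteq> 0"
      using minimal_tsid_prime[OF I_comp_minimal[OF mu]] rsym_supp by blast
    have "z \<in> supp Sym" using z I_comp_minimal[OF mu] tsid_supp by (auto simp: minimal_among_def)
    then have "?a \<star> z \<star> ?b' = (\<Sum>g\<in>Sym. z g \<odot> (?a \<star> delta g \<star> ?b'))"
      by (subst supp_expand[of z Sym]) (simp_all add: star_sum_right star_sum_left)
    then have "\<exists>g\<in>Sym. ?a \<star> delta g \<star> ?b' \<noteq> 0"
      using z(2) by (metis (no_types, lifting) FV.scale_zero_right sum.neutral)
    then obtain g where g: "g \<in> Sym" "?a \<star> delta g \<star> ?b' \<noteq> 0" by blast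
    have "inj_on (\<lambda>x. (row_of \<mu> x, col_of \<nu> (inv' g x))) N"
      using rsym_delta_csym_zero[OF g(1), of _ _ "row_of \<mu>" "col_of \<nu>"] g(2) unfolding inj_on_def by blast
    from column_count_le[OF t this, of j] show ?thesis
      using card_Sym_reindex[OF Sym_inv[OF g(1)], of "\<lambda>x. col_of \<nu> x < j"] by simp
  qed
  have cnt: "card {x \<in> N. col_of \<nu> x < j} = card {x \<in> N. col_of \<mu> x < j}" for j
    using le[OF mu nu eq, of j] le[OF nu mu eq[symmetric], of j] by simp
  \<comment> \<open>Differences of consecutive column counts are column lengths, so the counts
    determine the conjugate partition.\<close>
  have conj: "card {x \<in> N. col_of \<mu> x < Suc j} = card {x \<in> N. col_of \<mu> x < j} + conjugate \<mu> j"
    if mu: "\<mu> \<in> partitions_of n" for \<mu> j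
  proof -
    have "bij_betw (row_of \<mu>) {x \<in> N. col_of \<mu> x = j} {i. j < \<mu> i}"
      by (rule bij_betwI[of _ _ _ "\<lambda>i. tableau \<mu> (i, j)"])
        (use row_col_tableau[OF mu] tableau_row_col[OF mu] in \<open>auto simp: diagram_def\<close>)
    then have "card {x \<in> N. col_of \<mu> x = j} = conjugate \<mu> j"
      by (simp add: conjugate_def bij_betw_same_card)
    moreover have "{x \<in> N. col_of \<mu> x < Suc j} = {x \<in> N. col_of \<mu> x < j} \<union> {x \<in> N. col_of \<mu> x = j}" by auto
    moreover have "card \<dots> = card {x \<in> N. col_of \<mu> x < j} + card {x \<in> N. col_of \<mu> x = j}"
      by (rule card_Un_disjoint) auto
    ultimately show ?thesis by simp
  qed
  have "conjugate \<mu> = conjugate \<nu>"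
  proof
    fix j show "conjugate \<mu> j = conjugate \<nu> j"
      using conj[OF mu, of j] conj[OF nu, of j] cnt[of j] cnt[of "Suc j"] by linarith
  qed
  then show ?thesis using conjugate_conjugate mu nu by metis
qed

end


subsection \<open>Every simple ideal is an isotypic component\<close>

lemma strict_rank:
  assumes fin: "finite A"
    and irr: "\<And>a. \<not> R a a" and tr: "\<And>a b c. R a b \<Longrightarrow> R b c \<Longrightarrow> R a c"
    and tot: "\<And>a b. a \<in> A \<Longrightarrow> b \<in> A \<Longrightarrow> a \<noteq> b \<Longrightarrow> R a b \<or> R b a"
  defines "rk \<equiv> \<lambda>a. card {b \<in> A. R b a}"
  shows "a \<in> A \<Longrightarrow> b \<in> A \<Longrightarrow> rk a < rk b \<longleftrightarrow> R a b"
    and "a \<in> A \<Longrightarrow> b \<in> A \<Longrightarrow> rk a = rk b \<longleftrightarrow> a = b"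
    and "rk ` A = {..<card A}"
proof -
  have less: "rk a < rk b" if "a \<in> A" "R a b" for a b
  proof -
    have "{c \<in> A. R c a} \<subset> {c \<in> A. R c b}"
      using that tr irr by blast
    then show ?thesis unfolding rk_def using fin by (intro psubset_card_mono) auto
  qed
  show 1: "rk a < rk b \<longleftrightarrow> R a b" if "a \<in> A" "b \<in> A" for a b
    using less[of a b] less[of b a] tot[of a b] irr that by (metis less_asym')
  show 2: "rk a = rk b \<longleftrightarrow> a = b" if "a \<in> A" "b \<in> A" for a b
    using less[of a b] less[of b a] tot[of a b] that by (metis less_irrefl)
  have "rk a < card A" if "a \<in> A" for a
  proof -
    have "{c \<in> A. R c a} \<subset> A" using that irr by blast
    then show ?thesis unfolding rk_def using fin by (intro psubset_card_mono)
  qed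
  then have "rk ` A \<subseteq> {..<card A}" by auto
  moreover have "card (rk ` A) = card {..<card A}"
    using 2 by (subst card_image) (auto intro: inj_onI)
  ultimately show "rk ` A = {..<card A}"
    by (intro card_subset_eq) auto
qed

context sym_algebra begin

section \<open>Colourings, block sizes and pairs in common blocks\<close>

lemma Sym_inj_iff: "g \<in> Sym \<Longrightarrow> g x = g y \<longleftrightarrow> x = y"
  by (metis Sym_cancel_app(1))

definition blk :: "(nat \<Rightarrow> nat) \<Rightarrow> nat \<Rightarrow> nat" where
  "blk f i = card {x \<in> N. f x = i}"

text \<open>Larger blocks come first; ties are broken by the colour to obtain a strict total order.
  For the rows of a tableau, \<open>rank\<close> recovers the row number.\<close>

definition hi :: "(nat \<Rightarrow> nat) \<Rightarrow> nat \<Rightarrow> nat \<Rightarrow> bool" where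
  "hi f i j \<longleftrightarrow> blk f i > blk f j \<or> blk f i = blk f j \<and> i < j"

definition rank :: "(nat \<Rightarrow> nat) \<Rightarrow> nat \<Rightarrow> nat" where
  "rank f y = card {i \<in> f ` N. hi f i (f y)}"

text \<open>Ordered pairs, so the cardinality is twice the number of transpositions in
  \<open>stab f\<close>.\<close>

definition same :: "(nat \<Rightarrow> nat) \<Rightarrow> (nat \<times> nat) set" where
  "same f = {(x, y). x \<in> N \<and> y \<in> N \<and> x \<noteq> y \<and> f x = f y}"

lemma hi_irrefl: "\<not> hi f i i" by (simp add: hi_def)

lemma hi_trans: "hi f i j \<Longrightarrow> hi f j k \<Longrightarrow> hi f i k" by (auto simp: hi_def)

lemma hi_asym: "hi f i j \<Longrightarrow> \<not> hi f j i" by (auto simp: hi_def)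

lemma hi_total: "i \<noteq> j \<Longrightarrow> hi f i j \<or> hi f j i" by (auto simp: hi_def)

lemma rank_less: "x \<in> N \<Longrightarrow> y \<in> N \<Longrightarrow> rank f x < rank f y \<longleftrightarrow> hi f (f x) (f y)"
  unfolding rank_def by (rule strict_rank(1)) (simp_all add: hi_irrefl hi_total, use hi_trans in blast)

lemma rank_eq: "x \<in> N \<Longrightarrow> y \<in> N \<Longrightarrow> rank f x = rank f y \<longleftrightarrow> f x = f y"
  unfolding rank_def by (rule strict_rank(2)) (simp_all add: hi_irrefl hi_total, use hi_trans in blast)

lemma rank_below:
  assumes "y \<in> N" "i < rank f y"
  shows "\<exists>x\<in>N. rank f x = i"
proof -
  have "(\<lambda>a. card {b \<in> f ` N. hi f b a}) ` f ` N = {..<card (f ` N)}"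
    by (rule strict_rank(3)) (simp_all add: hi_irrefl hi_total, use hi_trans in blast)
  then have *: "rank f ` N = {..<card (f ` N)}" by (simp add: image_image rank_def)
  then have "rank f y < card (f ` N)" using assms(1) by blast
  then have "i \<in> rank f ` N" using assms(2) * by simp
  then show ?thesis by blast
qed

lemma finite_same [simp]: "finite (same f)"
  by (rule finite_subset[of _ "N \<times> N"]) (auto simp: same_def)

lemma card_cross:
  assumes "finite R" "finite A" "y \<notin> A" "\<And>a b. (a, b) \<in> R \<Longrightarrow> a \<noteq> y \<and> b \<noteq> y"
  shows "card (R \<union> ({y} \<times> A \<union> A \<times> {y})) = card R + 2 * card A"
proof -
  have "card (R \<union> ({y} \<times> A \<union> A \<times> {y})) = card R + card ({y} \<times> A \<union> A \<times> {y})"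
    using assms by (intro card_Un_disjoint) auto
  also have "card ({y} \<times> A \<union> A \<times> {y}) = card ({y} \<times> A) + card (A \<times> {y})"
    using assms by (intro card_Un_disjoint) auto
  finally show ?thesis by (simp add: card_cartesian_product)
qed

text \<open>Leaving its block, \<open>y\<close> loses one partner fewer than the size of that block;
  joining block \<open>i\<close>, which is at least as large, it gains as many partners as that
  block has elements.\<close>

lemma card_same_update:
  assumes y: "y \<in> N" and hi: "hi f i (f y)"
  shows "card (same f) < card (same (f(y := i)))"
proof -
  have ne: "i \<noteq> f y" using hi hi_irrefl by blast
  define A where "A = {x \<in> N. f x = f y} - {y}"
  define C where "C = {x \<in> N. f x = i}"
  define R where "R = {(x, z). x \<in> N \<and> z \<in> N \<and> x \<noteq> z \<and> f x = f z \<and> x \<noteq> y \<and> z \<noteq> y}"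
  have fin: "finite R" by (rule finite_subset[of _ "N \<times> N"]) (auto simp: R_def)
  have "same f = R \<union> ({y} \<times> A \<union> A \<times> {y})"
    using y by (auto simp: same_def R_def A_def)
  moreover have "card (R \<union> ({y} \<times> A \<union> A \<times> {y})) = card R + 2 * card A"
    by (rule card_cross) (use fin in \<open>auto simp: A_def R_def\<close>)
  moreover have "same (f(y := i)) = R \<union> ({y} \<times> C \<union> C \<times> {y})"
    using y ne by (auto simp: same_def R_def C_def split: if_splits)
  moreover have "card (R \<union> ({y} \<times> C \<union> C \<times> {y})) = card R + 2 * card C"
    by (rule card_cross) (use fin ne in \<open>auto simp: C_def R_def\<close>)
  moreover have "card A < card C"
  proof -
    have "card A < card {x \<in> N. f x = f y}"
      unfolding A_def by (rule psubset_card_mono) (use y in auto)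
    also have "\<dots> \<le> card C" using hi by (auto simp: C_def hi_def blk_def)
    finally show ?thesis .
  qed
  ultimately show ?thesis by simp
qed

text \<open>Coset decomposition of the Young subgroup of the updated colouring with respect to the
  stabiliser of \<open>y\<close>.\<close>

lemma rsym_update:
  assumes y: "y \<in> N" and ne: "i \<noteq> f y"
  shows "\<exists>c. c \<noteq> 0 \<and>
    rsym (f(y := i)) \<star> rsym f = c \<odot> (rsym f + (\<Sum>x | x \<in> N \<and> f x = i. delta (transpose x y) \<star> rsym f))"
proof -
  let ?f' = "f(y := i)"
  define B where "B = {x \<in> N. f x = i}"
  define K where "K = {g \<in> stab ?f'. g y = y}"
  have finB: "finite B" "y \<notin> B" using ne by (auto simp: B_def)
  have K: "k \<in> stab f" if k: "k \<in> K" for k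
  proof -
    have kS: "k \<in> stab ?f'" "k y = y" "k \<in> Sym" using k stab_Sym[of k ?f'] by (auto simp: K_def)
    have "f (k x) = f x" if x: "x \<in> N" for x
    proof (cases "x = y")
      case False
      then have "k x \<noteq> y" using kS by (metis Sym_cancel_app(1))
      then show ?thesis using stab_app[OF kS(1) x] False by simp
    qed (simp add: kS)
    then show ?thesis using kS(3) by (simp add: stab_def)
  qed
  have tr: "transpose u y \<in> stab ?f'" if "u \<in> insert y B" for u
    using that y by (intro transpose_stab) (auto simp: B_def)
  have bij: "bij_betw (\<lambda>(u, k). transpose u y \<circ> k) (insert y B \<times> K) (stab ?f')"
  proof (rule bij_betwI[of _ _ _ "\<lambda>g. (g y, transpose (g y) y \<circ> g)"])
    show "(\<lambda>(u, k). transpose u y \<circ> k) \<in> insert y B \<times> K \<rightarrow> stab ?f'"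
      using stab_comp tr by (fastforce simp: K_def)
    show "(\<lambda>g. (g y, transpose (g y) y \<circ> g)) \<in> stab ?f' \<rightarrow> insert y B \<times> K"
    proof
      fix g assume g: "g \<in> stab ?f'"
      have "?f' (g y) = i" using stab_app[OF g y] by simp
      then have "g y \<in> insert y B" using Sym_image[OF stab_Sym[OF g] y] by (auto simp: B_def split: if_splits)
      moreover from this have "transpose (g y) y \<circ> g \<in> K"
        using stab_comp[OF tr g] by (simp add: K_def)
      ultimately show "(g y, transpose (g y) y \<circ> g) \<in> insert y B \<times> K" by simp
    qed
  qed (auto simp: K_def comp_assoc[symmetric])
  have "rsym ?f' \<star> rsym f = (\<Sum>g\<in>stab ?f'. delta g \<star> rsym f)"
    by (simp only: rsym_expand[of ?f'] star_sum_left)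
  also have "\<dots> = (\<Sum>(u, k)\<in>insert y B \<times> K. delta (transpose u y \<circ> k) \<star> rsym f)"
    by (subst sum.reindex_bij_betw[OF bij, symmetric]) (simp add: case_prod_unfold)
  also have "\<dots> = (\<Sum>(u, k)\<in>insert y B \<times> K. delta (transpose u y) \<star> rsym f)"
  proof (intro sum.cong refl, clarify)
    fix u k assume "u \<in> insert y B" "k \<in> K"
    then have "delta (transpose u y \<circ> k) = delta (transpose u y) \<star> delta k"
      using stab_Sym[OF tr] stab_Sym[OF K] by (simp add: delta_star_delta)
    then show "delta (transpose u y \<circ> k) \<star> rsym f = delta (transpose u y) \<star> rsym f"
      using delta_star_rsym[OF K[OF \<open>k \<in> K\<close>]] by (simp add: star_assoc)
  qed
  also have "\<dots> = (\<Sum>u\<in>insert y B. \<Sum>k\<in>K. delta (transpose u y) \<star> rsym f)"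
    by (rule sum.cartesian_product[symmetric])
  also have "\<dots> = (\<Sum>u\<in>insert y B. of_nat (card K) \<odot> (delta (transpose u y) \<star> rsym f))"
    by (simp only: sum_const_scale)
  also have "\<dots> = of_nat (card K) \<odot> (\<Sum>u\<in>insert y B. delta (transpose u y) \<star> rsym f)"
    by (simp only: FV.scale_sum_right)
  also have "(\<Sum>u\<in>insert y B. delta (transpose u y) \<star> rsym f) = rsym f + (\<Sum>u\<in>B. delta (transpose u y) \<star> rsym f)"
  proof -
    have "transpose y y = id" by (simp add: fun_eq_iff transpose_def)
    then show ?thesis using finB by (simp only: sum.insert not_False_eq_True star_one(1)[OF rsym_supp])
  qed
  finally have eq: "rsym ?f' \<star> rsym f = of_nat (card K) \<odot> (rsym f + (\<Sum>u\<in>B. delta (transpose u y) \<star> rsym f))" .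
  have "id \<in> K" by (simp add: K_def)
  moreover have "finite K" by (rule finite_subset[OF _ finite_stab[of ?f']]) (auto simp: K_def)
  ultimately have "of_nat (card K) \<noteq> (0::complex)" by auto
  then show ?thesis using eq unfolding B_def by blast
qed

text \<open>The class sum of all transpositions acts on a simple ideal by a scalar. It is computed on a
  row colouring and on a column colouring with as many pairs in common blocks as possible;
  comparing the results shows that the two colourings are the rows and columns of a tableau.\<close>

definition omega :: "(nat \<Rightarrow> nat) \<Rightarrow> complex" where
  "omega = (\<Sum>(x, y) | x \<in> N \<and> y \<in> N \<and> x \<noteq> y. delta (transpose x y))"

lemma omega_central: "x \<in> supp Sym \<Longrightarrow> omega \<star> x = x \<star> omega"
proof -
  have fin: "finite {(x, y). x \<in> N \<and> y \<in> N \<and> x \<noteq> y}" by (rule finite_subset[of _ "N \<times> N"]) auto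
  have g: "omega \<star> delta g = delta g \<star> omega" if g: "g \<in> Sym" for g
  proof -
    note inj = Sym_inj_iff[OF g] Sym_inj_iff[OF Sym_inv[OF g]]
    have comm: "g \<circ> transpose x y = transpose (g x) (g y) \<circ> g" for x y
      by (auto simp: fun_eq_iff transpose_def inj)
    have "delta g \<star> omega = (\<Sum>(x, y) | x \<in> N \<and> y \<in> N \<and> x \<noteq> y. delta (transpose (g x) (g y)) \<star> delta g)"
      unfolding omega_def star_sum_right
    proof (intro sum.cong refl, clarify)
      fix x y assume "x \<in> N" "y \<in> N"
      then show "delta g \<star> delta (transpose x y) = delta (transpose (g x) (g y)) \<star> delta g"
        using g Sym_image[OF g] transpose_Sym comm by (simp add: delta_star_delta)
    qed
    also have "\<dots> = (\<Sum>(x, y) | x \<in> N \<and> y \<in> N \<and> x \<noteq> y. delta (transpose x y) \<star> delta g)"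
      by (rule sum.reindex_bij_witness[of _ "\<lambda>(x, y). (inv' g x, inv' g y)" "\<lambda>(x, y). (g x, g y)"])
        (use g in \<open>auto simp: inj Sym_image[OF g] Sym_image[OF Sym_inv[OF g]]\<close>)
    also have "\<dots> = omega \<star> delta g"
      unfolding omega_def star_sum_left by (intro sum.cong) auto
    finally show ?thesis ..
  qed
  assume x: "x \<in> supp Sym"
  have "omega \<star> (\<Sum>g\<in>Sym. x g \<odot> delta g) = (\<Sum>g\<in>Sym. x g \<odot> delta g) \<star> omega"
    unfolding star_sum_right star_sum_left by (intro sum.cong refl) (simp add: g)
  then show ?thesis using supp_expand[OF x finite_Sym] by simp
qed

lemma twist_omega: "twist omega = - omega"
proof -
  have "twist omega = (\<Sum>(x, y) | x \<in> N \<and> y \<in> N \<and> x \<noteq> y. - delta (transpose x y))"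
    unfolding omega_def twist_sum
    by (intro sum.cong refl) (auto simp: twist_delta sign_swap_id)
  also have "\<dots> = - omega"
    unfolding omega_def by (simp add: sum_negf case_prod_unfold)
  finally show ?thesis .
qed

text \<open>Transpositions within a block fix the vector. For a fixed \<open>y\<close> and a block
  higher than its own, the transpositions of \<open>y\<close> with that block sum to -1 on the
  vector, by the coset decomposition and maximality. There are \<open>rank f y\<close> such blocks,
  and every pair of positions occurs in both orders.\<close>

lemma omega_eigen:
  assumes J: "tsid Sym J" and z: "z \<in> J"
    and max: "\<And>f' z. card (same f) < card (same f') \<Longrightarrow> z \<in> J \<Longrightarrow> rsym f' \<star> z = 0"
  shows "omega \<star> (rsym f \<star> z) =
    of_int (int (card (same f)) - 2 * int (\<Sum>y\<in>N. rank f y)) \<odot> (rsym f \<star> z)"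
proof -
  let ?v = "rsym f \<star> z"
  have vJ: "?v \<in> J" by (rule tsid_lmult[OF J z]) simp
  have rel: "(\<Sum>x | x \<in> N \<and> f x = i. delta (transpose x y) \<star> ?v) = - ?v"
    if y: "y \<in> N" and hi: "hi f i (f y)" for i y
  proof -
    have ne: "i \<noteq> f y" using hi hi_irrefl by blast
    obtain c where c: "c \<noteq> 0"
      "rsym (f(y := i)) \<star> rsym f = c \<odot> (rsym f + (\<Sum>x | x \<in> N \<and> f x = i. delta (transpose x y) \<star> rsym f))"
      using rsym_update[of y i f] y ne by blast
    \<comment> \<open>Moving \<open>y\<close> to a higher block creates more pairs, so by maximality
      the symmetrizer of the new colouring kills \<open>J\<close>.\<close>
    have "0 = rsym (f(y := i)) \<star> ?v"
      using max[OF card_same_update[OF y hi] vJ] by simp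
    also have "\<dots> = c \<odot> (?v + (\<Sum>x | x \<in> N \<and> f x = i. delta (transpose x y) \<star> ?v))"
      unfolding star_assoc[symmetric] c(2) by (simp only: star_scale_left star_add_left star_sum_left)
    finally have "c = 0 \<or> ?v + (\<Sum>x | x \<in> N \<and> f x = i. delta (transpose x y) \<star> ?v) = 0"
      unfolding FV.scale_eq_0_iff[symmetric] by (rule sym)
    then have "?v + (\<Sum>x | x \<in> N \<and> f x = i. delta (transpose x y) \<star> ?v) = 0"
      using c(1) by blast
    then show ?thesis by (simp only: eq_neg_iff_add_eq_0 add.commute)
  qed
  define U where "U = {(x, y). x \<in> N \<and> y \<in> N \<and> hi f (f x) (f y)}"
  define U' where "U' = {(x, y). x \<in> N \<and> y \<in> N \<and> hi f (f y) (f x)}"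
  let ?F = "\<lambda>(x, y). delta (transpose x y) \<star> ?v"
  have fin: "finite U" "finite U'"
    by (rule finite_subset[of _ "N \<times> N"]; auto simp: U_def U'_def)+
  have "{(x, y). x \<in> N \<and> y \<in> N \<and> x \<noteq> y} = same f \<union> (U \<union> U')"
    using hi_total[of _ _ f] hi_irrefl[of f] by (auto simp: same_def U_def U'_def)
  then have "omega \<star> ?v = sum ?F (same f \<union> (U \<union> U'))"
    unfolding omega_def star_sum_left by (simp add: case_prod_unfold)
  also have "\<dots> = sum ?F (same f) + sum ?F (U \<union> U')"
    by (rule sum.union_disjoint) (use fin finite_same[of f] hi_irrefl[of f] in \<open>auto simp: same_def U_def U'_def\<close>)
  also have "sum ?F (U \<union> U') = sum ?F U + sum ?F U'"
    by (rule sum.union_disjoint) (use fin hi_irrefl[of f] hi_trans[of f] in \<open>auto simp: U_def U'_def\<close>)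
  also have "sum ?F U' = sum ?F U"
    by (rule sum.reindex_bij_witness[of _ prod.swap prod.swap]) (auto simp: U_def U'_def transpose_commute)
  also have "sum ?F U = (\<Sum>y\<in>N. \<Sum>x | x \<in> N \<and> hi f (f x) (f y). delta (transpose x y) \<star> ?v)"
    by (subst sum.Sigma) (auto simp: U_def intro!: sum.reindex_bij_witness[of _ prod.swap prod.swap])
  also have "\<dots> = (\<Sum>y\<in>N. of_nat (rank f y) \<odot> (- ?v))"
  proof (rule sum.cong[OF refl])
    fix y assume y: "y \<in> N"
    have "(\<Sum>x | x \<in> N \<and> hi f (f x) (f y). delta (transpose x y) \<star> ?v)
      = (\<Sum>i | i \<in> f ` N \<and> hi f i (f y). \<Sum>x | x \<in> {x. x \<in> N \<and> hi f (f x) (f y)} \<and> f x = i. delta (transpose x y) \<star> ?v)"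
      by (rule sum.group[symmetric]) auto
    also have "\<dots> = (\<Sum>i | i \<in> f ` N \<and> hi f i (f y). - ?v)"
    proof (rule sum.cong[OF refl])
      fix i assume i: "i \<in> {i. i \<in> f ` N \<and> hi f i (f y)}"
      then have "{x. x \<in> {x. x \<in> N \<and> hi f (f x) (f y)} \<and> f x = i} = {x. x \<in> N \<and> f x = i}" by auto
      then show "(\<Sum>x | x \<in> {x. x \<in> N \<and> hi f (f x) (f y)} \<and> f x = i. delta (transpose x y) \<star> ?v) = - ?v"
        using rel[OF y] i by simp
    qed
    finally show "(\<Sum>x | x \<in> N \<and> hi f (f x) (f y). delta (transpose x y) \<star> ?v) = of_nat (rank f y) \<odot> (- ?v)"
      by (simp only: sum_const_scale rank_def)
  qed
  also have "\<dots> = of_int (- int (\<Sum>y\<in>N. rank f y)) \<odot> ?v"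
    unfolding FV.scale_sum_left[symmetric] by simp
  also have "sum ?F (same f) = (\<Sum>p\<in>same f. ?v)"
  proof (intro sum.cong refl, clarify)
    fix x y assume "(x, y) \<in> same f"
    then have "delta (transpose x y) \<star> rsym f = rsym f"
      by (intro delta_star_rsym transpose_stab) (auto simp: same_def)
    then show "delta (transpose x y) \<star> ?v = ?v" by (simp add: star_assoc[symmetric])
  qed
  also have "\<dots> = of_int (int (card (same f))) \<odot> ?v"
    by (simp only: sum_const_scale of_int_of_nat_eq)
  finally have eq: "omega \<star> ?v = of_int (int (card (same f))) \<odot> ?v +
    (of_int (- int (\<Sum>y\<in>N. rank f y)) \<odot> ?v + of_int (- int (\<Sum>y\<in>N. rank f y)) \<odot> ?v)" .
  have "of_int (int (card (same f)) - 2 * int (\<Sum>y\<in>N. rank f y)) =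
    of_int (int (card (same f))) + (of_int (- int (\<Sum>y\<in>N. rank f y)) + (of_int (- int (\<Sum>y\<in>N. rank f y)) :: complex))"
    by simp
  then show ?thesis
    by (simp only: eq FV.scale_left_distrib)
qed

text \<open>As \<open>omega\<close> is central, its eigenvectors in \<open>J\<close> form an ideal,
  and minimality leaves only \<open>J\<close> itself.\<close>

lemma omega_eigen_ideal:
  assumes J: "minimal_among (tsid Sym) J" and v: "v \<in> J" "v \<noteq> 0" "omega \<star> v = c \<odot> v" and w: "w \<in> J"
  shows "omega \<star> w = c \<odot> w"
proof -
  have t: "tsid Sym J" using J by (simp add: minimal_among_def)
  define K where "K = {w \<in> J. omega \<star> w = c \<odot> w}"
  have l: "omega \<star> (a \<star> w) = c \<odot> (a \<star> w)" if "omega \<star> w = c \<odot> w" "a \<in> supp Sym" for a w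
    using that omega_central[OF that(2)] by (metis star_assoc star_scale_right)
  have r: "omega \<star> (w \<star> a) = c \<odot> (w \<star> a)" if "omega \<star> w = c \<odot> w" for a w
    using that by (metis star_assoc star_scale_left)
  have "tsid Sym K"
    using t l r unfolding K_def tsid_def lsub_def
    by (auto simp: star_add_right FV.scale_right_distrib)
  moreover have "K \<noteq> {0}" "K \<subseteq> J" using v by (auto simp: K_def)
  ultimately have "K = J" using J by (auto simp: minimal_among_def)
  then show ?thesis using w by (auto simp: K_def)
qed

lemma tsid_twist:
  assumes "tsid Sym J" shows "tsid Sym (twist ` J)"
proof -
  have "a \<star> twist x \<in> twist ` J" "twist x \<star> a \<in> twist ` J" if "a \<in> supp Sym" "x \<in> J" for a x
  proof -
    have "a \<star> twist x = twist (twist a \<star> x)" "twist x \<star> a = twist (x \<star> twist a)" by (simp_all add: twist_star)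
    moreover have "twist a \<star> x \<in> J" "x \<star> twist a \<in> J"
      using assms that tsid_lmult tsid_rmult by auto
    ultimately show "a \<star> twist x \<in> twist ` J" "twist x \<star> a \<in> twist ` J" by auto
  qed
  moreover have "0 \<in> twist ` J" using tsid_zero[OF assms] by (metis image_eqI twist_zero)
  moreover have "x + y \<in> twist ` J" if xy: "x \<in> twist ` J" "y \<in> twist ` J" for x y
  proof -
    obtain u v where "u \<in> J" "v \<in> J" "x = twist u" "y = twist v" using xy by blast
    moreover from this have "u + v \<in> J" using assms by (simp add: tsid_def lsub_def)
    ultimately show ?thesis by (simp add: twist_add[symmetric])
  qed
  moreover have "twist ` J \<subseteq> supp Sym" using tsid_supp[OF assms] by auto
  ultimately show ?thesis by (auto simp: tsid_def lsub_def)
qed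

lemma minimal_twist:
  assumes "minimal_among (tsid Sym) J" shows "minimal_among (tsid Sym) (twist ` J)"
proof -
  have tt: "twist ` twist ` K = K" for K by (simp add: image_image)
  have "K = {0} \<or> K = twist ` J" if K: "tsid Sym K" "K \<subseteq> twist ` J" for K
  proof -
    have "twist ` K \<subseteq> J" using image_mono[OF K(2), of twist] by (simp add: tt)
    then have "twist ` K = {0} \<or> twist ` K = J"
      using assms tsid_twist[OF K(1)] by (simp add: minimal_among_def)
    then show ?thesis
    proof
      assume "twist ` K = {0}"
      then have "twist ` twist ` K = twist ` {0}" by (rule arg_cong)
      then show ?thesis by (simp add: tt)
    next
      assume "twist ` K = J"
      then have "twist ` twist ` K = twist ` J" by (rule arg_cong)
      then show ?thesis by (simp add: tt)
    qed
  qed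
  moreover have "twist ` J \<noteq> {0}"
  proof
    assume "twist ` J = {0}"
    then have "twist ` twist ` J = twist ` {0}" by (rule arg_cong)
    then show False using assms by (simp add: tt minimal_among_def)
  qed
  ultimately show ?thesis using assms tsid_twist by (simp add: minimal_among_def)
qed

text \<open>Some colouring acts nontrivially, since the injective colouring \<open>id\<close> has
  trivial Young subgroup and symmetrizer 1; the number of pairs is bounded, so a maximal choice
  exists.\<close>

lemma exists_maximal_colouring:
  assumes J: "minimal_among (tsid Sym) J"
  obtains f z where "z \<in> J" "rsym f \<star> z \<noteq> 0"
    "\<And>f' z. card (same f) < card (same f') \<Longrightarrow> z \<in> J \<Longrightarrow> rsym f' \<star> z = 0"
proof -
  define P where "P f \<longleftrightarrow> (\<exists>z\<in>J. rsym f \<star> z \<noteq> 0)" for f :: "nat \<Rightarrow> nat"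
  have t: "tsid Sym J" and nz: "J \<noteq> {0}" using J by (auto simp: minimal_among_def)
  then obtain z where z: "z \<in> J" "z \<noteq> 0" using tsid_zero by blast
  have "g = id" if g: "g \<in> stab id" for g
  proof
    fix x show "g x = id x"
    proof (cases "x \<in> N")
      case True
      then show ?thesis using stab_app[OF g] by simp
    next
      case False
      then show ?thesis using permutes_not_in[of g N x] stab_Sym[OF g] by (simp add: Sym_def N_def)
    qed
  qed
  then have "stab id = {id}" using id_stab by blast
  then have "rsym id = delta id" by (simp add: rsym_expand)
  then have "rsym id \<star> z \<noteq> 0" using z tsid_supp[OF t z(1)] by simp
  then have P0: "P id" using z(1) unfolding P_def by blast
  have bound: "card (same f) < Suc (card (N \<times> N))" for f
    unfolding less_Suc_eq_le by (rule card_mono) (auto simp: same_def)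
  obtain f where f: "P f" "\<And>f'. P f' \<Longrightarrow> card (same f') \<le> card (same f)"
    using ex_has_greatest_nat[of P id "\<lambda>f. card (same f)" "Suc (card (N \<times> N))"] P0 bound by blast
  obtain z where z: "z \<in> J" "rsym f \<star> z \<noteq> 0" using f(1) unfolding P_def by blast
  have "rsym f' \<star> z = 0" if "card (same f) < card (same f')" "z \<in> J" for f' z
    using f(2)[of f'] that unfolding P_def by (meson not_le)
  then show ?thesis using that[OF z] by blast
qed

lemma same_reindex:
  assumes g: "g \<in> Sym" shows "card (same (f \<circ> g)) = card (same f)"
proof (rule bij_betw_same_card[of "\<lambda>(x, y). (g x, g y)"], rule bij_betwI[of _ _ _ "\<lambda>(x, y). (inv' g x, inv' g y)"])
  show "(\<lambda>(x, y). (g x, g y)) \<in> same (f \<circ> g) \<rightarrow> same f"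
    "(\<lambda>(x, y). (inv' g x, inv' g y)) \<in> same f \<rightarrow> same (f \<circ> g)"
    using g by (auto simp: same_def Sym_image[OF g] Sym_image[OF Sym_inv[OF g]]
      Sym_inj_iff[OF g] Sym_inj_iff[OF Sym_inv[OF g]])
qed (use g in auto)

text \<open>Entries sharing an \<open>h\<close>-block have different \<open>f\<close>-colours. Hence
  the entries that share the \<open>h\<close>-block of \<open>y\<close> and lie in higher
  \<open>f\<close>-blocks inject into the \<open>rank f y\<close> higher blocks. In the case of
  equality every one of these blocks is hit.\<close>

lemma card_same_le_rank:
  assumes inj: "inj_on (\<lambda>x. (f x, h x)) N"
  shows "card (same h) \<le> 2 * (\<Sum>y\<in>N. rank f y)"
    and "card (same h) = 2 * (\<Sum>y\<in>N. rank f y) \<Longrightarrow> y \<in> N \<Longrightarrow> i < rank f y \<Longrightarrow> \<exists>x\<in>N. rank f x = i \<and> h x = h y"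
proof -
  define X where "X y = {x \<in> N. h x = h y \<and> hi f (f x) (f y)}" for y
  have injX: "inj_on f (X y)" for y
    using inj by (auto simp: inj_on_def X_def)
  have subX: "f ` X y \<subseteq> {i \<in> f ` N. hi f i (f y)}" for y by (auto simp: X_def)
  have leX: "card (X y) \<le> rank f y" for y
    unfolding rank_def card_image[OF injX, symmetric] by (rule card_mono[OF _ subX]) simp
  define U where "U = Sigma N X"
  have "same h = (\<lambda>(y, x). (x, y)) ` U \<union> U"
  proof (intro equalityI subsetI)
    fix p assume p: "p \<in> same h"
    obtain x y where xy: "p = (x, y)" by (cases p)
    then have *: "x \<in> N" "y \<in> N" "x \<noteq> y" "h x = h y" using p by (auto simp: same_def)
    then have "f x \<noteq> f y" using inj_onD[OF inj, of x y] by auto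
    then have "hi f (f x) (f y) \<or> hi f (f y) (f x)" by (rule hi_total)
    then show "p \<in> (\<lambda>(y, x). (x, y)) ` U \<union> U"
      using * xy by (auto simp: U_def X_def intro!: image_eqI[where x = "(y, x)"])
  next
    fix p assume "p \<in> (\<lambda>(y, x). (x, y)) ` U \<union> U"
    then show "p \<in> same h" using hi_irrefl[of f] by (auto simp: U_def X_def same_def)
  qed
  moreover have "card ((\<lambda>(y, x). (x, y)) ` U \<union> U) = card ((\<lambda>(y, x). (x, y)) ` U) + card U"
    by (rule card_Un_disjoint) (auto simp: U_def X_def dest: hi_asym)
  moreover have "card ((\<lambda>(y, x). (x, y)) ` U) = card U"
    by (rule card_image) (auto simp: inj_on_def)
  moreover have "card U = (\<Sum>y\<in>N. card (X y))"
    unfolding U_def by (rule card_SigmaI) (auto simp: X_def)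
  ultimately have E: "card (same h) = 2 * (\<Sum>y\<in>N. card (X y))" by simp
  then show "card (same h) \<le> 2 * (\<Sum>y\<in>N. rank f y)"
    using sum_mono[of N "\<lambda>y. card (X y)" "rank f"] leX by simp
  assume eq: "card (same h) = 2 * (\<Sum>y\<in>N. rank f y)" and y: "y \<in> N" and i: "i < rank f y"
  have "card (X y) = rank f y"
    by (rule sum_mono_inv[of "\<lambda>y. card (X y)" N "rank f"]) (use eq E leX y in auto)
  then have "card (f ` X y) = card {i \<in> f ` N. hi f i (f y)}"
    using card_image[OF injX] by (simp add: rank_def)
  then have full: "f ` X y = {i \<in> f ` N. hi f i (f y)}"
    using subX by (intro card_subset_eq) auto
  obtain x' where x': "x' \<in> N" "rank f x' = i" using rank_below[OF y i] by blast
  then have "hi f (f x') (f y)" using rank_less[OF x'(1) y, of f] i by simp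
  then have "f x' \<in> f ` X y" using full x' by blast
  then obtain x where "x \<in> X y" "f x = f x'" by auto
  then have "x \<in> N" "h x = h y" "rank f x = i" using x' rank_eq[of x x' f] by (auto simp: X_def)
  then show "\<exists>x\<in>N. rank f x = i \<and> h x = h y" by blast
qed

text \<open>The two equalities say that below each occupied pair of ranks all smaller values of
  either coordinate are occupied as well. So the pairs of ranks form the diagram of a
  partition.\<close>

lemma nested_colourings_tab:
  assumes inj: "inj_on (\<lambda>x. (f x, h x)) N"
    and ef: "card (same h) = 2 * (\<Sum>y\<in>N. rank f y)" and eh: "card (same f) = 2 * (\<Sum>y\<in>N. rank h y)"
  obtains \<mu> where "\<mu> \<in> partitions_of n" "tab \<mu> (rank f) (rank h)"
proof -
  define D where "D = (\<lambda>x. (rank f x, rank h x)) ` N"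
  have inj': "inj_on (\<lambda>x. (h x, f x)) N" using inj by (auto simp: inj_on_def)
  have injr: "inj_on (\<lambda>x. (rank f x, rank h x)) N"
    using inj rank_eq[of _ _ f] rank_eq[of _ _ h] by (auto simp: inj_on_def)
  have 1: "(i', j) \<in> D" if D: "(i, j) \<in> D" and le: "i' \<le> i" for i j i'
  proof (cases "i' = i")
    case False
    obtain y where y: "y \<in> N" "rank f y = i" "rank h y = j" using D by (auto simp: D_def)
    obtain x where x: "x \<in> N" "rank f x = i'" "h x = h y"
      using card_same_le_rank(2)[OF inj ef y(1), of i'] False le y by auto
    then have "rank h x = j" using y rank_eq[of x y h] by simp
    then show ?thesis using x by (auto simp: D_def)
  qed (use D in simp)
  have 2: "(i, j') \<in> D" if D: "(i, j) \<in> D" and le: "j' \<le> j" for i j j'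
  proof (cases "j' = j")
    case False
    obtain y where y: "y \<in> N" "rank f y = i" "rank h y = j" using D by (auto simp: D_def)
    obtain x where x: "x \<in> N" "rank h x = j'" "f x = f y"
      using card_same_le_rank(2)[OF inj' eh y(1), of j'] False le y by auto
    then have "rank f x = i" using y rank_eq[of x y f] by simp
    then show ?thesis using x by (auto simp: D_def)
  qed (use D in simp)
  have down: "(i', j') \<in> D" if "(i, j) \<in> D" "i' \<le> i" "j' \<le> j" for i j i' j'
    using 1[OF 2[OF that(1,3)] that(2)] .
  let ?\<mu> = "\<lambda>i. card {j. (i, j) \<in> D}"
  have fin: "finite D" by (simp add: D_def)
  have mu: "?\<mu> \<in> partitions_of (card D)" "diagram ?\<mu> = D"
    by (rule partition_of_down_set[OF fin], rule down, assumption+)+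
  have "card D = n" unfolding D_def using card_image[OF injr] by (simp add: N_def)
  moreover have "tab ?\<mu> (rank f) (rank h)" unfolding tab_def bij_betw_def mu(2) using injr by (simp add: D_def)
  ultimately show ?thesis using mu(1) by (intro that[of ?\<mu>]) simp_all
qed

text \<open>A maximal colouring \<open>f\<close> for \<open>J\<close> and one for the twisted ideal
  are linked by a permutation through a nonzero product of symmetrizers, so after moving the second
  to \<open>k\<close> they separate the entries. The scalars of \<open>omega\<close> on the two
  ideals are negatives of each other, which forces equality in both bounds of
  \<open>card_same_le_rank\<close>. Then \<open>f\<close> and \<open>k\<close> are, up to renaming
  colours, rows and columns of a tableau whose symmetrizer lies in \<open>J\<close>.\<close>

lemma simple_ideal_is_I_comp:
  assumes J: "minimal_among (tsid Sym) J"
  shows "\<exists>\<mu>\<in>partitions_of n. J = I_comp n \<mu>"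
proof -
  have t: "tsid Sym J" using J by (simp add: minimal_among_def)
  have Jt: "minimal_among (tsid Sym) (twist ` J)" by (rule minimal_twist[OF J])
  have tt: "tsid Sym (twist ` J)" using Jt by (simp add: minimal_among_def)
  obtain f z where f: "z \<in> J" "rsym f \<star> z \<noteq> 0"
    "\<And>f' z. card (same f) < card (same f') \<Longrightarrow> z \<in> J \<Longrightarrow> rsym f' \<star> z = 0"
    using exists_maximal_colouring[OF J] by metis
  obtain h z' where h: "z' \<in> twist ` J" "rsym h \<star> z' \<noteq> 0"
    "\<And>f' z. card (same h) < card (same f') \<Longrightarrow> z \<in> twist ` J \<Longrightarrow> rsym f' \<star> z = 0"
    using exists_maximal_colouring[OF Jt] by metis
  obtain w where w: "w \<in> J" "z' = twist w" using h(1) by blast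
  \<comment> \<open>Untwisting turns a symmetrizer acting on the twisted ideal into an
    antisymmetrizer acting on \<open>J\<close>.\<close>
  have bw: "csym h \<star> w \<noteq> 0"
  proof
    assume "csym h \<star> w = 0"
    then have "twist (csym h \<star> w) = 0" by simp
    then show False using h(2) by (simp add: twist_star csym_def w)
  qed
  obtain e where e: "e \<in> J" "\<And>x. x \<in> J \<Longrightarrow> e \<star> x = x" "\<And>a. a \<in> supp Sym \<Longrightarrow> a \<star> e = e \<star> a"
    using tsid_identity[OF subgrp_Sym t] by metis
  have "e \<star> csym h \<noteq> 0"
  proof
    assume "e \<star> csym h = 0"
    then have "csym h \<star> e \<star> w = 0" using e(3)[of "csym h"] by simp
    then show False using e(2)[OF w(1)] bw by (simp add: star_assoc)
  qed
  then obtain z0 where z0: "z0 \<in> J" "rsym f \<star> z0 \<star> csym h \<noteq> 0"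
    using minimal_tsid_prime[OF J f(1,2) e(1), of "csym h"] by auto
  have "rsym f \<star> z0 \<star> csym h = (\<Sum>g\<in>Sym. z0 g \<odot> (rsym f \<star> delta g \<star> csym h))"
    by (subst supp_expand[OF tsid_supp[OF t z0(1)] finite_Sym]) (simp only: star_sum_right star_sum_left star_scale_right star_scale_left)
  then obtain g where g: "g \<in> Sym" "rsym f \<star> delta g \<star> csym h \<noteq> 0"
    using z0(2) by (metis (no_types, lifting) FV.scale_zero_right sum.neutral)
  \<comment> \<open>Moving the permutation into the colouring removes it from the product and turns
    nonvanishing into joint injectivity of \<open>f\<close> and \<open>k\<close>.\<close>
  define k where "k = h \<circ> inv' g"
  have inj: "inj_on (\<lambda>x. (f x, k x)) N"
    using rsym_delta_csym_zero[OF g(1), of _ _ f h] g(2) unfolding inj_on_def k_def by auto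
  have kc: "rsym k = delta g \<star> rsym h \<star> delta (inv' g)" "csym k = delta g \<star> csym h \<star> delta (inv' g)"
    using rsym_conj[OF Sym_inv[OF g(1)], of h] csym_conj[OF Sym_inv[OF g(1)], of h] g(1) by (simp_all add: k_def)
  have sk: "card (same k) = card (same h)"
    unfolding k_def by (rule same_reindex[OF Sym_inv[OF g(1)]])
  let ?z1 = "delta g \<star> z'"
  have z1: "?z1 \<in> twist ` J" by (rule tsid_lmult[OF tt h(1) delta_supp[OF g(1)]])
  have cancel: "delta (inv' g) \<star> (delta g \<star> z') = z'"
    using g(1) tsid_supp[OF tt h(1)] by (simp add: star_assoc[symmetric] delta_star_delta)
  have "rsym k \<star> ?z1 \<noteq> 0"
  proof
    assume "rsym k \<star> ?z1 = 0"
    then have "delta g \<star> (rsym h \<star> z') = 0" by (simp add: kc star_assoc cancel)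
    then have "delta (inv' g) \<star> delta g \<star> (rsym h \<star> z') = 0" by (simp add: star_assoc)
    then show False using h(2) g(1) by (simp add: delta_star_delta)
  qed
  note nzk = this
  define cf where "cf = int (card (same f)) - 2 * int (\<Sum>y\<in>N. rank f y)"
  define ck where "ck = int (card (same k)) - 2 * int (\<Sum>y\<in>N. rank k y)"
  have of: "omega \<star> x = of_int cf \<odot> x" if "x \<in> J" for x
    using omega_eigen[OF t f(1) f(3)] omega_eigen_ideal[OF J tsid_lmult[OF t f(1) rsym_supp] f(2) _ that]
    unfolding cf_def by blast
  have ok: "omega \<star> x = of_int ck \<odot> x" if "x \<in> twist ` J" for x
    using omega_eigen[OF tt z1 h(3)[folded sk]] omega_eigen_ideal[OF Jt tsid_lmult[OF tt z1 rsym_supp] nzk _ that]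
    unfolding ck_def by blast
  \<comment> \<open>Twisting changes the sign of \<open>omega\<close>, since transpositions are
    odd.\<close>
  have "cf = - ck"
  proof -
    have fz: "rsym f \<star> z \<in> J" by (rule tsid_lmult[OF t f(1) rsym_supp])
    have "omega \<star> twist (rsym f \<star> z) = of_int ck \<odot> twist (rsym f \<star> z)"
      using fz by (intro ok) blast
    then have "twist (omega \<star> twist (rsym f \<star> z)) = of_int ck \<odot> (rsym f \<star> z)"
      by (simp add: twist_scale)
    then have "- (omega \<star> (rsym f \<star> z)) = of_int ck \<odot> (rsym f \<star> z)"
      by (simp only: twist_star[of omega] twist_omega twist_twist star_minus_left)
    then have "of_int (- cf) \<odot> (rsym f \<star> z) = of_int ck \<odot> (rsym f \<star> z)"
      using of[OF fz] by simp
    then have "of_int (- cf) = (of_int ck :: complex)"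
      using f(2) FV.scale_cancel_right by blast
    then show ?thesis by (simp only: of_int_eq_iff)
  qed
  moreover have "card (same k) \<le> 2 * (\<Sum>y\<in>N. rank f y)" by (rule card_same_le_rank(1)[OF inj])
  moreover have "card (same f) \<le> 2 * (\<Sum>y\<in>N. rank k y)"
    by (rule card_same_le_rank(1)) (use inj in \<open>auto simp: inj_on_def\<close>)
  \<comment> \<open>The identity says that the two left sides and the two right sides have equal
    sums, so neither inequality can be strict.\<close>
  ultimately have eqs: "card (same k) = 2 * (\<Sum>y\<in>N. rank f y)" "card (same f) = 2 * (\<Sum>y\<in>N. rank k y)"
    unfolding cf_def ck_def by linarith+
  obtain \<mu> where mu: "\<mu> \<in> partitions_of n" "tab \<mu> (rank f) (rank k)"
    using nested_colourings_tab[OF inj eqs] by metis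
  have rf: "rsym f = rsym (rank f)" by (rule rsym_cong) (simp add: rank_eq)
  have ck: "csym k = csym (rank k)" by (rule rsym_cong) (simp add: rank_eq)
  let ?c = "rsym (rank f) \<star> csym (rank k)"
  \<comment> \<open>Compensates for the conjugation hidden in \<open>csym k\<close>: up to a final
    \<open>delta (inv' g)\<close>, the product \<open>rsym f \<star> ?z2 \<star> csym k\<close> is
    the nonzero product with \<open>csym h\<close>.\<close>
  let ?z2 = "z0 \<star> delta (inv' g)"
  have z2: "?z2 \<in> J" by (rule tsid_rmult[OF t z0(1)]) (simp add: delta_supp g(1))
  obtain s where s: "rsym f \<star> ?z2 \<star> csym k = s \<odot> ?c"
    using rsym_star_csym_scalar[OF mu(2) tsid_supp[OF t z2]] unfolding rf ck by blast
  have "s \<noteq> 0"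
  proof
    assume "s = 0"
    then have "rsym f \<star> ?z2 \<star> csym k \<star> delta g = 0" using s by simp
    moreover have "rsym f \<star> ?z2 \<star> csym k \<star> delta g = rsym f \<star> z0 \<star> (delta (inv' g) \<star> delta g) \<star> csym h \<star> (delta (inv' g) \<star> delta g)"
      by (simp only: kc star_assoc)
    moreover have "\<dots> = rsym f \<star> z0 \<star> csym h"
      using g(1) by (simp add: delta_star_delta)
    ultimately show False using z0(2) by simp
  qed
  have "rsym f \<star> ?z2 \<star> csym k \<in> J"
    by (rule tsid_lrmult[OF t z2]) simp_all
  then have "(1 / s) \<odot> (s \<odot> ?c) \<in> J"
    unfolding s by (rule FV.subspace_scale[OF tsid_subspace(1)[OF subgrp_Sym t]])
  then have cJ: "?c \<in> J" using \<open>s \<noteq> 0\<close> by simp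
  have "J = gen ?c"
    by (rule minimal_tsid_meet[OF J gen_tab_simple[OF mu(2)] cJ gen_base rsym_star_csym_nonzero[OF mu(2)]]) simp
  then show ?thesis using I_comp_eq[OF mu] mu(1) by blast
qed


subsection \<open>Central idempotents and the alternating group\<close>

abbreviation Par :: "(nat \<Rightarrow> nat) set" where
  "Par \<equiv> partitions_of n"

text \<open>A cell (i, j) brings along i + 1 cells of its column and j + 1 cells of its row, so
  diagrams lie in a square of side \<open>n\<close>.\<close>

lemma finite_Par [simp]: "finite Par"
proof (rule inj_on_finite[of diagram _ "Pow ({..<n} \<times> {..<n})"])
  show "inj_on diagram Par" by (auto intro: inj_onI diagram_eq_imp_eq)
  show "diagram ` Par \<subseteq> Pow ({..<n} \<times> {..<n})"
  proof (clarsimp)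
    fix \<mu> i j assume mu: "\<mu> \<in> Par" and ij: "(i, j) \<in> diagram \<mu>"
    have anti: "antimono \<mu>" using mu by (simp add: partitions_of_def)
    have "(\<lambda>i'. (i', j)) ` {..i} \<subseteq> diagram \<mu>" "(\<lambda>j'. (i, j')) ` {..j} \<subseteq> diagram \<mu>"
      using diagram_down[OF anti ij] by auto
    then have "card ((\<lambda>i'. (i', j)) ` {..i}) \<le> n" "card ((\<lambda>j'. (i, j')) ` {..j}) \<le> n"
      using card_mono[OF diagram_partition(1)[OF mu]] diagram_partition(2)[OF mu] by auto
    then show "i < n \<and> j < n" by (simp add: card_image inj_on_def)
  qed
qed simp

definition eid :: "(nat \<Rightarrow> nat) \<Rightarrow> (nat \<Rightarrow> nat) \<Rightarrow> complex" where
  "eid \<mu> = (SOME e. e \<in> I_comp n \<mu> \<and> (\<forall>x\<in>I_comp n \<mu>. e \<star> x = x \<and> x \<star> e = x))"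

lemma I_comp_tsid: "\<mu> \<in> Par \<Longrightarrow> tsid Sym (I_comp n \<mu>)"
  using I_comp_minimal by (simp add: minimal_among_def)

lemma eid:
  assumes "\<mu> \<in> Par"
  shows "eid \<mu> \<in> I_comp n \<mu>" "x \<in> I_comp n \<mu> \<Longrightarrow> eid \<mu> \<star> x = x" "x \<in> I_comp n \<mu> \<Longrightarrow> x \<star> eid \<mu> = x"
proof -
  have "\<exists>e. e \<in> I_comp n \<mu> \<and> (\<forall>x\<in>I_comp n \<mu>. e \<star> x = x \<and> x \<star> e = x)"
    by (rule tsid_identity[OF subgrp_Sym I_comp_tsid[OF assms]]) auto
  then have "eid \<mu> \<in> I_comp n \<mu> \<and> (\<forall>x\<in>I_comp n \<mu>. eid \<mu> \<star> x = x \<and> x \<star> eid \<mu> = x)"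
    unfolding eid_def by (rule someI_ex)
  then show "eid \<mu> \<in> I_comp n \<mu>" "x \<in> I_comp n \<mu> \<Longrightarrow> eid \<mu> \<star> x = x" "x \<in> I_comp n \<mu> \<Longrightarrow> x \<star> eid \<mu> = x"
    by simp_all
qed

lemma eid_supp: "\<mu> \<in> Par \<Longrightarrow> eid \<mu> \<in> supp Sym"
  using tsid_supp[OF I_comp_tsid eid(1)] by simp

lemma eid_central:
  assumes "\<mu> \<in> Par" "x \<in> supp Sym"
  shows "eid \<mu> \<star> x = x \<star> eid \<mu>"
proof -
  have "eid \<mu> \<star> x \<in> I_comp n \<mu>" "x \<star> eid \<mu> \<in> I_comp n \<mu>"
    using tsid_lmult[OF I_comp_tsid eid(1)] tsid_rmult[OF I_comp_tsid eid(1)] assms by blast+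
  then have "eid \<mu> \<star> x = eid \<mu> \<star> x \<star> eid \<mu>" "x \<star> eid \<mu> = eid \<mu> \<star> (x \<star> eid \<mu>)"
    using eid(2,3)[OF assms(1)] by simp_all
  then show ?thesis by (simp add: star_assoc)
qed

lemma eid_nonzero: "\<mu> \<in> Par \<Longrightarrow> eid \<mu> \<noteq> 0"
proof
  assume mu: "\<mu> \<in> Par" and 0: "eid \<mu> = 0"
  then have "x = 0" if "x \<in> I_comp n \<mu>" for x using eid(2)[OF mu that] by simp
  moreover have "0 \<in> I_comp n \<mu>" using tsid_zero[OF I_comp_tsid[OF mu]] .
  ultimately show False using I_comp_minimal[OF mu] by (auto simp: minimal_among_def)
qed

lemma eid_mult:
  assumes "\<mu> \<in> Par" "\<nu> \<in> Par"
  shows "eid \<mu> \<star> eid \<nu> = (if \<mu> = \<nu> then eid \<mu> else 0)"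
proof (cases "\<mu> = \<nu>")
  case False
  have m: "eid \<mu> \<star> eid \<nu> \<in> I_comp n \<mu>" "eid \<mu> \<star> eid \<nu> \<in> I_comp n \<nu>"
    using tsid_lmult[OF I_comp_tsid eid(1) eid_supp, OF assms(2,2,1)]
      tsid_rmult[OF I_comp_tsid eid(1) eid_supp, OF assms(1,1,2)] by simp_all
  have "I_comp n \<mu> \<noteq> I_comp n \<nu>" using I_comp_inj[OF assms] False by blast
  then have "eid \<mu> \<star> eid \<nu> = 0"
    using minimal_tsid_meet[OF I_comp_minimal[OF assms(1)] I_comp_minimal[OF assms(2)] m] by blast
  then show ?thesis using False by simp
qed (use eid[OF assms(1)] in simp)

definition esum :: "(nat \<Rightarrow> nat) set \<Rightarrow> (nat \<Rightarrow> nat) \<Rightarrow> complex" where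
  "esum X = (\<Sum>\<mu>\<in>X. eid \<mu>)"

lemma esum_supp: "X \<subseteq> Par \<Longrightarrow> esum X \<in> supp Sym"
  unfolding esum_def using eid_supp by (intro supp_sum) auto

lemma esum_central: "X \<subseteq> Par \<Longrightarrow> x \<in> supp Sym \<Longrightarrow> esum X \<star> x = x \<star> esum X"
  unfolding esum_def star_sum_left star_sum_right using eid_central by (intro sum.cong) auto

lemma esum_eid:
  assumes "X \<subseteq> Par" "\<mu> \<in> Par"
  shows "esum X \<star> eid \<mu> = (if \<mu> \<in> X then eid \<mu> else 0)"
proof -
  have "esum X \<star> eid \<mu> = (\<Sum>\<nu>\<in>X. if \<mu> = \<nu> then eid \<mu> else 0)"
    unfolding esum_def star_sum_left using assms by (intro sum.cong) (auto simp: eid_mult)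
  also have "\<dots> = (if \<mu> \<in> X then eid \<mu> else 0)"
    by (rule sum.delta'[OF finite_subset[OF assms(1) finite_Par]])
  finally show ?thesis .
qed

lemma esum_mult:
  assumes "X \<subseteq> Par" "Y \<subseteq> Par"
  shows "esum X \<star> esum Y = esum (X \<inter> Y)"
proof -
  have "esum X \<star> esum Y = (\<Sum>\<mu>\<in>Y. if \<mu> \<in> X then eid \<mu> else 0)"
    unfolding esum_def[of Y] star_sum_right using esum_eid[OF assms(1)] assms(2) by (intro sum.cong) auto
  also have "\<dots> = esum (X \<inter> Y)"
    unfolding esum_def using finite_subset[OF assms(2) finite_Par]
    by (subst sum.inter_restrict[symmetric]) (auto simp: Int_commute)
  finally show ?thesis .
qed

lemma esum_I_comp:
  assumes "X \<subseteq> Par" "\<mu> \<in> X" "x \<in> I_comp n \<mu>"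
  shows "esum X \<star> x = x"
proof -
  have mu: "\<mu> \<in> Par" using assms by blast
  have "esum X \<star> x = esum X \<star> eid \<mu> \<star> x" using eid(2)[OF mu assms(3)] by (simp add: star_assoc)
  then show ?thesis using esum_eid[OF assms(1) mu] assms(2) eid(2)[OF mu assms(3)] by simp
qed

lemma esum_Un:
  assumes "X \<subseteq> Par" "Y \<subseteq> Par" "X \<inter> Y = {}"
  shows "esum (X \<union> Y) = esum X + esum Y"
  unfolding esum_def using assms finite_subset[OF _ finite_Par] by (intro sum.union_disjoint) auto

lemma tsid_annihilator:
  assumes t: "tsid H M" and e: "\<And>a. a \<in> supp H \<Longrightarrow> e \<star> a = a \<star> e"
  shows "tsid H {x \<in> M. e \<star> x = 0}"
proof -
  have "e \<star> (a \<star> x) = 0" if "a \<in> supp H" "e \<star> x = 0" for a x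
  proof -
    have "e \<star> (a \<star> x) = a \<star> (e \<star> x)" using e[OF that(1)] by (simp add: star_assoc[symmetric])
    then show ?thesis using that(2) by simp
  qed
  moreover have "e \<star> (x \<star> a) = 0" if "e \<star> x = 0" for a x
    using that by (simp add: star_assoc[symmetric])
  ultimately show ?thesis
    using t unfolding tsid_def lsub_def by (auto simp: star_add_right)
qed

text \<open>The annihilator of \<open>esum Par\<close> is an ideal. If it were nonzero it would
  contain a minimal ideal, which belongs to some partition and whose identity is not annihilated.
  Since \<open>esum Par\<close> is idempotent, its difference from 1 lies in the
  annihilator.\<close>

lemma esum_Par: "esum Par = delta id"
proof -
  have E: "esum Par \<in> supp Sym" by (rule esum_supp) simp
  let ?K = "{x \<in> supp Sym. esum Par \<star> x = 0}"
  have all: "tsid Sym (supp Sym)"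
    by (auto simp: tsid_def lsub_def supp_add)
  have tK: "tsid Sym ?K" by (rule tsid_annihilator[OF all]) (rule esum_central, auto)
  have "?K = {0}"
  proof (rule ccontr)
    assume ne: "?K \<noteq> {0}"
    have "\<And>U. tsid Sym U \<Longrightarrow> FV.subspace U \<and> U \<subseteq> supp Sym"
      using tsid_subspace[OF subgrp_Sym] by blast
    with tK ne obtain J where J: "minimal_among (tsid Sym) J" "J \<subseteq> ?K"
      by (rule exists_minimal)
    obtain \<mu> where mu: "\<mu> \<in> Par" "J = I_comp n \<mu>" using simple_ideal_is_I_comp[OF J(1)] by blast
    then have "esum Par \<star> eid \<mu> = 0" using J(2) eid(1)[OF mu(1)] by blast
    then show False using esum_eid[of Par \<mu>] mu(1) eid_nonzero by simp
  qed
  moreover have "delta id - esum Par \<in> ?K"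
    using E esum_mult[of Par Par] by (simp add: supp_diff delta_supp star_diff_right)
  ultimately have "delta id - esum Par = 0" by blast
  then show ?thesis by (simp only: right_minus_eq)
qed

text \<open>With row and column functions exchanged, the element \<open>?z\<close> lies in the
  component of the conjugate, and it is also the twist of an element of
  \<open>I_comp n \<mu>\<close>. Two minimal ideals with a common nonzero element are equal.\<close>

lemma twist_I_comp:
  assumes mu: "\<mu> \<in> Par"
  shows "twist ` I_comp n \<mu> = I_comp n (conjugate \<mu>)"
proof -
  let ?f = "row_of \<mu>" and ?h = "col_of \<mu>"
  note t = tab_canonical[OF mu]
  have mu': "conjugate \<mu> \<in> Par" by (rule conjugate_partition[OF mu])
  have t': "tab (conjugate \<mu>) ?h ?f"
  proof -
    have "bij_betw prod.swap (diagram \<mu>) (diagram (conjugate \<mu>))"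
      unfolding conjugate_partition(2)[OF mu] by (rule bij_betw_imageI) simp_all
    from bij_betw_trans[OF t[unfolded tab_def] this] show ?thesis by (simp add: tab_def comp_def)
  qed
  obtain s where s: "s \<noteq> 0" "rsym ?h \<star> csym ?f \<star> (rsym ?h \<star> csym ?f) = s \<odot> (rsym ?h \<star> csym ?f)"
    using rsym_csym_rsym_csym[OF t'] by metis
  let ?z = "csym ?f \<star> (rsym ?h \<star> csym ?f)"
  have "rsym ?h \<star> ?z \<noteq> 0" using s rsym_star_csym_nonzero[OF t'] by (simp add: star_assoc)
  then have nz: "?z \<noteq> 0" by auto
  have "?z \<in> I_comp n (conjugate \<mu>)"
    unfolding I_comp_eq[OF mu' t'] by (rule tsid_lmult[OF tsid_gen gen_base]) simp_all
  moreover have "?z \<in> twist ` I_comp n \<mu>"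
  proof -
    have "rsym ?f \<star> csym ?h \<star> rsym ?f \<in> I_comp n \<mu>"
      unfolding I_comp_eq[OF mu t] by (rule tsid_rmult[OF tsid_gen gen_base]) simp_all
    moreover have "?z = twist (rsym ?f \<star> csym ?h \<star> rsym ?f)"
      by (simp add: twist_star csym_def star_assoc)
    ultimately show ?thesis by blast
  qed
  ultimately show ?thesis
    using minimal_tsid_meet[OF minimal_twist[OF I_comp_minimal[OF mu]] I_comp_minimal[OF mu']] nz by blast
qed

lemma twist_eid:
  assumes mu: "\<mu> \<in> Par" shows "twist (eid \<mu>) = eid (conjugate \<mu>)"
proof -
  have mu': "conjugate \<mu> \<in> Par" by (rule conjugate_partition[OF mu])
  have "twist (eid \<mu>) \<in> I_comp n (conjugate \<mu>)"
    using twist_I_comp[OF mu] eid(1)[OF mu] by blast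
  then have "eid (conjugate \<mu>) \<star> twist (eid \<mu>) = twist (eid \<mu>)" using eid(2)[OF mu'] by simp
  moreover obtain y where y: "y \<in> I_comp n \<mu>" "eid (conjugate \<mu>) = twist y"
    using twist_I_comp[OF mu] eid(1)[OF mu'] by blast
  then have "eid (conjugate \<mu>) \<star> twist (eid \<mu>) = eid (conjugate \<mu>)"
    using eid(3)[OF mu y(1)] by (simp add: twist_star[symmetric])
  ultimately show ?thesis by simp
qed

lemma conjugate_inj: "inj_on conjugate Par"
  by (rule inj_on_inverseI[of _ conjugate]) (rule conjugate_conjugate)

lemma twist_esum:
  assumes "X \<subseteq> Par" shows "twist (esum X) = esum (conjugate ` X)"
proof -
  have "esum (conjugate ` X) = (\<Sum>\<mu>\<in>X. eid (conjugate \<mu>))"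
    unfolding esum_def using inj_on_subset[OF conjugate_inj assms] by (simp add: sum.reindex)
  also have "\<dots> = (\<Sum>\<mu>\<in>X. twist (eid \<mu>))"
    using assms twist_eid by (intro sum.cong) auto
  finally show ?thesis by (simp only: esum_def twist_sum)
qed

section \<open>Even central idempotents and components over the alternating group\<close>

definition conj_closure :: "(nat \<Rightarrow> nat) set \<Rightarrow> (nat \<Rightarrow> nat) set" where
  "conj_closure X = X \<union> conjugate ` X"

lemma conj_closure_subset: "X \<subseteq> Par \<Longrightarrow> conj_closure X \<subseteq> Par"
  using conjugate_partition(1) by (auto simp: conj_closure_def)

lemma esum_conj_closure_Alt:
  assumes "X \<subseteq> Par" shows "esum (conj_closure X) \<in> supp Alt"
proof -
  have "conjugate ` conjugate ` X = id ` X"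
    unfolding image_image using assms conjugate_conjugate[of _ n] by (intro image_cong) auto
  then have "conjugate ` conj_closure X = conj_closure X"
    unfolding conj_closure_def image_Un by (simp add: Un_commute)
  then show ?thesis
    using twist_esum[OF conj_closure_subset[OF assms]] esum_supp[OF conj_closure_subset[OF assms]]
    by (simp add: supp_Alt_iff)
qed

text \<open>Schur's argument: kernel and preimages of submodules are submodules. The map may be
  assumed additive and equivariant everywhere because it will be a right multiplication.\<close>

lemma image_minimal_submodule:
  assumes L: "minimal_among (lsub H) L" and add: "\<And>u v. F (u + v) = F u + F v"
    and eqv: "\<And>a u. F (a \<star> u) = a \<star> F u" and supp: "\<And>u. F u \<in> supp Sym"
    and nz: "x \<in> L" "F x \<noteq> 0" and z: "F 0 = 0" and H: "subgrp H"
  shows "minimal_among (lsub H) (F ` L)" "inj_on F L"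
proof -
  have l: "lsub H L" using L by (simp add: minimal_among_def)
  have pre: "lsub H {u \<in> L. F u \<in> V}" if "lsub H V" for V
    using l that by (auto simp: lsub_def add eqv z)
  have l0: "lsub H {0}" by (simp add: lsub_def)
  have "{u \<in> L. F u \<in> {0}} = {0} \<or> {u \<in> L. F u \<in> {0}} = L"
    using L pre[OF l0] unfolding minimal_among_def by blast
  then have ker: "u = 0" if "u \<in> L" "F u = 0" for u using that nz by blast
  show "inj_on F L"
  proof (rule inj_onI)
    fix u v assume uv: "u \<in> L" "v \<in> L" "F u = F v"
    have s: "FV.subspace L" by (rule lsub_subspace[OF H l])
    have "F (u - v) + F v = F v" using add[of "u - v" v] uv(3) by simp
    then have "F (u - v) = 0" by (simp only: add_cancel_left_left)
    then have "u - v = 0" using ker FV.subspace_diff[OF s uv(1,2)] by blast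
    then show "u = v" by simp
  qed
  have im: "lsub H (F ` L)"
    unfolding lsub_def
  proof (intro conjI ballI)
    show "0 \<in> F ` L" using l z by (force simp: lsub_def)
  next
    fix u v assume "u \<in> F ` L" "v \<in> F ` L"
    then show "u + v \<in> F ` L" using l by (auto simp: lsub_def add[symmetric])
  next
    fix a u assume "a \<in> supp H" "u \<in> F ` L"
    then show "a \<star> u \<in> F ` L" using l by (auto simp: lsub_def eqv[symmetric])
  qed (use supp in auto)
  have "V = {0} \<or> V = F ` L" if V: "lsub H V" "V \<subseteq> F ` L" for V
  proof -
    have "{u \<in> L. F u \<in> V} = {0} \<or> {u \<in> L. F u \<in> V} = L"
      using L pre[OF V(1)] unfolding minimal_among_def by blast
    moreover have "V = F ` {u \<in> L. F u \<in> V}" using V(2) by blast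
    ultimately show ?thesis using z by auto
  qed
  moreover have "F ` L \<noteq> {0}" using nz by blast
  ultimately show "minimal_among (lsub H) (F ` L)" using im by (simp add: minimal_among_def)
qed

lemma specht_eq:
  "\<mu> \<in> Par \<Longrightarrow> specht n \<mu> = {x \<star> (rsym (row_of \<mu>) \<star> csym (col_of \<mu>)) |x. x \<in> supp Sym}"
  by (simp add: specht_def young_symmetrizer_eq CS_simps)

lemma specht_subset_I_comp: "\<mu> \<in> Par \<Longrightarrow> specht n \<mu> \<subseteq> I_comp n \<mu>"
  unfolding specht_eq I_comp_eq[OF _ tab_canonical] using tsid_lmult[OF tsid_gen gen_base] by auto

definition J_family :: "(nat \<Rightarrow> nat) set \<Rightarrow> ((nat \<Rightarrow> nat) \<Rightarrow> complex) set set" where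
  "J_family X = {J. simple_ideal J (CA n) \<and>
         (\<exists>\<mu>\<in>X. \<exists>L U. irreducible_module_of J (CA n) L \<and>
            U \<subseteq> specht n \<mu> \<and> irreducible_submodule (CS n) (carrier (CA n)) U \<and>
            isomorphic_submodules (CS n) (carrier (CA n)) L U)}"

lemma J_bar_family: "J_bar n X = FV.span (\<Union>(J_family X))"
  by (simp add: J_bar_def sum_of_subspaces_def J_family_def)

text \<open>The even central idempotent acts as 1 on the Specht module, hence on the submodule
  \<open>U\<close>, and the isomorphism carries this over to \<open>L\<close> inside
  \<open>J\<close>. The elements of \<open>J\<close> on which it acts as 1 form an ideal of the even
  algebra, so minimality gives all of \<open>J\<close>.\<close>

lemma J_family_subset:
  assumes X: "X \<subseteq> Par" and J: "J \<in> J_family X"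
  shows "J \<subseteq> {x \<in> supp Alt. esum (conj_closure X) \<star> x = x}"
proof -
  let ?E = "esum (conj_closure X)"
  have E: "?E \<in> supp Alt" by (rule esum_conj_closure_Alt[OF X])
  have mJ: "minimal_among (tsid Alt) J" using J by (auto simp: J_family_def simple_ideal_CA_iff)
  obtain \<mu> L U where mu: "\<mu> \<in> X" and L: "irreducible_module_of J (CA n) L" and U: "U \<subseteq> specht n \<mu>"
    and iso: "isomorphic_submodules (CS n) (supp Alt) L U"
    using J unfolding J_family_def by (auto simp: CS_simps)
  have LJ: "L \<subseteq> J" and mL: "minimal_among (lsub Alt) L"
    using L by (auto simp: irreducible_module_of_def irreducible_submodule_CA_iff CS_simps)
  obtain F where F: "bij_betw F L U" "\<And>a u. a \<in> supp Alt \<Longrightarrow> u \<in> L \<Longrightarrow> F (a \<star> u) = a \<star> F u"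
    using iso by (auto simp: isomorphic_submodules_def CS_simps)
  have lL: "lsub Alt L" and "L \<noteq> {0}" using mL by (auto simp: minimal_among_def)
  then obtain x where x: "x \<in> L" "x \<noteq> 0" by (auto simp: lsub_def)
  have Ex: "?E \<star> x \<in> L" using lL x(1) E by (simp add: lsub_def)
  have "F x \<in> I_comp n \<mu>"
    using F(1) x(1) U specht_subset_I_comp[of \<mu>] mu X by (auto simp: bij_betw_def)
  then have "?E \<star> F x = F x"
    using mu by (intro esum_I_comp[OF conj_closure_subset[OF X], of \<mu>]) (auto simp: conj_closure_def)
  then have "F (?E \<star> x) = F x" using F(2)[OF E x(1)] by simp
  then have "?E \<star> x = x" using F(1) Ex x(1) by (auto simp: bij_betw_def inj_on_def)
  \<comment> \<open>Phrasing invariance as annihilation by \<open>delta id - ?E\<close> makes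
    \<open>K\<close> an annihilator ideal.\<close>
  define K where "K = {y \<in> J. (delta id - ?E) \<star> y = 0}"
  have tJ: "tsid Alt J" using mJ by (simp add: minimal_among_def)
  have sA: "y \<in> supp Sym" if "y \<in> supp Alt" for y using that supp_Alt_Sym by blast
  have "tsid Alt K"
    unfolding K_def
  proof (rule tsid_annihilator[OF tJ])
    fix a assume "a \<in> supp Alt"
    then show "(delta id - ?E) \<star> a = a \<star> (delta id - ?E)"
      using esum_central[OF conj_closure_subset[OF X]] sA by (simp add: star_diff_left star_diff_right)
  qed
  moreover have "x \<in> K"
    using x LJ \<open>?E \<star> x = x\<close> tsid_supp[OF tJ] sA by (auto simp: K_def star_diff_left)
  ultimately have "K = J" using mJ x(2) unfolding minimal_among_def K_def by blast
  have "?E \<star> y = y \<and> y \<in> supp Alt" if y: "y \<in> J" for y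
  proof -
    have "(delta id - ?E) \<star> y = 0" using y \<open>K = J\<close> by (auto simp: K_def)
    moreover have yA: "y \<in> supp Alt" using tsid_supp[OF tJ y] .
    ultimately have "y - ?E \<star> y = 0" using sA by (simp add: star_diff_left)
    then show ?thesis using yA by simp
  qed
  then show ?thesis by blast
qed

text \<open>Some idempotent \<open>eid \<mu>\<close> with \<open>\<mu>\<close> in \<open>X\<close>
  does not kill \<open>J\<close>, and by minimality it kills no nonzero element of \<open>J\<close>.
  Primeness of \<open>I_comp n \<mu>\<close> then provides a right multiplication into the Specht
  module that is nonzero on a minimal left submodule \<open>L\<close>, hence injective
  there.\<close>

lemma simple_in_J_family:
  assumes X: "X \<subseteq> Par" and J: "minimal_among (tsid Alt) J"
    and sub: "J \<subseteq> {x \<in> supp Alt. esum (conj_closure X) \<star> x = x}"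
  shows "J \<in> J_family X"
proof -
  have tJ: "tsid Alt J" and "J \<noteq> {0}" using J by (auto simp: minimal_among_def)
  then obtain y where y: "y \<in> J" "y \<noteq> 0" using tsid_zero by blast
  have ytw: "twist y = y" using y(1) sub by (auto simp: supp_Alt_iff)
  have sA: "y \<in> supp Sym" if "y \<in> supp Alt" for y using that supp_Alt_Sym by blast
  have "\<exists>\<mu>\<in>conj_closure X. eid \<mu> \<star> y \<noteq> 0"
  proof (rule ccontr)
    assume "\<not> ?thesis"
    then have "esum (conj_closure X) \<star> y = 0"
      unfolding esum_def star_sum_left by (intro sum.neutral) blast
    then show False using y sub by auto
  qed
  then obtain \<nu> where nu: "\<nu> \<in> conj_closure X" "eid \<nu> \<star> y \<noteq> 0" by blast
  have "\<exists>\<mu>\<in>X. eid \<mu> \<star> y \<noteq> 0"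
  proof (cases "\<nu> \<in> X")
    case False
    then obtain \<mu> where mu: "\<mu> \<in> X" "\<nu> = conjugate \<mu>" using nu(1) by (auto simp: conj_closure_def)
    \<comment> \<open>Even elements are fixed by the twist, so their components at conjugate
      partitions vanish together; the partition can be moved from the closure into
      \<open>X\<close>.\<close>
    have "twist (eid \<mu> \<star> y) = eid \<nu> \<star> y"
      using mu X ytw by (simp add: twist_star twist_eid subset_iff)
    then have "eid \<mu> \<star> y \<noteq> 0" using nu(2) by auto
    then show ?thesis using mu(1) by blast
  qed (use nu in blast)
  then obtain \<mu> where mu: "\<mu> \<in> X" "eid \<mu> \<star> y \<noteq> 0" by blast
  then have muP: "\<mu> \<in> Par" using X by blast
  let ?I = "I_comp n \<mu>" and ?c = "rsym (row_of \<mu>) \<star> csym (col_of \<mu>)"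
  note t = tab_canonical[OF muP]
  have "tsid Alt {x \<in> J. eid \<mu> \<star> x = 0}"
    by (rule tsid_annihilator[OF tJ]) (use eid_central[OF muP] sA in blast)
  then have "{x \<in> J. eid \<mu> \<star> x = 0} = {0} \<or> {x \<in> J. eid \<mu> \<star> x = 0} = J"
    using J unfolding minimal_among_def by blast
  then have ann: "eid \<mu> \<star> x \<noteq> 0" if "x \<in> J" "x \<noteq> 0" for x using that y mu(2) by blast
  have "lsub Alt J" using tJ by (simp add: tsid_def)
  moreover have "\<And>U. lsub Alt U \<Longrightarrow> FV.subspace U \<and> U \<subseteq> supp Sym"
    using lsub_subspace[OF subgrp_Alt] by (simp add: lsub_def)
  ultimately obtain L where L: "minimal_among (lsub Alt) L" "L \<subseteq> J"
    using exists_minimal[of "lsub Alt" J] \<open>J \<noteq> {0}\<close> by metis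
  then have "L \<noteq> {0}" "0 \<in> L" by (auto simp: minimal_among_def lsub_def)
  then obtain x where x: "x \<in> L" "x \<noteq> 0" by blast
  have xS: "x \<in> supp Sym" using x L(2) tsid_supp[OF tJ] sA by blast
  have ex: "eid \<mu> \<star> x \<noteq> 0" using ann x L(2) by blast
  have "eid \<mu> \<star> x \<star> eid \<mu> = eid \<mu> \<star> x"
    using eid_central[OF muP xS] eid(2)[OF muP eid(1)[OF muP]] by (simp add: star_assoc)
  then have 1: "eid \<mu> \<star> x \<star> eid \<mu> \<noteq> 0" using ex by simp
  have "?c \<in> ?I" unfolding I_comp_eq[OF muP t] by (rule gen_base) simp
  then have 2: "eid \<mu> \<star> ?c \<noteq> 0" using eid(2)[OF muP] rsym_star_csym_nonzero[OF t] by simp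
  obtain z where z: "z \<in> ?I" "eid \<mu> \<star> x \<star> z \<star> ?c \<noteq> 0"
    using minimal_tsid_prime[OF I_comp_minimal[OF muP] eid(1)[OF muP] 1 eid(1)[OF muP] 2 star_supp] by blast
  have "eid \<mu> \<star> x \<star> z = x \<star> z"
    using eid_central[OF muP xS] eid(2)[OF muP z(1)] by (simp add: star_assoc)
  then have xz: "x \<star> (z \<star> ?c) \<noteq> 0" using z(2) by (simp add: star_assoc)
  \<comment> \<open>Right multiplication commutes with the left action, and the final factor
    \<open>?c\<close> puts the image into the Specht module.\<close>
  define F where "F u = u \<star> (z \<star> ?c)" for u
  have F: "minimal_among (lsub Alt) (F ` L)" "inj_on F L"
    by (rule image_minimal_submodule[OF L(1), where F = F and x = x];
        use x xz in \<open>simp add: F_def star_add_left star_assoc\<close>)+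
  have "F ` L \<subseteq> specht n \<mu>"
  proof -
    have "F u = u \<star> z \<star> ?c" for u by (simp add: F_def star_assoc)
    then show ?thesis unfolding specht_eq[OF muP] using star_supp by blast
  qed
  moreover have "isomorphic_submodules (CS n) (supp Alt) L (F ` L)"
    unfolding isomorphic_submodules_def CS_simps
    by (rule exI[of _ F]) (use F(2) in \<open>auto simp: bij_betw_def F_def star_add_left star_assoc\<close>)
  moreover have "irreducible_module_of J (CA n) L"
    using L tsid_supp[OF tJ] by (auto simp: irreducible_module_of_def irreducible_submodule_CA_iff CS_simps)
  moreover have "irreducible_submodule (CS n) (supp Alt) (F ` L)"
    using F by (simp add: irreducible_submodule_CS_iff)
  ultimately show ?thesis
    using J mu(1) unfolding J_family_def simple_ideal_CA_iff CS_simps by blast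
qed

lemma tsid_span_Union:
  assumes H: "subgrp H" and t: "\<And>J. J \<in> \<J> \<Longrightarrow> tsid H J"
  shows "tsid H (FV.span (\<Union>\<J>))"
proof -
  have 1: "a \<star> x \<in> FV.span (\<Union>\<J>)" if "x \<in> FV.span (\<Union>\<J>)" "a \<in> supp H" for a x
    using that(1)
  proof (induction x rule: FV.span_induct_alt)
    case (step s x y)
    then obtain J where "J \<in> \<J>" "x \<in> J" by blast
    then have "a \<star> x \<in> \<Union>\<J>" using tsid_lmult[OF t] that(2) by blast
    then show ?case
      unfolding star_add_right star_scale_right by (intro FV.span_add FV.span_scale step.IH FV.span_base)
  qed (simp only: star_zero FV.span_zero)
  have 2: "x \<star> a \<in> FV.span (\<Union>\<J>)" if "x \<in> FV.span (\<Union>\<J>)" "a \<in> supp H" for a x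
    using that(1)
  proof (induction x rule: FV.span_induct_alt)
    case (step s x y)
    then obtain J where "J \<in> \<J>" "x \<in> J" by blast
    then have "x \<star> a \<in> \<Union>\<J>" using tsid_rmult[OF t] that(2) by blast
    then show ?case
      unfolding star_add_left star_scale_left by (intro FV.span_add FV.span_scale step.IH FV.span_base)
  qed (simp only: star_zero FV.span_zero)
  have "FV.span (\<Union>\<J>) \<subseteq> supp H"
    by (rule FV.span_minimal) (use tsid_supp[OF t] supp_subspace in auto)
  then show ?thesis
    using 1 2 subgrp_supp_Sym[OF H]
    by (auto simp: tsid_def lsub_def FV.span_zero FV.span_add)
qed

text \<open>Let \<open>e\<close> be the identity of the span. The elements of the right side killed
  by \<open>e\<close> form an ideal; a minimal ideal inside it would belong to the family, where
  \<open>e\<close> acts as 1. So nothing is killed and every \<open>x\<close> equals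
  \<open>e \<star> x\<close>.\<close>

lemma J_bar_eq:
  assumes X: "X \<subseteq> Par"
  shows "J_bar n X = {x \<in> supp Alt. esum (conj_closure X) \<star> x = x}" (is "_ = ?M")
proof -
  let ?E = "esum (conj_closure X)"
  have sA: "y \<in> supp Sym" if "y \<in> supp Alt" for y using that supp_Alt_Sym by blast
  have "tsid Alt {y \<in> supp Alt. (delta id - ?E) \<star> y = 0}"
  proof (rule tsid_annihilator)
    show "tsid Alt (supp Alt)"
      using supp_Alt_Sym by (auto simp: tsid_def lsub_def supp_add supp_star)
    fix a assume "a \<in> supp Alt"
    then show "(delta id - ?E) \<star> a = a \<star> (delta id - ?E)"
      using esum_central[OF conj_closure_subset[OF X]] sA by (simp add: star_diff_left star_diff_right)
  qed
  moreover have "(delta id - ?E) \<star> y = 0 \<longleftrightarrow> ?E \<star> y = y" if "y \<in> supp Alt" for y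
  proof -
    have "(delta id - ?E) \<star> y = y - ?E \<star> y" using sA[OF that] by (simp add: star_diff_left)
    then show ?thesis by auto
  qed
  then have "{y \<in> supp Alt. (delta id - ?E) \<star> y = 0} = ?M" by blast
  ultimately have tM: "tsid Alt ?M" by simp
  let ?T = "FV.span (\<Union>(J_family X))"
  have tT: "tsid Alt ?T"
    by (rule tsid_span_Union) (auto simp: J_family_def simple_ideal_CA_iff minimal_among_def)
  have TM: "?T \<subseteq> ?M"
    by (rule FV.span_minimal) (use J_family_subset[OF X] tsid_subspace(1)[OF subgrp_Alt tM] in auto)
  obtain e where e: "e \<in> ?T" "\<And>x. x \<in> ?T \<Longrightarrow> e \<star> x = x" "\<And>a. a \<in> supp Alt \<Longrightarrow> a \<star> e = e \<star> a"
    using tsid_identity[OF subgrp_Alt tT] by metis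
  let ?K = "{x \<in> ?M. e \<star> x = 0}"
  have tK: "tsid Alt ?K" by (rule tsid_annihilator[OF tM]) (simp add: e(3))
  have "?K = {0}"
  proof (rule ccontr)
    assume ne: "?K \<noteq> {0}"
    have "\<And>U. tsid Alt U \<Longrightarrow> FV.subspace U \<and> U \<subseteq> supp Sym"
      using tsid_subspace[OF subgrp_Alt] by blast
    with tK ne obtain J where J: "minimal_among (tsid Alt) J" "J \<subseteq> ?K"
      by (rule exists_minimal)
    have "J \<subseteq> ?M" using J(2) by blast
    then have "J \<in> J_family X" by (rule simple_in_J_family[OF X J(1)])
    have "x = 0" if x: "x \<in> J" for x
    proof -
      have "x \<in> ?T" by (rule FV.span_base) (use x \<open>J \<in> J_family X\<close> in blast)
      then have "e \<star> x = x" by (rule e(2))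
      moreover have "e \<star> x = 0" using x J(2) by blast
      ultimately show ?thesis by simp
    qed
    moreover have "tsid Alt J" "J \<noteq> {0}" using J(1) by (auto simp: minimal_among_def)
    ultimately show False using tsid_zero by blast
  qed
  have "x \<in> ?T" if x: "x \<in> ?M" for x
  proof -
    have ex: "e \<star> x \<in> ?T" using x by (intro tsid_rmult[OF tT e(1)]) simp
    have "x - e \<star> x \<in> ?M"
      using x ex TM tsid_subspace(1)[OF subgrp_Alt tM] FV.subspace_diff by blast
    moreover have "e \<star> (x - e \<star> x) = 0" using e(2)[OF ex] by (simp add: star_diff_right)
    ultimately have "x - e \<star> x \<in> {0}" using \<open>?K = {0}\<close> by blast
    then have "x = e \<star> x" by simp
    then show ?thesis using ex by simp
  qed
  then show ?thesis using TM unfolding J_bar_family by blast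
qed

end


section \<open>The sign permutation action\<close>

context vector_space begin

lemma independent_Un:
  assumes A: "independent A" and B: "independent B" and AB: "span A \<inter> span B \<subseteq> {0}"
  shows "independent (A \<union> B)"
  unfolding dependent_explicit
proof safe
  fix S u v assume S: "finite S" "S \<subseteq> A \<union> B" and z: "(\<Sum>v\<in>S. scale (u v) v) = 0"
    and v: "v \<in> S" "u v \<noteq> 0"
  have split: "(\<Sum>v\<in>S. scale (u v) v) = (\<Sum>v\<in>S \<inter> A. scale (u v) v) + (\<Sum>v\<in>S - A. scale (u v) v)"
    using S(1) by (subst sum.union_disjoint[symmetric]) (auto intro!: sum.cong)
  have a: "(\<Sum>v\<in>S \<inter> A. scale (u v) v) \<in> span A" by (intro span_sum span_scale span_base) auto
  have b: "(\<Sum>v\<in>S - A. scale (u v) v) \<in> span B"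
    using S(2) by (intro span_sum span_scale span_base) auto
  have "(\<Sum>v\<in>S \<inter> A. scale (u v) v) = - (\<Sum>v\<in>S - A. scale (u v) v)"
    using z split by (simp add: eq_neg_iff_add_eq_0)
  then have "(\<Sum>v\<in>S \<inter> A. scale (u v) v) \<in> span B" using span_neg[OF b] by simp
  then have za: "(\<Sum>v\<in>S \<inter> A. scale (u v) v) = 0" using a AB by blast
  then have zb: "(\<Sum>v\<in>S - A. scale (u v) v) = 0" using z split by simp
  show False
  proof (cases "v \<in> A")
    case True
    then have "dependent A"
      unfolding dependent_explicit using S(1) za v by (intro exI[of _ "S \<inter> A"] exI[of _ u]) auto
    then show ?thesis using A by contradiction
  next
    case False
    then have "dependent B"
      unfolding dependent_explicit using S zb v by (intro exI[of _ "S - A"] exI[of _ u]) auto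
    then show ?thesis using B by contradiction
  qed
qed

end

section \<open>The tensor power, a graded basis and word tensors\<close>

locale tensor_rep = sym_algebra n for n +
  fixes sV :: "complex \<Rightarrow> 'v::ab_group_add \<Rightarrow> 'v"
    and sT :: "complex \<Rightarrow> 't::ab_group_add \<Rightarrow> 't"
    and V0 V1 :: "'v set"
    and \<tau> :: "(nat \<Rightarrow> 'v) \<Rightarrow> 't"
    and k l :: nat
  assumes vsV: "vector_space sV" and vsT: "vector_space sT"
    and dirsum: "direct_sum_of sV UNIV V0 V1"
    and dim0: "has_dimension sV V0 k" and dim1: "has_dimension sV V1 l"
    and tensor: "is_tensor_power n sV sT \<tau>"
begin

sublocale VV: vector_space sV by (rule vsV)
sublocale VT: vector_space sT by (rule vsT)

text \<open>Even vectors receive the indices below \<open>k\<close>, so the parity of a letter is a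
  comparison with \<open>k\<close> and even letters precede odd ones. The weight used for
  straightening depends on this order.\<close>

definition graded_basis :: "(nat \<Rightarrow> 'v) \<Rightarrow> bool" where
  "graded_basis b \<longleftrightarrow> inj_on b {..<k + l} \<and> VV.independent (b ` {..<k + l}) \<and>
     VV.span (b ` {..<k}) = V0 \<and> VV.span (b ` {k..<k + l}) = V1"

lemma exists_graded_basis: "\<exists>b. graded_basis b"
proof -
  obtain B0 where B0: "finite B0" "card B0 = k" "VV.independent B0" "VV.span B0 = V0"
    using dim0 by (auto simp: has_dimension_def)
  obtain B1 where B1: "finite B1" "card B1 = l" "VV.independent B1" "VV.span B1 = V1"
    using dim1 by (auto simp: has_dimension_def)
  have int: "V0 \<inter> V1 = {0}" using dirsum by (simp add: direct_sum_of_def)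
  have disj: "B0 \<inter> B1 = {}"
  proof -
    have "x = 0" if "x \<in> B0" "x \<in> B1" for x
      using that B0(4) B1(4) VV.span_base int by blast
    then show ?thesis using B0(3) VV.dependent_zero by blast
  qed
  obtain g where g: "bij_betw g {..<k} B0"
    using ex_bij_betw_nat_finite[OF B0(1)] B0(2) by (auto simp: lessThan_atLeast0)
  obtain h where h: "bij_betw h {..<l} B1"
    using ex_bij_betw_nat_finite[OF B1(1)] B1(2) by (auto simp: lessThan_atLeast0)
  define b where "b i = (if i < k then g i else h (i - k))" for i
  have b0: "bij_betw b {..<k} B0"
    by (subst bij_betw_cong[of _ _ g]) (use g in \<open>auto simp: b_def\<close>)
  have b1: "bij_betw b {k..<k + l} B1"
  proof -
    have "bij_betw (\<lambda>i. i - k) {k..<k + l} {..<l}"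
      by (rule bij_betwI[of _ _ _ "\<lambda>i. i + k"]) auto
    from bij_betw_trans[OF this h] have "bij_betw (h \<circ> (\<lambda>i. i - k)) {k..<k + l} B1" .
    then show ?thesis by (subst bij_betw_cong[of _ _ "h \<circ> (\<lambda>i. i - k)"]) (auto simp: b_def)
  qed
  have un: "{..<k} \<union> {k..<k + l} = {..<k + l}" by auto
  have "bij_betw b {..<k + l} (B0 \<union> B1)"
    using bij_betw_combine[OF b0 b1 disj] by (simp only: un)
  moreover have "VV.independent (B0 \<union> B1)"
    by (rule VV.independent_Un) (use B0 B1 int in auto)
  ultimately have "graded_basis b"
    using b0 b1 B0 B1 by (simp add: graded_basis_def bij_betw_def)
  then show ?thesis by blast
qed

definition b :: "nat \<Rightarrow> 'v" where
  "b = (SOME b. graded_basis b)"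

lemma graded_basis_b: "graded_basis b"
  unfolding b_def by (rule someI_ex[OF exists_graded_basis])

lemma b_inj: "inj_on b {..<k + l}" and b_indep: "VV.independent (b ` {..<k + l})"
  and b_span0: "VV.span (b ` {..<k}) = V0" and b_span1: "VV.span (b ` {k..<k + l}) = V1"
  using graded_basis_b by (simp_all add: graded_basis_def)

lemma b_span: "VV.span (b ` {..<k + l}) = UNIV"
proof -
  have un: "{..<k + l} = {..<k} \<union> {k..<k + l}" by auto
  have "VV.span (b ` {..<k + l}) = {x + y |x y. x \<in> V0 \<and> y \<in> V1}"
    unfolding un image_Un VV.span_Un by (simp add: b_span0 b_span1)
  then show ?thesis using dirsum by (simp add: direct_sum_of_def)
qed

lemma V01_int: "V0 \<inter> V1 = {0}"
  using dirsum by (simp add: direct_sum_of_def)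

lemma b_in: "i < k \<Longrightarrow> b i \<in> V0" "k \<le> i \<Longrightarrow> i < k + l \<Longrightarrow> b i \<in> V1"
proof -
  show "b i \<in> V0" if "i < k"
    using VV.span_base[of "b i" "b ` {..<k}"] that unfolding b_span0 by simp
  show "b i \<in> V1" if "k \<le> i" "i < k + l"
    using VV.span_base[of "b i" "b ` {k..<k + l}"] that unfolding b_span1 by simp
qed

lemma b_nonzero: "i < k + l \<Longrightarrow> b i \<noteq> 0"
proof
  assume "i < k + l" "b i = 0"
  then have "0 \<in> b ` {..<k + l}" using image_eqI[of 0 b i "{..<k + l}"] by simp
  then show False using b_indep VV.dependent_zero[of "b ` {..<k + l}"] by simp
qed

text \<open>For odd indices one needs \<open>b i \<noteq> 0\<close>, because the zero vector lies in
  \<open>V0\<close> and counts as even.\<close>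

lemma b_deg: "i < k + l \<Longrightarrow> super_degree V0 (b i) = (if i < k then 0 else 1)"
  using b_in(1)[of i] b_in(2)[of i] b_nonzero[of i] V01_int by (cases "i < k") (auto simp: super_degree_def)

definition coord :: "nat \<Rightarrow> 'v \<Rightarrow> complex" where
  "coord i x = VV.representation (b ` {..<k + l}) x (b i)"

lemma coord_add: "coord i (x + y) = coord i x + coord i y"
  using b_span by (simp add: coord_def VV.representation_add[OF b_indep])

lemma coord_scale: "coord i (sV c x) = c * coord i x"
  using b_span by (simp add: coord_def VV.representation_scale[OF b_indep])

lemma coord_b: "i < k + l \<Longrightarrow> j < k + l \<Longrightarrow> coord i (b j) = (if i = j then 1 else 0)"
  using b_inj by (auto simp: coord_def VV.representation_basis[OF b_indep] inj_on_def)

text \<open>Induction on the set of slots in which generators have been replaced by arbitrary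
  vectors of their span. The generators may depend on the slot because Koszul signs are compatible
  with linear combinations only within a fixed parity.\<close>

lemma slotwise_span:
  assumes sub: "\<And>v i. i \<in> N \<Longrightarrow> VV.subspace {x. Q (v(i := x))}"
    and base: "\<And>v. \<forall>i\<in>N. v i \<in> C i \<Longrightarrow> Q v"
    and v: "\<forall>i\<in>N. v i \<in> VV.span (C i)"
  shows "Q v"
proof -
  have "\<forall>v. (\<forall>i\<in>M. v i \<in> VV.span (C i)) \<and> (\<forall>i\<in>N - M. v i \<in> C i) \<longrightarrow> Q v" if "finite M" "M \<subseteq> N" for M
    using that
  proof (induction M rule: finite_induct)
    case empty
    then show ?case using base by simp
  next
    case (insert j M)
    show ?case
    proof (intro allI impI)
      fix v assume v: "(\<forall>i\<in>insert j M. v i \<in> VV.span (C i)) \<and> (\<forall>i\<in>N - insert j M. v i \<in> C i)"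
      have "C j \<subseteq> {x. Q (v(j := x))}"
      proof clarify
        fix x assume "x \<in> C j"
        then have "(\<forall>i\<in>M. (v(j := x)) i \<in> VV.span (C i)) \<and> (\<forall>i\<in>N - M. (v(j := x)) i \<in> C i)"
          using v insert.hyps by auto
        then show "Q (v(j := x))" using insert.IH insert.prems by blast
      qed
      then have "VV.span (C j) \<subseteq> {x. Q (v(j := x))}"
        using sub insert.prems by (intro VV.span_minimal) auto
      moreover have "v j \<in> VV.span (C j)" using v by blast
      ultimately have "Q (v(j := v j))" by blast
      then show "Q v" by simp
    qed
  qed
  from this[of N] show ?thesis using v by simp
qed

lemma tau_cong: "(\<And>i. i \<in> N \<Longrightarrow> v i = w i) \<Longrightarrow> \<tau> v = \<tau> w"
  using tensor unfolding is_tensor_power_def multilinear_map_def N_def by blast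

lemma tau_linear: "i \<in> N \<Longrightarrow> Vector_Spaces.linear sV sT (\<lambda>x. \<tau> (v(i := x)))"
  using tensor unfolding is_tensor_power_def multilinear_map_def N_def by blast

lemma tau_add: "i \<in> N \<Longrightarrow> \<tau> (v(i := x + y)) = \<tau> (v(i := x)) + \<tau> (v(i := y))"
  using tau_linear[of i v] by (simp add: Vector_Spaces.linear_iff)

lemma tau_scale: "i \<in> N \<Longrightarrow> \<tau> (v(i := sV c x)) = sT c (\<tau> (v(i := x)))"
  using tau_linear[of i v] by (simp add: Vector_Spaces.linear_iff)

lemma tau_zero: "i \<in> N \<Longrightarrow> \<tau> (v(i := 0)) = 0"
  using tau_scale[of i v 0 0] by simp

definition t :: "(nat \<Rightarrow> nat) \<Rightarrow> 't" where
  "t w = \<tau> (\<lambda>i. b (w i))"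

text \<open>The value 0 outside \<open>N\<close> makes a word determined by its letters, so that
  \<open>t\<close> is injective on words.\<close>

definition Words :: "(nat \<Rightarrow> nat) set" where
  "Words = {w. (\<forall>i\<in>N. w i < k + l) \<and> (\<forall>i. i \<notin> N \<longrightarrow> w i = 0)}"

lemma vs_complex: "vector_space ((*) :: complex \<Rightarrow> complex \<Rightarrow> complex)"
  by unfold_locales (auto simp: algebra_simps)

text \<open>The product of the coordinate functions of the letters is multilinear; the universal
  property turns it into an element of the dual basis.\<close>

lemma word_functional:
  assumes "w \<in> Words"
  shows "\<exists>g. Vector_Spaces.linear sT (*) g \<and> (\<forall>w'\<in>Words. g (t w') = (if w' = w then 1 else 0))"
proof -
  let ?f = "\<lambda>v. \<Prod>i\<in>N. coord (w i) (v i)"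
  have upd: "?f (v(i := x)) = coord (w i) x * (\<Prod>j\<in>N - {i}. coord (w j) (v j))" if "i \<in> N" for v i x
  proof -
    have "?f (v(i := x)) = coord (w i) ((v(i := x)) i) * (\<Prod>j\<in>N - {i}. coord (w j) ((v(i := x)) j))"
      using that by (intro prod.remove) auto
    also have "(\<Prod>j\<in>N - {i}. coord (w j) ((v(i := x)) j)) = (\<Prod>j\<in>N - {i}. coord (w j) (v j))"
      by (rule prod.cong) auto
    finally show ?thesis by simp
  qed
  have "Vector_Spaces.linear sV (*) (\<lambda>x. ?f (v(i := x)))" if "i \<in> N" for v i
    unfolding Vector_Spaces.linear_iff upd[OF that]
    using vsV vs_complex by (auto simp: coord_add coord_scale algebra_simps)
  moreover have "?f v = ?f u" if "\<forall>i\<in>N. v i = u i" for v u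
    using that by (intro prod.cong) auto
  ultimately have "multilinear_map n sV (*) ?f"
    unfolding multilinear_map_def N_def[symmetric] by blast
  then obtain g where g: "Vector_Spaces.linear sT (*) g" "\<And>v. g (\<tau> v) = ?f v"
    using tensor unfolding is_tensor_power_def by blast
  have "g (t w') = (if w' = w then 1 else 0)" if w': "w' \<in> Words" for w'
  proof -
    have "g (t w') = (\<Prod>i\<in>N. if w i = w' i then 1 else 0)"
      unfolding t_def g(2) using assms w' by (intro prod.cong) (auto simp: coord_b Words_def)
    also have "\<dots> = (if \<forall>i\<in>N. w i = w' i then 1 else 0)"
      by (induction rule: finite_induct[OF finite_N]) auto
    also have "(\<forall>i\<in>N. w i = w' i) \<longleftrightarrow> w' = w"
      using assms w' by (auto simp: Words_def fun_eq_iff) metis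
    finally show ?thesis .
  qed
  then show ?thesis using g(1) by blast
qed

lemma t_inj: "inj_on t Words"
proof (rule inj_onI)
  fix w w' assume w: "w \<in> Words" "w' \<in> Words" "t w = t w'"
  obtain g where "\<forall>w'\<in>Words. g (t w') = (if w' = w then 1 else (0::complex))"
    using word_functional[OF w(1)] by blast
  then show "w = w'" using w by (metis zero_neq_one)
qed

lemma t_indep: "VT.independent (t ` Words)"
  unfolding VT.dependent_explicit
proof safe
  fix S u v assume S: "finite S" "S \<subseteq> t ` Words" and z: "(\<Sum>v\<in>S. sT (u v) v) = 0"
    and v: "v \<in> S" "u v \<noteq> 0"
  then obtain w where w: "t w \<in> S" "u (t w) \<noteq> 0" "w \<in> Words" by blast
  obtain g where g: "Vector_Spaces.linear sT (*) g" "\<forall>w'\<in>Words. g (t w') = (if w' = w then 1 else (0::complex))"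
    using word_functional[OF w(3)] by blast
  interpret g: Vector_Spaces.linear sT "(*)" g by fact
  have "0 = (\<Sum>v\<in>S. u v * g v)" using arg_cong[OF z, of g] by (simp add: g.sum g.scale)
  also have "\<dots> = (\<Sum>v\<in>S. if v = t w then u v else 0)"
  proof (rule sum.cong[OF refl])
    fix v assume "v \<in> S"
    then obtain w' where "v = t w'" "w' \<in> Words" using S(2) by blast
    then show "u v * g v = (if v = t w then u v else 0)"
      using g(2) w(3) t_inj by (auto simp: inj_on_def)
  qed
  also have "\<dots> = u (t w)" using S(1) w(1) by (simp add: sum.delta)
  finally show False using w(2) by simp
qed

text \<open>Otherwise some functional vanishes on all words but not everywhere. By slotwise
  linearity it vanishes on all pure tensors, contradicting uniqueness in the universal property for
  the zero form.\<close>

lemma t_span: "VT.span (t ` Words) = UNIV"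
proof (rule ccontr)
  assume "VT.span (t ` Words) \<noteq> UNIV"
  then obtain x where x: "x \<notin> VT.span (t ` Words)" by blast
  interpret TC: vector_space_pair sT "(*) :: complex \<Rightarrow> complex \<Rightarrow> complex"
    using vsT vs_complex by (simp add: vector_space_pair_def)
  have "VT.independent (insert x (t ` Words))"
    using x t_indep by (rule VT.independent_insertI)
  then obtain g where g: "Vector_Spaces.linear sT (*) g" "\<forall>y\<in>insert x (t ` Words). g y = (if y = x then 1 else 0)"
    using TC.linear_independent_extend[of _ "\<lambda>y. if y = x then 1 else 0"] by blast
  have tx: "t w \<noteq> x" if "w \<in> Words" for w using that x VT.span_base by blast
  interpret g: Vector_Spaces.linear sT "(*)" g by (rule g(1))
  have "g (\<tau> v) = 0" for v
  proof (rule slotwise_span[where C = "\<lambda>i. b ` {..<k + l}"])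
    fix v :: "nat \<Rightarrow> 'v" and i assume i: "i \<in> N"
    show "VV.subspace {x. g (\<tau> (v(i := x))) = 0}"
      using i by (auto simp: VV.subspace_def tau_add tau_scale tau_zero g.add g.scale)
  next
    fix v assume v: "\<forall>i\<in>N. v i \<in> b ` {..<k + l}"
    define w where "w i = (if i \<in> N then SOME j. j < k + l \<and> v i = b j else 0)" for i
    have w: "w i < k + l \<and> v i = b (w i)" if "i \<in> N" for i
    proof -
      have "\<exists>j. j < k + l \<and> v i = b j" using v that by blast
      then have "(SOME j. j < k + l \<and> v i = b j) < k + l \<and> v i = b (SOME j. j < k + l \<and> v i = b j)"
        by (rule someI_ex)
      then show ?thesis using that by (simp add: w_def)
    qed
    have "\<tau> v = t w" unfolding t_def by (rule tau_cong) (use w in blast)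
    moreover have "w \<in> Words" using w by (auto simp: Words_def w_def)
    ultimately show "g (\<tau> v) = 0" using g(2) tx by auto
  qed (simp add: b_span)
  moreover have "multilinear_map n sV (*) (\<lambda>v. 0::complex)"
    unfolding multilinear_map_def Vector_Spaces.linear_iff using vsV vs_complex by simp
  then have "\<exists>!g. Vector_Spaces.linear sT (*) g \<and> (\<forall>v. g (\<tau> v) = (0::complex))"
    using tensor unfolding is_tensor_power_def by blast
  moreover have "Vector_Spaces.linear sT (*) (\<lambda>x. 0::complex)"
    unfolding Vector_Spaces.linear_iff using vsT vs_complex by simp
  ultimately have "g = (\<lambda>x. 0)" using g(1) by blast
  then show False using g(2) by simp
qed

lemma linear_eq_on_words:
  assumes "Vector_Spaces.linear sT sT F" "Vector_Spaces.linear sT sT G"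
    and "\<And>w. w \<in> Words \<Longrightarrow> F (t w) = G (t w)"
  shows "F = G"
proof
  fix x
  interpret TT: vector_space_pair sT sT using vsT by (simp add: vector_space_pair_def)
  show "F x = G x"
    using TT.linear_eq_on[OF assms(1,2), of x "t ` Words"] assms(3) t_span by auto
qed

section \<open>Koszul signs and the action of permutations\<close>

definition inversions :: "(nat \<Rightarrow> nat) \<Rightarrow> (nat \<times> nat) set" where
  "inversions \<sigma> = {(i, j). i \<in> N \<and> j \<in> N \<and> i < j \<and> \<sigma> i > \<sigma> j}"

definition ks :: "(nat \<Rightarrow> nat) \<Rightarrow> (nat \<Rightarrow> nat) \<Rightarrow> complex" where
  "ks \<sigma> w = (\<Prod>(i, j)\<in>inversions \<sigma>. if k \<le> w i \<and> k \<le> w j then - 1 else 1)"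

lemma koszul_cong:
  assumes "\<And>i. i \<in> N \<Longrightarrow> super_degree V0 (v i) = super_degree V0 (u i)"
  shows "koszul_sign n V0 \<sigma> v = koszul_sign n V0 \<sigma> u"
  unfolding koszul_sign_def N_def[symmetric] by (rule prod.cong) (auto simp: assms)

lemma koszul_ks: "w \<in> Words \<Longrightarrow> koszul_sign n V0 \<sigma> (\<lambda>i. b (w i)) = ks \<sigma> w"
  unfolding koszul_sign_def N_def[symmetric] ks_def inversions_def
  by (rule prod.cong) (auto simp: b_deg Words_def)

definition R :: "(nat \<Rightarrow> nat) \<Rightarrow> 't \<Rightarrow> 't" where
  "R = sign_perm n sT \<tau> V0 V1"

lemma word_comp: "w \<in> Words \<Longrightarrow> g \<in> Sym \<Longrightarrow> w \<circ> g \<in> Words"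
  using Sym_image_iff by (auto simp: Words_def)

text \<open>The map is prescribed on the basis of words. On pure homogeneous tensors both sides are
  linear in each slot once the parities are fixed, so agreement on words of the same parities
  suffices.\<close>

lemma sign_perm_exists:
  assumes s: "\<sigma> \<in> Sym"
  shows "\<exists>F. Vector_Spaces.linear sT sT F \<and>
     (\<forall>v. (\<forall>i\<in>N. v i \<in> V0 \<union> V1) \<longrightarrow>
        F (\<tau> v) = sT (koszul_sign n V0 \<sigma> v) (\<tau> (\<lambda>i. v (inv' \<sigma> i))))"
proof -
  interpret TT: vector_space_pair sT sT using vsT by (simp add: vector_space_pair_def)
  let ?G = "\<lambda>x. let w = inv_into Words t x in sT (ks \<sigma> w) (t (w \<circ> inv' \<sigma>))"
  obtain F where F: "Vector_Spaces.linear sT sT F" "\<forall>x\<in>t ` Words. F x = ?G x"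
    using TT.linear_independent_extend[OF t_indep, of ?G] by blast
  interpret F: Vector_Spaces.linear sT sT F by (rule F(1))
  have Ft: "F (t w) = sT (ks \<sigma> w) (t (w \<circ> inv' \<sigma>))" if "w \<in> Words" for w
    using F(2) that inv_into_f_f[OF t_inj that] by simp
  have "F (\<tau> v) = sT (koszul_sign n V0 \<sigma> v) (\<tau> (\<lambda>i. v (inv' \<sigma> i)))" if v: "\<forall>i\<in>N. v i \<in> V0 \<union> V1" for v
  proof -
    \<comment> \<open>The sign is frozen while the slots vary: as a function of all vectors it would
      not be linear in a slot.\<close>
    define c where "c = koszul_sign n V0 \<sigma> v"
    \<comment> \<open>A zero slot is assigned even generators, in agreement with its degree
      0.\<close>
    define C where "C i = (if v i \<in> V0 then b ` {..<k} else b ` {k..<k + l})" for i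
    have "F (\<tau> v) = sT c (\<tau> (\<lambda>i. v (inv' \<sigma> i)))"
    proof (rule slotwise_span[where C = C])
      fix u :: "nat \<Rightarrow> 'v" and i assume i: "i \<in> N"
      have upd: "(\<lambda>j. (u(i := x)) (inv' \<sigma> j)) = (\<lambda>j. u (inv' \<sigma> j))(\<sigma> i := x)" for x
        using s by (auto simp: fun_eq_iff)
      have "\<sigma> i \<in> N" using Sym_image[OF s i] .
      then show "VV.subspace {x. F (\<tau> (u(i := x))) = sT c (\<tau> (\<lambda>j. (u(i := x)) (inv' \<sigma> j)))}"
        unfolding upd using i
        by (auto simp: VV.subspace_def tau_add tau_scale tau_zero F.add F.scale F.zero
            VT.scale_right_distrib VT.scale_left_commute)
    next
      fix u assume u: "\<forall>i\<in>N. u i \<in> C i"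
      have Cb: "C i \<subseteq> b ` {..<k + l}" for i by (auto simp: C_def)
      define w where "w i = (if i \<in> N then SOME j. j < k + l \<and> u i = b j else 0)" for i
      have w: "w i < k + l \<and> u i = b (w i)" if "i \<in> N" for i
      proof -
        have "\<exists>j. j < k + l \<and> u i = b j" using u that Cb[of i] by blast
        then have "(SOME j. j < k + l \<and> u i = b j) < k + l \<and> u i = b (SOME j. j < k + l \<and> u i = b j)"
          by (rule someI_ex)
        then show ?thesis using that by (simp add: w_def)
      qed
      have tw: "\<tau> u = t w" unfolding t_def by (rule tau_cong) (use w in blast)
      have W: "w \<in> Words" using w by (auto simp: Words_def w_def)
      have tw': "\<tau> (\<lambda>j. u (inv' \<sigma> j)) = t (w \<circ> inv' \<sigma>)"
        unfolding t_def by (rule tau_cong) (use w Sym_image[OF Sym_inv[OF s]] in auto)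
      have "super_degree V0 (v i) = super_degree V0 (b (w i))" if i: "i \<in> N" for i
      proof (cases "v i \<in> V0")
        case True
        then have "b (w i) \<in> V0"
          using u w[OF i] i b_in(1) by (fastforce simp: C_def)
        then show ?thesis using True by (simp add: super_degree_def)
      next
        case False
        have "u i \<in> C i" using u i by blast
        then have "b (w i) \<in> b ` {k..<k + l}" using False w[OF i] by (simp add: C_def)
        then obtain j where "j \<in> {k..<k + l}" "b (w i) = b j" by blast
        then show ?thesis using False b_deg[of j] by (simp add: super_degree_def)
      qed
      then have "c = ks \<sigma> w"
        unfolding c_def koszul_ks[OF W, symmetric] by (rule koszul_cong)
      then show "F (\<tau> u) = sT c (\<tau> (\<lambda>j. u (inv' \<sigma> j)))"
        by (simp add: tw tw' Ft[OF W])
    next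
      show "\<forall>i\<in>N. v i \<in> VV.span (C i)"
        using v by (auto simp: C_def b_span0 b_span1)
    qed
    then show ?thesis by (simp only: c_def)
  qed
  then show ?thesis using F(1) by blast
qed

lemma R_props:
  assumes s: "\<sigma> \<in> Sym"
  shows "Vector_Spaces.linear sT sT (R \<sigma>)"
    and "w \<in> Words \<Longrightarrow> R \<sigma> (t w) = sT (ks \<sigma> w) (t (w \<circ> inv' \<sigma>))"
proof -
  let ?P = "\<lambda>F. Vector_Spaces.linear sT sT F \<and>
     (\<forall>v. (\<forall>i\<in>N. v i \<in> V0 \<union> V1) \<longrightarrow>
        F (\<tau> v) = sT (koszul_sign n V0 \<sigma> v) (\<tau> (\<lambda>i. v (inv' \<sigma> i))))"
  have hom: "\<forall>i\<in>N. b (w i) \<in> V0 \<union> V1" if "w \<in> Words" for w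
  proof
    fix i assume "i \<in> N"
    then have "w i < k + l" using that by (simp add: Words_def)
    then show "b (w i) \<in> V0 \<union> V1" using b_in(1)[of "w i"] b_in(2)[of "w i"] by (cases "w i < k") auto
  qed
  have word: "F (t w) = sT (ks \<sigma> w) (t (w \<circ> inv' \<sigma>))" if "?P F" "w \<in> Words" for F w
    using that hom[OF that(2)] koszul_ks[OF that(2)] by (simp add: t_def)
  have "\<exists>!F. ?P F"
  proof (rule ex_ex1I[OF sign_perm_exists[OF s]])
    fix F G assume FG: "?P F" "?P G"
    show "F = G"
    proof (rule linear_eq_on_words)
      show "F (t w) = G (t w)" if "w \<in> Words" for w
        using word[OF FG(1) that] word[OF FG(2) that] by simp
    qed (use FG in blast)+
  qed
  then have "?P (R \<sigma>)" unfolding R_def sign_perm_def N_def[symmetric] by (rule theI')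
  then show "Vector_Spaces.linear sT sT (R \<sigma>)" "w \<in> Words \<Longrightarrow> R \<sigma> (t w) = sT (ks \<sigma> w) (t (w \<circ> inv' \<sigma>))"
    using word by auto
qed

definition pairs :: "(nat \<times> nat) set" where
  "pairs = {(i, j). i \<in> N \<and> j \<in> N \<and> i < j}"

lemma finite_pairs: "finite pairs"
  by (rule finite_subset[of _ "N \<times> N"]) (auto simp: pairs_def)

text \<open>An unordered pair is represented in increasing order, so the permuted pair has to be
  sorted again; symmetry of \<open>m\<close> makes this harmless.\<close>

lemma prod_pairs_reindex:
  fixes m :: "nat \<Rightarrow> nat \<Rightarrow> complex"
  assumes g: "g \<in> Sym" and sym: "\<And>i j. m i j = m j i"
  shows "(\<Prod>(i, j)\<in>pairs. m (g i) (g j)) = (\<Prod>(i, j)\<in>pairs. m i j)"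
proof (rule prod.reindex_bij_witness[of _
    "\<lambda>(i, j). (min (inv' g i) (inv' g j), max (inv' g i) (inv' g j))"
    "\<lambda>(i, j). (min (g i) (g j), max (g i) (g j))"])
  note inj = Sym_inj_iff[OF g] Sym_inj_iff[OF Sym_inv[OF g]]
  have mm: "min i j = i \<and> max i j = j \<or> min i j = j \<and> max i j = i" for i j :: nat
    by (auto simp: min_def max_def)
  fix p assume "p \<in> pairs"
  then obtain i j where p: "p = (i, j)" "i \<in> N" "j \<in> N" "i < j" by (auto simp: pairs_def)
  show "(case case p of (i, j) \<Rightarrow> (min (g i) (g j), max (g i) (g j)) of
      (i, j) \<Rightarrow> (min (inv' g i) (inv' g j), max (inv' g i) (inv' g j))) = p"
    using p(4) mm[of "g i" "g j"] g by (auto simp: p(1))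
  show "(case case p of (i, j) \<Rightarrow> (min (inv' g i) (inv' g j), max (inv' g i) (inv' g j)) of
      (i, j) \<Rightarrow> (min (g i) (g j), max (g i) (g j))) = p"
    using p(4) mm[of "inv' g i" "inv' g j"] g by (auto simp: p(1))
  have "g i \<noteq> g j" "inv' g i \<noteq> inv' g j" using p(4) inj by simp_all
  then show "(case p of (i, j) \<Rightarrow> (min (g i) (g j), max (g i) (g j))) \<in> pairs"
    "(case p of (i, j) \<Rightarrow> (min (inv' g i) (inv' g j), max (inv' g i) (inv' g j))) \<in> pairs"
    using p Sym_image[OF g] Sym_image[OF Sym_inv[OF g]] by (auto simp: pairs_def min_def max_def)
  show "(case case p of (i, j) \<Rightarrow> (min (g i) (g j), max (g i) (g j)) of (i, j) \<Rightarrow> m i j) =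
      (case p of (i, j) \<Rightarrow> m (g i) (g j))"
    using mm[of "g i" "g j"] sym by (auto simp: p(1))
qed

text \<open>Reversal of order without fixing which position comes first: for distinct positions and
  a permutation this is symmetric, as reindexing over unordered pairs requires.\<close>

definition flips :: "(nat \<Rightarrow> nat) \<Rightarrow> nat \<Rightarrow> nat \<Rightarrow> bool" where
  "flips \<sigma> i j \<longleftrightarrow> (i < j) \<noteq> (\<sigma> i < \<sigma> j)"

lemma ks_pairs:
  assumes "\<sigma> \<in> Sym"
  shows "ks \<sigma> w = (\<Prod>(i, j)\<in>pairs. if flips \<sigma> i j \<and> i \<noteq> j \<and> k \<le> w i \<and> k \<le> w j then - 1 else 1)"
proof -
  have "\<sigma> j < \<sigma> i \<longleftrightarrow> flips \<sigma> i j" if "i < j" for i j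
    using that Sym_inj_iff[OF assms, of i j] by (auto simp: flips_def)
  then show ?thesis
    unfolding ks_def
    by (intro prod.mono_neutral_cong_left finite_pairs) (auto simp: inversions_def pairs_def split: if_splits)
qed

text \<open>A pair is reversed by the composite exactly if one, and only one, of the two steps
  reverses it. For two odd letters each reversal contributes -1; the second step sees the letters in
  their new positions.\<close>

lemma ks_comp:
  assumes s: "\<sigma> \<in> Sym" and r: "\<rho> \<in> Sym"
  shows "ks (\<sigma> \<circ> \<rho>) w = ks \<rho> w * ks \<sigma> (w \<circ> inv' \<rho>)"
proof -
  let ?m = "\<lambda>i j. if flips \<sigma> i j \<and> i \<noteq> j \<and> k \<le> (w \<circ> inv' \<rho>) i \<and> k \<le> (w \<circ> inv' \<rho>) j then - 1 else (1::complex)"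
  have fl: "flips (\<sigma> \<circ> \<rho>) i j \<longleftrightarrow> flips \<rho> i j \<noteq> flips \<sigma> (\<rho> i) (\<rho> j)" for i j
    by (auto simp: flips_def)
  have "flips \<sigma> i j \<longleftrightarrow> flips \<sigma> j i" if "i \<noteq> j" for i j
    using that Sym_inj_iff[OF s, of i j] by (auto simp: flips_def)
  then have sym: "?m i j = ?m j i" for i j by auto
  have "ks \<sigma> (w \<circ> inv' \<rho>) = (\<Prod>(i, j)\<in>pairs. ?m i j)" by (rule ks_pairs[OF s])
  also have "\<dots> = (\<Prod>(i, j)\<in>pairs. ?m (\<rho> i) (\<rho> j))"
    by (rule prod_pairs_reindex[OF r sym, symmetric])
  finally show ?thesis
    unfolding ks_pairs[OF Sym_comp[OF s r]] ks_pairs[OF r]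
    by (simp only: prod.distrib[symmetric], intro prod.cong refl)
      (auto simp: fl r Sym_inj_iff[OF r])
qed

lemma ks_id: "ks id w = 1"
proof -
  have "inversions id = {}" by (auto simp: inversions_def)
  then show ?thesis by (simp add: ks_def)
qed

lemma R_linear: "\<sigma> \<in> Sym \<Longrightarrow> R \<sigma> (x + y) = R \<sigma> x + R \<sigma> y"
  "\<sigma> \<in> Sym \<Longrightarrow> R \<sigma> (sT c x) = sT c (R \<sigma> x)"
  using R_props(1)[of \<sigma>] by (auto simp: Vector_Spaces.linear_iff)

lemma R_comp:
  assumes s: "\<sigma> \<in> Sym" and r: "\<rho> \<in> Sym"
  shows "R (\<sigma> \<circ> \<rho>) = R \<sigma> \<circ> R \<rho>"
proof (rule linear_eq_on_words)
  show "Vector_Spaces.linear sT sT (R \<sigma> \<circ> R \<rho>)"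
    by (rule Vector_Spaces.linear_compose[OF R_props(1)[OF r] R_props(1)[OF s]])
  fix w assume w: "w \<in> Words"
  have "R (\<sigma> \<circ> \<rho>) (t w) = sT (ks (\<sigma> \<circ> \<rho>) w) (t (w \<circ> inv' \<rho> \<circ> inv' \<sigma>))"
    using w s r by (simp add: R_props Sym_inv_distrib comp_assoc)
  then show "R (\<sigma> \<circ> \<rho>) (t w) = (R \<sigma> \<circ> R \<rho>) (t w)"
    using w s r by (simp add: R_props R_linear word_comp ks_comp)
qed (use s r in \<open>simp add: R_props\<close>)

lemma R_id: "R id = id"
  by (rule linear_eq_on_words) (auto simp: R_props(1)[OF Sym_id] R_props(2)[OF Sym_id] ks_id VT.linear_id)

section \<open>The representation of the group algebra\<close>

definition \<phi> :: "((nat \<Rightarrow> nat) \<Rightarrow> complex) \<Rightarrow> 't \<Rightarrow> 't" where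
  "\<phi> = sign_rep n sT \<tau> V0 V1"

lemma phi_apply: "\<phi> a x = (\<Sum>\<sigma>\<in>Sym. sT (a \<sigma>) (R \<sigma> x))"
  by (simp add: \<phi>_def sign_rep_def R_def carrier_sym)

lemma phi_add: "\<phi> (a + c) = \<phi> a + \<phi> c"
  by (rule ext) (simp add: phi_apply VT.scale_left_distrib sum.distrib)

lemma phi_scale: "\<phi> (c \<odot> a) = fun_scale sT c (\<phi> a)"
  by (rule ext) (simp add: phi_apply fun_scale_def VT.scale_sum_right)

lemma phi_zero: "\<phi> 0 = 0"
  by (rule ext) (simp add: phi_apply)

lemma phi_diff: "\<phi> (a - c) = \<phi> a - \<phi> c"
  by (rule ext) (simp add: phi_apply VT.scale_left_diff_distrib sum_subtractf)

lemma phi_lin: "\<phi> a (x + y) = \<phi> a x + \<phi> a y" "\<phi> a (sT c x) = sT c (\<phi> a x)"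
  by (simp_all add: phi_apply R_linear VT.scale_right_distrib sum.distrib VT.scale_sum_right mult.commute)

lemma phi_lin_zero: "\<phi> a 0 = 0"
  using phi_lin(2)[of a 0 0] by simp

lemma phi_delta: "g \<in> Sym \<Longrightarrow> \<phi> (delta g) = R g"
proof
  fix x assume g: "g \<in> Sym"
  have "\<phi> (delta g) x = (\<Sum>\<sigma>\<in>Sym. if \<sigma> = g then R g x else 0)"
    unfolding phi_apply by (intro sum.cong) (auto simp: delta_def)
  then show "\<phi> (delta g) x = R g x" using g by (simp add: sum.delta)
qed

lemma phi_star: "\<phi> (a \<star> c) = \<phi> a \<circ> \<phi> c"
proof
  fix x
  have "\<phi> (a \<star> c) x = (\<Sum>\<sigma>\<in>Sym. \<Sum>h\<in>Sym. sT (a h * c (inv' h \<circ> \<sigma>)) (R \<sigma> x))"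
    by (simp add: phi_apply star_eval VT.scale_sum_left)
  also have "\<dots> = (\<Sum>h\<in>Sym. \<Sum>\<sigma>\<in>Sym. sT (a h * c (inv' h \<circ> \<sigma>)) (R \<sigma> x))"
    by (rule sum.swap)
  also have "\<dots> = (\<Sum>h\<in>Sym. \<Sum>\<sigma>\<in>Sym. sT (a h * c \<sigma>) (R (h \<circ> \<sigma>) x))"
  proof (rule sum.cong[OF refl])
    fix h assume h: "h \<in> Sym"
    show "(\<Sum>\<sigma>\<in>Sym. sT (a h * c (inv' h \<circ> \<sigma>)) (R \<sigma> x)) = (\<Sum>\<sigma>\<in>Sym. sT (a h * c \<sigma>) (R (h \<circ> \<sigma>) x))"
      by (rule sum.reindex_bij_witness[of _ "\<lambda>\<sigma>. h \<circ> \<sigma>" "\<lambda>\<sigma>. inv' h \<circ> \<sigma>"]) (use h in auto)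
  qed
  also have "\<dots> = (\<Sum>h\<in>Sym. sT (a h) (R h (\<Sum>\<sigma>\<in>Sym. sT (c \<sigma>) (R \<sigma> x))))"
  proof (rule sum.cong[OF refl])
    fix h assume h: "h \<in> Sym"
    interpret R: Vector_Spaces.linear sT sT "R h" by (rule R_props(1)[OF h])
    show "(\<Sum>\<sigma>\<in>Sym. sT (a h * c \<sigma>) (R (h \<circ> \<sigma>) x)) = sT (a h) (R h (\<Sum>\<sigma>\<in>Sym. sT (c \<sigma>) (R \<sigma> x)))"
      using h by (simp add: R.sum R.scale R_comp VT.scale_sum_right)
  qed
  finally show "\<phi> (a \<star> c) x = (\<phi> a \<circ> \<phi> c) x" by (simp add: phi_apply)
qed

lemma phi_one: "\<phi> (delta id) = id"
  by (simp add: phi_delta R_id)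


section \<open>The hook theorem\<close>

lemma phi_sum_apply: "\<phi> (\<Sum>i\<in>A. F i) x = (\<Sum>i\<in>A. \<phi> (F i) x)"
proof (induction A rule: infinite_finite_induct)
  case (insert i A)
  show ?case
    unfolding sum.insert[OF insert.hyps] phi_add by (simp only: plus_fun_apply insert.IH)
qed (simp_all only: sum.infinite sum.empty not_False_eq_True phi_zero, simp_all)

lemma phi_scale_apply: "\<phi> (c \<odot> a) x = sT c (\<phi> a x)"
  by (simp only: phi_scale) (simp add: fun_scale_def)

lemma phi_linear: "Vector_Spaces.linear sT sT (\<phi> a)"
  unfolding Vector_Spaces.linear_iff using vsT by (simp add: phi_lin)

text \<open>Besides the pair of the two positions itself, every position between them is inverted
  with both. As both are odd, these two factors agree and cancel.\<close>

lemma ks_transpose: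
  assumes p: "p \<in> N" "q \<in> N" "p \<noteq> q" and odd: "k \<le> w p" "k \<le> w q"
  shows "ks (transpose p q) w = - 1"
proof -
  have main: "ks (transpose p q) w = - 1"
    if p: "p \<in> N" "q \<in> N" "p < q" and odd: "k \<le> w p" "k \<le> w q" for p q
  proof -
    define M where "M = {m \<in> N. p < m \<and> m < q}"
    let ?s = "\<lambda>(i, j). if k \<le> w i \<and> k \<le> w j then - 1 else (1::complex)"
    have fin: "finite M" by (simp add: M_def)
    have "inversions (transpose p q) = insert (p, q) (Pair p ` M \<union> (\<lambda>m. (m, q)) ` M)"
      using p by (auto simp: inversions_def M_def transpose_def split: if_splits)
    then have "ks (transpose p q) w = ?s (p, q) * prod ?s (Pair p ` M \<union> (\<lambda>m. (m, q)) ` M)"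
      unfolding ks_def using fin by (simp only:) (subst prod.insert, auto simp: M_def)
    also have "prod ?s (Pair p ` M \<union> (\<lambda>m. (m, q)) ` M) = prod ?s (Pair p ` M) * prod ?s ((\<lambda>m. (m, q)) ` M)"
      by (rule prod.union_disjoint) (use fin in \<open>auto simp: M_def\<close>)
    also have "prod ?s (Pair p ` M) = (\<Prod>m\<in>M. if k \<le> w m then - 1 else 1)"
      by (subst prod.reindex) (use odd in \<open>auto simp: inj_on_def intro!: prod.cong\<close>)
    also have "prod ?s ((\<lambda>m. (m, q)) ` M) = (\<Prod>m\<in>M. if k \<le> w m then - 1 else 1)"
      by (subst prod.reindex) (use odd in \<open>auto simp: inj_on_def intro!: prod.cong\<close>)
    also have "(\<Prod>m\<in>M. if k \<le> w m then - 1 else (1::complex)) * (\<Prod>m\<in>M. if k \<le> w m then - 1 else 1) = 1"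
      unfolding prod.distrib[symmetric] by (rule prod.neutral) auto
    finally show ?thesis using odd by simp
  qed
  show ?thesis
  proof (cases "p < q")
    case False
    then have "q < p" using p by simp
    from main[OF p(2,1) this odd(2,1)] show ?thesis by (simp add: transpose_commute)
  qed (use main p odd in blast)
qed

text \<open>Two odd positions that stay in place are never inverted, and other pairs carry no
  sign.\<close>

lemma ks_fix_odd:
  assumes "\<And>i. i \<in> N \<Longrightarrow> k \<le> w i \<Longrightarrow> g i = i"
  shows "ks g w = 1"
  unfolding ks_def by (rule prod.neutral) (use assms in \<open>auto simp: inversions_def\<close>)

text \<open>Induction over transpositions of odd positions; the permutation built so far keeps the
  set of odd positions, so each further transposition again exchanges two odd letters.\<close>

lemma ks_odd_sign:
  assumes "g permutes {i \<in> N. k \<le> w i}"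
  shows "ks g w = of_int (sign g)"
proof -
  let ?O = "{i \<in> N. k \<le> w i}"
  have perm: "g \<in> Sym" if "g permutes ?O" for g
  proof -
    have "g permutes N" by (rule permutes_subset[OF that]) blast
    then show ?thesis by (simp add: Sym_def N_def)
  qed
  have "finite ?O" by simp
  from assms this show ?thesis
  proof (induction g rule: permutes_induct)
    case id
    then show ?case by (simp only: ks_id sign_id of_int_1)
  next
    case (swap a c p)
    have p: "p \<in> Sym" by (rule perm[OF swap.hyps(4)])
    have ac: "a \<in> N" "c \<in> N" "k \<le> w a" "k \<le> w c" using swap.hyps by auto
    have inv: "inv' p permutes ?O" by (rule permutes_inv[OF swap.hyps(4)])
    have "k \<le> w (inv' p a)" "k \<le> w (inv' p c)"
      using permutes_in_image[OF inv, of a] permutes_in_image[OF inv, of c] ac by auto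
    have "ks (transpose a c \<circ> p) w = ks p w * ks (transpose a c) (w \<circ> inv' p)"
      using ac p by (intro ks_comp transpose_Sym)
    also have "ks (transpose a c) (w \<circ> inv' p) = - 1"
      using ac swap.hyps(3) \<open>k \<le> w (inv' p a)\<close> \<open>k \<le> w (inv' p c)\<close> by (intro ks_transpose) simp_all
    finally have "ks (transpose a c \<circ> p) w = ks p w * - 1" .
    moreover have "sign (transpose a c \<circ> p) = - sign p"
      using swap.hyps(3)
      by (simp only: sign_compose[OF permutation_swap_id Sym_permutation[OF p]] sign_swap_id) simp
    ultimately show ?case by (simp only: swap.IH of_int_minus mult_minus_right mult_1_right)
  qed
qed

text \<open>The twist of \<open>rsym_delta_csym_zero\<close>.\<close>

lemma csym_delta_rsym_zero:
  assumes "g \<in> Sym" "x \<in> N" "y \<in> N" "x \<noteq> y" "h x = h y" "f (inv' g x) = f (inv' g y)"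
  shows "csym h \<star> delta g \<star> rsym f = 0"
proof -
  have "twist (rsym h \<star> delta g \<star> csym f) = 0"
    by (simp only: rsym_delta_csym_zero[OF assms] twist_zero)
  then have "of_int (sign g) \<odot> (csym h \<star> delta g \<star> rsym f) = 0"
    by (simp add: twist_star twist_delta csym_def)
  then show ?thesis by (simp add: sign_def split: if_splits)
qed

text \<open>Every row permutation sends two of the cells into the same column, by the pigeonhole
  principle.\<close>

lemma garnir:
  assumes tb: "tab \<mu> f h" and mu: "\<mu> (Suc i) \<le> \<mu> i"
    and A: "A \<subseteq> N" "\<And>x. x \<in> A \<Longrightarrow> f x = i \<or> f x = Suc i" "card A > \<mu> i"
    and c: "\<And>x y. x \<in> A \<Longrightarrow> y \<in> A \<Longrightarrow> c x = c y"
  shows "csym h \<star> rsym f \<star> rsym c = 0"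
proof -
  have z: "csym h \<star> delta p \<star> rsym c = 0" if p: "p \<in> stab f" for p
  proof -
    have pS: "p \<in> Sym" by (rule stab_Sym[OF p])
    have "h (p x) < \<mu> i" if x: "x \<in> A" for x
    proof -
      have "p x \<in> N" using Sym_image[OF pS] A(1) x by blast
      then have "h (p x) < \<mu> (f (p x))"
        using tb by (auto simp: tab_def bij_betw_def diagram_def)
      moreover have "f (p x) = i \<or> f (p x) = Suc i" using stab_app[OF p subsetD[OF A(1) x]] A(2)[OF x] by simp
      ultimately show ?thesis using mu by auto
    qed
    then have "(\<lambda>x. h (p x)) ` A \<subseteq> {..<\<mu> i}" by auto
    then have "card ((\<lambda>x. h (p x)) ` A) \<le> card {..<\<mu> i}" by (intro card_mono) simp_all
    then have "\<not> inj_on (\<lambda>x. h (p x)) A" using A(3) card_image[of "\<lambda>x. h (p x)" A] by auto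
    then obtain x y where xy: "x \<in> A" "y \<in> A" "x \<noteq> y" "h (p x) = h (p y)" by (auto simp: inj_on_def)
    have "x \<in> N" "y \<in> N" using xy(1,2) A(1) by blast+
    then have N: "p x \<in> N" "p y \<in> N" using Sym_image[OF pS] by simp_all
    have "p x \<noteq> p y" using Sym_inj_iff[OF pS] xy(3) by simp
    moreover have "c (inv' p (p x)) = c (inv' p (p y))" using c[OF xy(1,2)] pS by simp
    ultimately show ?thesis by (rule csym_delta_rsym_zero[OF pS N _ xy(4)])
  qed
  have "csym h \<star> rsym f \<star> rsym c = (\<Sum>p\<in>stab f. csym h \<star> delta p \<star> rsym c)"
    by (simp only: rsym_expand[of f] star_sum_right star_sum_left)
  also have "\<dots> = 0" by (rule sum.neutral) (use z in blast)
  finally show ?thesis .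
qed

lemma phi_star_delta_apply: "g \<in> Sym \<Longrightarrow> \<phi> (a \<star> delta g) x = \<phi> a (R g x)"
  by (simp add: phi_star phi_delta)

lemma VT_eq_neg_imp_zero: "x = - x \<Longrightarrow> x = 0" for x :: 't
proof -
  assume "x = - x"
  then have "x + x = x + - x" by (rule arg_cong)
  also have "\<dots> = 0" by (rule add.right_inverse)
  finally have "sT 2 x = 0" using VT.scale_left_distrib[of 1 1 x] by simp
  then show "x = 0" by simp
qed

text \<open>The involution \<open>\<kappa>\<close> swapping the equal even symbols fixes the word tensor without a sign, and
  \<open>\<sigma> \<circ> \<kappa>\<close> is a row permutation.\<close>

lemma exchange_equal_symbols:
  assumes s: "\<sigma> \<in> Sym" and UV: "U \<subseteq> N" "V \<subseteq> N" "U \<inter> V = {}" "card U = card V"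
    and rows: "\<And>x. x \<in> U \<Longrightarrow> f x = i \<and> f (\<sigma> x) = j" "\<And>x. x \<in> V \<Longrightarrow> f x = j \<and> f (\<sigma> x) = i"
    and rest: "\<And>x. x \<in> N \<Longrightarrow> x \<notin> U \<Longrightarrow> x \<notin> V \<Longrightarrow> f (\<sigma> x) = f x"
    and e: "e < k" "\<And>x. x \<in> U \<union> V \<Longrightarrow> w x = e" and w: "w \<in> Words"
  shows "\<phi> (z \<star> rsym f) (R \<sigma> (t w)) = \<phi> (z \<star> rsym f) (t w)"
proof -
  have fin: "finite U" "finite V" using UV finite_subset[OF _ finite_N] by auto
  obtain g where g: "bij_betw g U V" using finite_same_card_bij[OF fin UV(4)] by blast
  define g' where "g' = inv_into U g"
  have g': "bij_betw g' V U" unfolding g'_def by (rule bij_betw_inv_into[OF g])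
  have gg: "g' (g x) = x" if "x \<in> U" for x using that g by (simp add: g'_def bij_betw_def)
  have gg': "g (g' x) = x" if "x \<in> V" for x
    using that g by (simp add: g'_def bij_betw_def f_inv_into_f)
  have gU: "g x \<in> V" if "x \<in> U" for x using that g by (auto simp: bij_betw_def)
  have gV: "g' x \<in> U" if "x \<in> V" for x using that g' by (auto simp: bij_betw_def)
  define \<kappa> where "\<kappa> x = (if x \<in> U then g x else if x \<in> V then g' x else x)" for x
  have inv: "\<kappa> (\<kappa> x) = x" for x
    using gg[of x] gg'[of x] gU[of x] gV[of x] UV(3) by (auto simp: \<kappa>_def)
  have kk: "\<kappa> \<circ> \<kappa> = id" using inv by (simp add: fun_eq_iff)
  have "\<kappa> permutes N"
    unfolding permutes_def
  proof (intro conjI allI impI)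
    fix x assume "x \<notin> N" then show "\<kappa> x = x" using UV(1,2) by (auto simp: \<kappa>_def)
  next
    fix y show "\<exists>!x. \<kappa> x = y" by (rule ex1I[of _ "\<kappa> y"]) (use inv in auto)
  qed
  then have kS: "\<kappa> \<in> Sym" by (simp add: Sym_def N_def)
  have kinv: "inv' \<kappa> = \<kappa>" by (rule inv_unique_comp[OF kk kk])
  let ?p = "\<sigma> \<circ> \<kappa>"
  have p: "?p \<in> stab f"
  proof -
    have "f (\<sigma> (\<kappa> x)) = f x" if x: "x \<in> N" for x
    proof -
      consider "x \<in> U" | "x \<in> V" "x \<notin> U" | "x \<notin> U" "x \<notin> V" by blast
      then show ?thesis
      proof cases
        case 1
        then have "\<kappa> x \<in> V" using gU by (simp add: \<kappa>_def)
        then show ?thesis using rows 1 by simp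
      next
        case 2
        then have "\<kappa> x \<in> U" using gV by (simp add: \<kappa>_def)
        then show ?thesis using rows 2 by simp
      next
        case 3
        then show ?thesis using rest[OF x] by (simp add: \<kappa>_def)
      qed
    qed
    then show ?thesis using s kS by (simp add: stab_def)
  qed
  have wk: "w (\<kappa> x) = w x" for x
    using e(2) gU[of x] gV[of x] by (auto simp: \<kappa>_def)
  have "ks \<kappa> w = 1"
    by (rule ks_fix_odd) (use e in \<open>auto simp: \<kappa>_def\<close>)
  moreover have "w \<circ> \<kappa> = w" using wk by (simp add: fun_eq_iff)
  ultimately have Rk: "R \<kappa> (t w) = t w"
    using R_props(2)[OF kS w] by (simp add: kinv)
  have "\<sigma> = ?p \<circ> \<kappa>" by (simp add: comp_assoc kk)
  then have "R \<sigma> = R ?p \<circ> R \<kappa>" using R_comp[of ?p \<kappa>] s kS by simp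
  then have "R \<sigma> (t w) = R ?p (t w)" by (simp add: Rk)
  then have "\<phi> (z \<star> rsym f) (R \<sigma> (t w)) = \<phi> (z \<star> rsym f \<star> delta ?p) (t w)"
    using phi_star_delta_apply[of ?p] s kS by simp
  also have "z \<star> rsym f \<star> delta ?p = z \<star> rsym f"
    by (simp only: star_assoc rsym_star_delta[OF p])
  finally show ?thesis .
qed

text \<open>Induction on the weight \<open>\<Sum> f x * (k - w x)\<close>, which measures how far down the small even
  symbols lie (odd symbols contribute \<open>0\<close> by truncated subtraction). A Garnir relation either
  lowers the weight, or no row contains too many small even symbols; then row \<open>k\<close> holds only odd
  symbols, one of them twice.\<close>

lemma word_killed:
  assumes mu: "\<mu> \<in> Par" and tb: "tab \<mu> f h" and hook: "\<mu> k > l" and w: "w \<in> Words"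
  shows "\<phi> (csym h \<star> rsym f) (t w) = 0"
  using w
proof (induction "\<Sum>x\<in>N. f x * (k - w x)" arbitrary: w rule: less_induct)
  case (less w)
  let ?Z = "csym h \<star> rsym f"
  have anti: "antimono \<mu>" using mu by (simp add: partitions_of_def)
  have row: "card {x \<in> N. f x = i} = \<mu> i" for i
    using bij_betw_same_card[OF tab_row[OF tb, of i]] by simp
  show ?case
  proof (cases "\<exists>i e. e < k \<and> \<mu> i < card ({x \<in> N. f x = i \<and> e \<le> w x} \<union> {x \<in> N. f x = Suc i \<and> w x \<le> e})")
    case True
    then obtain i e where e: "e < k"
      and big: "\<mu> i < card ({x \<in> N. f x = i \<and> e \<le> w x} \<union> {x \<in> N. f x = Suc i \<and> w x \<le> e})" by blast
    define X where "X = {x \<in> N. f x = i \<and> e \<le> w x}"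
    define Y where "Y = {x \<in> N. f x = Suc i \<and> w x \<le> e}"
    \<comment> \<open>One common colour for the cells of \<open>X \<union> Y\<close> and a private
      one for every other position (\<open>Suc\<close> keeps them away from 0), so that
      \<open>stab c\<close> permutes exactly these cells.\<close>
    define c where "c x = (if x \<in> X \<union> Y then 0 else Suc x)" for x
    have XY: "X \<subseteq> N" "Y \<subseteq> N" "X \<inter> Y = {}" "finite X" "finite Y" by (auto simp: X_def Y_def)
    have "?Z \<star> rsym c = 0"
      by (rule garnir[OF tb, of i "X \<union> Y"])
        (use antimonoD[OF anti, of i "Suc i"] big in \<open>auto simp: c_def X_def Y_def\<close>)
    then have zero: "\<phi> (?Z \<star> rsym c) (t w) = 0" by (simp only: phi_zero zero_fun_apply)
    have step: "\<phi> ?Z (R \<sigma> (t w)) = \<phi> ?Z (t w) \<or> \<phi> ?Z (R \<sigma> (t w)) = 0" if s: "\<sigma> \<in> stab c" for \<sigma>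
    proof -
      have sS: "\<sigma> \<in> Sym" by (rule stab_Sym[OF s])
      have sfix: "\<sigma> x = x" if "x \<in> N" "x \<notin> X \<union> Y" for x
        using stab_app[OF s that(1)] that(2) by (auto simp: c_def split: if_splits)
      have sXY: "\<sigma> x \<in> X \<union> Y" if "x \<in> X \<union> Y" for x
        using stab_app[OF s, of x] that XY by (auto simp: c_def split: if_splits)
      \<comment> \<open>\<open>U\<close> collects the cells moved down from row \<open>i\<close> to
        the next row, \<open>V\<close> those moved up; other cells keep their row.\<close>
      define U where "U = {x \<in> X. \<sigma> x \<in> Y}"
      define V where "V = {x \<in> Y. \<sigma> x \<in> X}"
      have fU: "f x = i \<and> f (\<sigma> x) = Suc i" if "x \<in> U" for x using that by (auto simp: U_def X_def Y_def)
      have fV: "f x = Suc i \<and> f (\<sigma> x) = i" if "x \<in> V" for x using that by (auto simp: V_def X_def Y_def)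
      have frest: "f (\<sigma> x) = f x" if "x \<in> N" "x \<notin> U" "x \<notin> V" for x
      proof (cases "x \<in> X \<union> Y")
        case True
        then show ?thesis using sXY[OF True] that by (auto simp: U_def V_def X_def Y_def)
      qed (use sfix that in simp)
      have finUV: "finite U" "finite V" "U \<inter> V = {}" "U \<subseteq> N" "V \<subseteq> N"
        using XY by (auto simp: U_def V_def)
      have cUV: "card U = card V"
      proof -
        let ?Y' = "{x \<in> Y. \<sigma> x \<in> Y}"
        have "bij_betw \<sigma> (U \<union> ?Y') Y"
        proof (rule bij_betw_imageI)
          show "inj_on \<sigma> (U \<union> ?Y')" using Sym_inj_iff[OF sS] by (simp add: inj_on_def)
          show "\<sigma> ` (U \<union> ?Y') = Y"
          proof (intro equalityI subsetI)
            fix y assume y: "y \<in> Y"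
            let ?x = "inv' \<sigma> y"
            have xy: "\<sigma> ?x = y" using sS by simp
            have "?x \<in> N" using Sym_image[OF Sym_inv[OF sS]] y XY by blast
            have "?x \<in> X \<union> Y"
            proof (rule ccontr)
              assume "?x \<notin> X \<union> Y"
              moreover from this have "?x = y" using sfix[OF \<open>?x \<in> N\<close>] xy by simp
              ultimately show False using y by simp
            qed
            then have "?x \<in> U \<union> ?Y'" using xy y by (auto simp: U_def)
            then show "y \<in> \<sigma> ` (U \<union> ?Y')" by (rule image_eqI[of y \<sigma> ?x, OF xy[symmetric]])
          qed (auto simp: U_def)
        qed
        then have "card (U \<union> ?Y') = card Y" by (rule bij_betw_same_card)
        moreover have "card (U \<union> ?Y') = card U + card ?Y'"
          using XY by (intro card_Un_disjoint) (auto simp: U_def)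
        moreover have "Y = V \<union> ?Y'" using sXY by (auto simp: V_def)
        moreover have "card (V \<union> ?Y') = card V + card ?Y'"
          using XY by (intro card_Un_disjoint) (auto simp: V_def)
        ultimately show ?thesis by simp
      qed
      show ?thesis
      \<comment> \<open>Letters moving down are at least \<open>e\<close>, letters moving up at most
        \<open>e\<close>. If all equal \<open>e\<close>, the move can be undone by exchanging equal
        even letters; otherwise some inequality is strict and the weight drops.\<close>
      proof (cases "\<forall>x\<in>U \<union> V. w x = e")
        case True
        have "\<phi> ?Z (R \<sigma> (t w)) = \<phi> ?Z (t w)"
          by (rule exchange_equal_symbols[where f = f and i = i and j = "Suc i" and e = e and U = U and V = V])
            (use True in \<open>simp_all add: sS finUV cUV fU fV frest e less.prems\<close>)
        then show ?thesis by blast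
      next
        case False
        have wU: "e \<le> w x" if "x \<in> U" for x using that by (auto simp: U_def X_def)
        have wV: "w x \<le> e" if "x \<in> V" for x using that by (auto simp: V_def Y_def)
        have lU: "(\<Sum>x\<in>U. k - w x) \<le> card U * (k - e)"
          using sum_bounded_above[of U "\<lambda>x. k - w x" "k - e"] wU by (simp add: diff_le_mono2)
        have lV: "card V * (k - e) \<le> (\<Sum>x\<in>V. k - w x)"
          using sum_bounded_below[of V "k - e" "\<lambda>x. k - w x"] wV by (simp add: diff_le_mono2)
        have strict: "(\<Sum>x\<in>U. k - w x) < (\<Sum>x\<in>V. k - w x)"
        proof (cases "\<exists>x\<in>U. w x \<noteq> e")
          case True
          then obtain x where x: "x \<in> U" "e < w x" using wU by fastforce
          have "(\<Sum>x\<in>U. k - w x) < (\<Sum>x\<in>U. k - e)"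
            by (rule sum_strict_mono_ex1[OF finUV(1)]) (use wU x e in \<open>auto intro!: bexI[of _ x] diff_le_mono2\<close>)
          then show ?thesis using lV cUV by simp
        next
          case F: False
          then obtain x where x: "x \<in> V" "w x < e" using False wV by fastforce
          have "(\<Sum>x\<in>V. k - e) < (\<Sum>x\<in>V. k - w x)"
            by (rule sum_strict_mono_ex1[OF finUV(2)]) (use wV x e in \<open>auto intro!: bexI[of _ x] diff_le_mono2\<close>)
          then show ?thesis using lU cUV by simp
        qed
        let ?w = "w \<circ> inv' \<sigma>"
        have "(\<Sum>x\<in>N. f x * (k - ?w x)) = (\<Sum>x\<in>N. f (\<sigma> x) * (k - w x))"
          by (rule sum.reindex_bij_witness[of _ \<sigma> "inv' \<sigma>"])
            (use sS Sym_image[OF sS] Sym_image[OF Sym_inv[OF sS]] in auto)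
        moreover have "(\<Sum>x\<in>N. f (\<sigma> x) * (k - w x)) + (\<Sum>x\<in>V. k - w x)
          = (\<Sum>x\<in>N. f x * (k - w x)) + (\<Sum>x\<in>U. k - w x)"
        proof -
          have VN: "(\<Sum>x\<in>V. k - w x) = (\<Sum>x\<in>N. if x \<in> V then k - w x else 0)"
            using finUV by (simp add: sum.inter_restrict[symmetric] Int_absorb1)
          have UN: "(\<Sum>x\<in>U. k - w x) = (\<Sum>x\<in>N. if x \<in> U then k - w x else 0)"
            using finUV by (simp add: sum.inter_restrict[symmetric] Int_absorb1)
          show ?thesis
            unfolding VN UN sum.distrib[symmetric]
          proof (rule sum.cong[OF refl])
            fix x assume x: "x \<in> N"
            show "f (\<sigma> x) * (k - w x) + (if x \<in> V then k - w x else 0)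
              = f x * (k - w x) + (if x \<in> U then k - w x else 0)"
              using fU[of x] fV[of x] frest[OF x] finUV(3) by (cases "x \<in> U"; cases "x \<in> V") auto
          qed
        qed
        ultimately have "(\<Sum>x\<in>N. f x * (k - ?w x)) < (\<Sum>x\<in>N. f x * (k - w x))" using strict by linarith
        then have "\<phi> ?Z (t ?w) = 0"
          by (rule less.hyps) (rule word_comp[OF less.prems Sym_inv[OF sS]])
        then show ?thesis using R_props(2)[OF sS less.prems] by (simp add: phi_lin)
      qed
    qed
    \<comment> \<open>Each term is 0 or equal to the term of the identity, so the Garnir relation
      makes a positive multiple of the desired value vanish.\<close>
    have "\<phi> (?Z \<star> rsym c) (t w) = (\<Sum>\<sigma>\<in>stab c. \<phi> ?Z (R \<sigma> (t w)))"
      unfolding rsym_expand[of c] star_sum_right phi_sum_apply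
      by (intro sum.cong refl phi_star_delta_apply) (rule stab_Sym)
    also have "\<dots> = (\<Sum>\<sigma>\<in>stab c. sT (if \<phi> ?Z (R \<sigma> (t w)) = \<phi> ?Z (t w) then 1 else 0) (\<phi> ?Z (t w)))"
      by (rule sum.cong[OF refl]) (use step in auto)
    also have "\<dots> = sT (of_nat (card {\<sigma> \<in> stab c. \<phi> ?Z (R \<sigma> (t w)) = \<phi> ?Z (t w)})) (\<phi> ?Z (t w))"
      unfolding VT.scale_sum_left[symmetric] by (simp add: sum.If_cases Int_def)
    finally have "of_nat (card {\<sigma> \<in> stab c. \<phi> ?Z (R \<sigma> (t w)) = \<phi> ?Z (t w)}) = (0::complex) \<or> \<phi> ?Z (t w) = 0"
      using zero by simp
    moreover have nz: "card A \<noteq> 0" if "g \<in> A" "A \<subseteq> stab c" for g A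
      using that(1) finite_subset[OF that(2) finite_stab] by auto
    have "card {\<sigma> \<in> stab c. \<phi> ?Z (R \<sigma> (t w)) = \<phi> ?Z (t w)} \<noteq> 0"
      by (rule nz[of id]) (auto simp: R_id)
    ultimately show ?thesis by simp
  next
    case False
    \<comment> \<open>Where no Garnir relation applies, row \<open>i\<close> has too few letters
      from \<open>e\<close> on to exceed its length together with the letters up to \<open>e\<close>
      in the next row; the complement in row \<open>i\<close> gives the inequality.\<close>
    have le: "card {x \<in> N. f x = Suc i \<and> w x < Suc e} \<le> card {x \<in> N. f x = i \<and> w x < e}" if e: "e < k" for i e
    proof -
      let ?X = "{x \<in> N. f x = i \<and> e \<le> w x}" and ?Y = "{x \<in> N. f x = Suc i \<and> w x \<le> e}"
      have "card (?X \<union> ?Y) \<le> \<mu> i" using False e by (meson not_le)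
      moreover have "card (?X \<union> ?Y) = card ?X + card ?Y" by (rule card_Un_disjoint) auto
      moreover have "\<mu> i = card (?X \<union> {x \<in> N. f x = i \<and> w x < e})"
        unfolding row[symmetric] by (rule arg_cong[of _ _ card]) auto
      moreover have "card (?X \<union> {x \<in> N. f x = i \<and> w x < e}) = card ?X + card {x \<in> N. f x = i \<and> w x < e}"
        by (rule card_Un_disjoint) auto
      moreover have "?Y = {x \<in> N. f x = Suc i \<and> w x < Suc e}" by auto
      ultimately show ?thesis by simp
    qed
    \<comment> \<open>Descending one row raises the smallest possible letter by one, starting from
      the trivial bound in row 0; in row \<open>k\<close> all even letters are excluded.\<close>
    have "j \<le> k \<Longrightarrow> card {x \<in> N. f x = j \<and> w x < j} = 0" for j
    proof (induction j)
      case (Suc j)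
      show ?case
        using le[OF Suc_le_lessD[OF Suc.prems], of j] Suc.IH[OF Suc_leD[OF Suc.prems]] by linarith
    qed simp
    then have "card {x \<in> N. f x = k \<and> w x < k} = 0" by blast
    then have odd: "k \<le> w x" if "x \<in> N" "f x = k" for x using that by auto
    \<comment> \<open>Only \<open>l\<close> odd letters are available for more than \<open>l\<close>
      cells. Transposing two equal odd letters gives the sign -1, while the row symmetrizer absorbs
      the transposition without sign.\<close>
    have "w ` {x \<in> N. f x = k} \<subseteq> {k..<k + l}"
      using odd less.prems by (auto simp: Words_def)
    then have "card (w ` {x \<in> N. f x = k}) \<le> card {k..<k + l}" by (intro card_mono) simp_all
    then have "\<not> inj_on w {x \<in> N. f x = k}"
      using row[of k] hook card_image[of w "{x \<in> N. f x = k}"] by auto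
    then obtain p q where pq: "p \<in> N" "q \<in> N" "p \<noteq> q" "f p = k" "f q = k" "w p = w q"
      by (auto simp: inj_on_def)
    let ?T = "transpose p q"
    have T: "?T \<in> stab f" using pq by (intro transpose_stab) simp_all
    have TS: "?T \<in> Sym" by (rule stab_Sym[OF T])
    have "w \<circ> inv' ?T = w" using pq(6) by (auto simp: fun_eq_iff transpose_def)
    then have "R ?T (t w) = - t w"
      using R_props(2)[OF TS less.prems] ks_transpose[of p q w] pq odd by simp
    then have "\<phi> ?Z (R ?T (t w)) = - \<phi> ?Z (t w)"
      using phi_lin(2)[of ?Z "- 1" "t w"] by simp
    moreover have "\<phi> ?Z (R ?T (t w)) = \<phi> (?Z \<star> delta ?T) (t w)"
      by (simp only: phi_star_delta_apply[OF TS])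
    moreover have "?Z \<star> delta ?T = ?Z" by (simp only: star_assoc rsym_star_delta[OF T])
    ultimately show ?thesis using VT_eq_neg_imp_zero by metis
  qed
qed

section \<open>The kernel of the representation on the simple components\<close>

lemma tsid_kernel: "tsid Sym {x \<in> supp Sym. \<phi> x = 0}"
proof -
  have "(0::'t \<Rightarrow> 't) \<circ> F = 0" for F :: "'t \<Rightarrow> 't" by (simp add: fun_eq_iff)
  moreover have "\<phi> a \<circ> (0::'t \<Rightarrow> 't) = 0" for a by (simp add: fun_eq_iff phi_lin_zero)
  ultimately show ?thesis
    by (auto simp: tsid_def lsub_def supp_add phi_add phi_zero phi_star)
qed

text \<open>Word tensors are killed with the row symmetrizer acting first, that is by
  \<open>ba\<close> instead of \<open>ab\<close>. As the kernel is a two-sided ideal it contains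
  \<open>a(ba)b\<close>, a nonzero multiple of the Young symmetrizer.\<close>

lemma phi_I_comp_zero:
  assumes mu: "\<mu> \<in> Par" and hook: "\<mu> k > l" and x: "x \<in> I_comp n \<mu>"
  shows "\<phi> x = 0"
proof -
  let ?a = "rsym (row_of \<mu>)" and ?b = "csym (col_of \<mu>)"
  note tb = tab_canonical[OF mu]
  have zl: "Vector_Spaces.linear sT sT (0 :: 't \<Rightarrow> 't)"
    unfolding Vector_Spaces.linear_iff using vsT by simp
  have "\<phi> (?b \<star> ?a) = 0"
    by (rule linear_eq_on_words[OF phi_linear zl]) (simp add: word_killed[OF mu tb hook])
  then have ba: "?b \<star> ?a \<in> {x \<in> supp Sym. \<phi> x = 0}" by simp
  obtain s where s: "s \<noteq> 0" "?a \<star> ?b \<star> (?a \<star> ?b) = s \<odot> (?a \<star> ?b)"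
    using rsym_csym_rsym_csym[OF tb] by metis
  have "?a \<star> (?b \<star> ?a) \<star> ?b \<in> {x \<in> supp Sym. \<phi> x = 0}"
    by (rule tsid_lrmult[OF tsid_kernel ba]) simp_all
  then have "s \<odot> (?a \<star> ?b) \<in> {x \<in> supp Sym. \<phi> x = 0}"
    unfolding s(2)[symmetric] by (simp only: star_assoc)
  then have "(1 / s) \<odot> (s \<odot> (?a \<star> ?b)) \<in> {x \<in> supp Sym. \<phi> x = 0}"
    by (rule FV.subspace_scale[OF tsid_subspace(1)[OF subgrp_Sym tsid_kernel]])
  then have "?a \<star> ?b \<in> {x \<in> supp Sym. \<phi> x = 0}" using s(1) by simp
  then have "I_comp n \<mu> \<subseteq> {x \<in> supp Sym. \<phi> x = 0}"
    unfolding I_comp_eq[OF mu tb] by (rule gen_subset[OF tsid_kernel])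
  then show ?thesis using x by blast
qed

text \<open>The coefficient of \<open>t v\<close> in the image of \<open>t v\<close> counts the
  pairs of a row permutation \<open>p\<close> and a column permutation \<open>q\<close> whose
  composite fixes the word \<open>v\<close>. For such pairs \<open>q\<close> moves only odd letters
  and \<open>p\<close> moves none, so the Koszul sign equals \<open>sign q\<close> and cancels the
  sign in \<open>csym h\<close>. Every pair contributes 1, the identity pair included.\<close>

lemma young_symmetrizer_acts:
  assumes mu: "\<mu> \<in> Par" and tb: "tab \<mu> f h" and hook: "\<mu> k \<le> l"
  shows "\<phi> (rsym f \<star> csym h) \<noteq> 0"
proof
  assume zero: "\<phi> (rsym f \<star> csym h) = 0"
  have anti: "antimono \<mu>" using mu by (simp add: partitions_of_def)
  \<comment> \<open>An even letter remembers the row of its cell, an odd letter the column. Below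
    row \<open>k\<close> the columns are smaller than \<open>l\<close>, so the letters stay below
    \<open>k + l\<close>.\<close>
  define v where "v x = (if x \<in> N then if f x < k then f x else k + h x else 0)" for x
  have cell: "h x < \<mu> (f x)" if "x \<in> N" for x
    using tb that by (auto simp: tab_def bij_betw_def diagram_def)
  have v: "v \<in> Words"
  proof -
    have "v x < k + l" if x: "x \<in> N" for x
    proof (cases "f x < k")
      case False
      then have "\<mu> (f x) \<le> \<mu> k" using antimonoD[OF anti, of k "f x"] by simp
      then show ?thesis using cell[OF x] hook x by (simp add: v_def)
    qed (use x in \<open>simp add: v_def\<close>)
    then show ?thesis by (simp add: Words_def v_def)
  qed
  obtain g where g: "Vector_Spaces.linear sT (*) g" "\<forall>w'\<in>Words. g (t w') = (if w' = v then 1 else (0::complex))"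
    using word_functional[OF v] by blast
  interpret g: Vector_Spaces.linear sT "(*)" g by (rule g(1))
  have vk: "k \<le> v x \<longleftrightarrow> k \<le> f x" if "x \<in> N" for x using that by (simp add: v_def)
  have coeff: "of_int (sign q) * g (R (p \<circ> q) (t v)) = (if v \<circ> inv' (p \<circ> q) = v then 1 else 0)"
    if p: "p \<in> stab f" and q: "q \<in> stab h" for p q
  proof -
    have pS: "p \<in> Sym" and qS: "q \<in> Sym" using stab_Sym[OF p] stab_Sym[OF q] by auto
    have pqS: "p \<circ> q \<in> Sym" using pS qS by simp
    have "g (R (p \<circ> q) (t v)) = ks (p \<circ> q) v * (if v \<circ> inv' (p \<circ> q) = v then 1 else 0)"
      using R_props(2)[OF pqS v] g(2) word_comp[OF v Sym_inv[OF pqS]] by (simp add: g.scale)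
    moreover have "of_int (sign q) * ks (p \<circ> q) v = 1" if eq: "v \<circ> inv' (p \<circ> q) = v"
    proof -
      have vpq: "v (p (q x)) = v x" for x
        using fun_cong[OF eq, of "p (q x)"] pqS Sym_cancel_app(1)[OF pqS, of x] by simp
      have tinj: "x = y" if "x \<in> N" "y \<in> N" "f x = f y" "h x = h y" for x y
        using inj_onD[OF tab_inj[OF tb], of x y] that by simp
      have inN: "q x \<in> N" "p (q x) \<in> N" if "x \<in> N" for x
        using Sym_image[OF qS that] Sym_image[OF pS] by auto
      \<comment> \<open>The even letter shows that the row survives \<open>p \<circ> q\<close>,
        hence also \<open>q\<close>, while \<open>q\<close> preserves the column; so the cell is
        fixed.\<close>
      have qfix: "q x = x" if x: "x \<in> N" "f x < k" for x
      proof -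
        have "f (p (q x)) = f x"
          using vpq[of x] x inN[OF x(1)] by (auto simp: v_def split: if_splits)
        then have "f (q x) = f x" using stab_app[OF p inN(1)[OF x(1)]] by simp
        then show ?thesis using tinj[OF inN(1)[OF x(1)] x(1)] stab_app[OF q x(1)] by simp
      qed
      \<comment> \<open>The odd letter shows that the column survives \<open>p \<circ> q\<close>,
        hence \<open>p\<close> preserves the column of \<open>q x\<close> as well as its
        row.\<close>
      have pfix: "p (q x) = q x" if x: "x \<in> N" "k \<le> f x" for x
      proof -
        have "h (p (q x)) = h x"
          using vpq[of x] x inN[OF x(1)] by (auto simp: v_def split: if_splits)
        then have "h (p (q x)) = h (q x)" using stab_app[OF q x(1)] by simp
        then show ?thesis using tinj[OF inN(2)[OF x(1)] inN(1)[OF x(1)]] stab_app[OF p inN(1)[OF x(1)]] by simp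
      qed
      have qodd: "q permutes {i \<in> N. k \<le> v i}"
        unfolding permutes_def
      proof (intro conjI allI impI)
        fix x assume "x \<notin> {i \<in> N. k \<le> v i}"
        then show "q x = x"
          using qfix[of x] vk[of x] qS permutes_not_in[of q N x] by (cases "x \<in> N") (auto simp: Sym_def N_def)
      next
        fix y show "\<exists>!x. q x = y"
          by (rule ex1I[of _ "inv' q y"]) (use qS in auto)
      qed
      have "ks p (v \<circ> inv' q) = 1"
      proof (rule ks_fix_odd)
        fix y assume y: "y \<in> N" "k \<le> (v \<circ> inv' q) y"
        let ?x = "inv' q y"
        have "?x \<in> N" "k \<le> f ?x" using y Sym_image[OF Sym_inv[OF qS]] vk by auto
        from pfix[OF this] show "p y = y" using qS by simp
      qed
      then have "ks (p \<circ> q) v = of_int (sign q)"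
        using ks_comp[OF pS qS] ks_odd_sign[OF qodd] by simp
      moreover have "complex_of_int (sign q) * of_int (sign q) = 1"
        by (simp add: sign_def)
      ultimately show ?thesis by simp
    qed
    ultimately show ?thesis by (simp add: mult.assoc[symmetric])
  qed
  let ?S = "{(p, q). p \<in> stab f \<and> q \<in> stab h \<and> v \<circ> inv' (p \<circ> q) = v}"
  have "\<phi> (rsym f \<star> csym h) (t v) = (\<Sum>p\<in>stab f. \<Sum>q\<in>stab h. sT (of_int (sign q)) (R (p \<circ> q) (t v)))"
    unfolding rsym_expand csym_expand star_sum_left phi_sum_apply
    unfolding star_sum_right phi_sum_apply
  proof (intro sum.cong refl)
    fix p q assume "p \<in> stab f" "q \<in> stab h"
    then have S: "p \<in> Sym" "q \<in> Sym" using stab_Sym by blast+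
    then show "\<phi> (delta p \<star> of_int (sign q) \<odot> delta q) (t v) = sT (of_int (sign q)) (R (p \<circ> q) (t v))"
      by (simp add: phi_scale_apply delta_star_delta phi_delta)
  qed
  then have "0 = g (\<Sum>p\<in>stab f. \<Sum>q\<in>stab h. sT (of_int (sign q)) (R (p \<circ> q) (t v)))"
    using zero by (simp add: g.zero)
  also have "\<dots> = (\<Sum>p\<in>stab f. \<Sum>q\<in>stab h. if v \<circ> inv' (p \<circ> q) = v then 1 else 0)"
    unfolding g.sum g.scale by (intro sum.cong refl coeff)
  also have "\<dots> = (\<Sum>(p, q)\<in>stab f \<times> stab h. if v \<circ> inv' (p \<circ> q) = v then 1 else 0)"
    by (rule sum.cartesian_product)
  also have "\<dots> = of_nat (card ((stab f \<times> stab h) \<inter> {(p, q). v \<circ> inv' (p \<circ> q) = v}))"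
    by (simp add: case_prod_unfold sum.If_cases)
  finally have "card ((stab f \<times> stab h) \<inter> {(p, q). v \<circ> inv' (p \<circ> q) = v}) = 0" by simp
  moreover have "(id, id) \<in> (stab f \<times> stab h) \<inter> {(p, q). v \<circ> inv' (p \<circ> q) = v}" by simp
  ultimately show False by (auto simp: card_eq_0_iff)
qed

text \<open>The kernel meets the minimal ideal in an ideal; if this were nonzero it would contain
  the Young symmetrizer, which acts nontrivially.\<close>

lemma phi_I_comp_inj:
  assumes mu: "\<mu> \<in> Par" and hook: "\<mu> k \<le> l" and x: "x \<in> I_comp n \<mu>" "\<phi> x = 0"
  shows "x = 0"
proof (rule ccontr)
  assume nz: "x \<noteq> 0"
  note tb = tab_canonical[OF mu]
  let ?c = "rsym (row_of \<mu>) \<star> csym (col_of \<mu>)"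
  have "tsid Sym ({x \<in> supp Sym. \<phi> x = 0} \<inter> I_comp n \<mu>)"
    by (rule tsid_Int[OF tsid_kernel I_comp_tsid[OF mu]])
  moreover have "x \<in> {x \<in> supp Sym. \<phi> x = 0} \<inter> I_comp n \<mu>"
    using x tsid_supp[OF I_comp_tsid[OF mu]] by simp
  ultimately have "{x \<in> supp Sym. \<phi> x = 0} \<inter> I_comp n \<mu> = I_comp n \<mu>"
    using I_comp_minimal[OF mu] nz unfolding minimal_among_def by blast
  moreover have "?c \<in> I_comp n \<mu>" unfolding I_comp_eq[OF mu tb] by (rule gen_base) simp
  ultimately have "\<phi> ?c = 0" by blast
  then show False using young_symmetrizer_acts[OF mu tb hook] by contradiction
qed


section \<open>Decomposition of the image algebras and their centralizers\<close>

sublocale FW: vector_space "fun_scale sT"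
  by (rule vector_space_fun_scale[OF vsT])

abbreviation H0 where "H0 \<equiv> hook0 k l n"
abbreviation H1 where "H1 \<equiv> hook1 k l n"

text \<open>For a set of partitions this is the sum of their components; the idempotent equation
  replaces explicit sums of ideal elements.\<close>

definition comp_space :: "(nat \<Rightarrow> nat) set \<Rightarrow> ((nat \<Rightarrow> nat) \<Rightarrow> complex) set" where
  "comp_space X = {x \<in> supp Sym. esum X \<star> x = x}"

lemma H_subset: "H0 \<subseteq> Par" "H1 \<subseteq> Par"
  by (auto simp: hook0_def hook1_def hook_def)

lemma H_disjoint: "H0 \<inter> H1 = {}"
  by (auto simp: hook1_def)

lemma H0_conj: "conjugate ` H0 = H0"
proof -
  have "conjugate \<mu> \<in> H0 \<and> conjugate (conjugate \<mu>) = \<mu>" if "\<mu> \<in> H0" for \<mu>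
  proof -
    have "\<mu> \<in> Par" using that H_subset by blast
    then have "conjugate (conjugate \<mu>) = \<mu>" by (rule conjugate_conjugate)
    then show ?thesis using that by (simp add: hook0_def)
  qed
  then show ?thesis by (metis image_eqI image_subsetI subsetI subset_antisym)
qed

lemma H1_conj: "\<mu> \<in> H1 \<Longrightarrow> conjugate \<mu> \<in> Par \<and> conjugate \<mu> k > l"
  using conjugate_partition(1)[of \<mu> n] by (auto simp: hook1_def hook0_def hook_def)

lemma H_hook: "\<mu> \<in> H0 \<Longrightarrow> \<mu> k \<le> l" "\<mu> \<in> H1 \<Longrightarrow> \<mu> k \<le> l"
  by (auto simp: hook0_def hook1_def hook_def)

lemma phi_esum_zero:
  assumes "X \<subseteq> Par" "\<And>\<mu>. \<mu> \<in> X \<Longrightarrow> \<mu> k > l"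
  shows "\<phi> (esum X) = 0"
proof
  fix x
  have "\<phi> (eid \<mu>) x = 0" if "\<mu> \<in> X" for \<mu>
    using phi_I_comp_zero[of \<mu> "eid \<mu>"] eid(1)[of \<mu>] assms that by (simp add: subset_iff)
  then show "\<phi> (esum X) x = 0 x"
    unfolding esum_def phi_sum_apply by simp
qed

text \<open>All idempotents sum to 1, and those of partitions outside the hook act as 0.\<close>

lemma phi_E_sum: "\<phi> (esum H0) x + \<phi> (esum H1) x = x"
proof -
  let ?X = "Par - (H0 \<union> H1)"
  have "Par = H0 \<union> H1 \<union> ?X" using H_subset by blast
  then have "esum Par = esum (H0 \<union> H1 \<union> ?X)" by (rule arg_cong)
  also have "\<dots> = esum H0 + esum H1 + esum ?X"
    using H_subset H_disjoint by (subst esum_Un, auto)+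
  finally have "\<phi> (delta id) = \<phi> (esum H0) + \<phi> (esum H1) + \<phi> (esum ?X)"
    unfolding esum_Par by (simp only: phi_add)
  moreover have "\<phi> (esum ?X) = 0"
    by (rule phi_esum_zero) (auto simp: hook1_def hook0_def hook_def)
  ultimately have "id x = (\<phi> (esum H0) + \<phi> (esum H1)) x"
    unfolding phi_one by (simp only: add_0_right)
  then show ?thesis by simp
qed

lemma phi_star_apply: "\<phi> (a \<star> c) x = \<phi> a (\<phi> c x)"
  by (simp add: phi_star)

lemma phi_split: "\<phi> x = \<phi> (esum H0 \<star> x) + \<phi> (esum H1 \<star> x)"
  by (rule ext) (simp add: phi_star_apply phi_E_sum)

lemma E01: "esum H0 \<star> esum H1 = 0" "esum H1 \<star> esum H0 = 0"
  "esum H0 \<star> esum H0 = esum H0" "esum H1 \<star> esum H1 = esum H1"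
  using H_subset H_disjoint by (simp_all add: esum_mult Int_commute) (simp_all add: esum_def)

lemma comp_space_image: "X \<subseteq> Par \<Longrightarrow> x \<in> supp Sym \<Longrightarrow> esum X \<star> x \<in> comp_space X"
  using esum_mult[of X X] by (simp add: comp_space_def star_assoc[symmetric])

lemma comp_space_subspace: "FV.subspace (comp_space X)"
  using supp_subspace[of Sym]
  by (auto simp: comp_space_def FV.subspace_def star_add_right)

lemma phi_subspace:
  assumes "FV.subspace M" shows "FW.subspace (\<phi> ` M)"
  unfolding FW.subspace_def
proof (intro conjI ballI allI)
  show "0 \<in> \<phi> ` M" using FV.subspace_0[OF assms] phi_zero by (metis image_eqI)
next
  fix f g assume "f \<in> \<phi> ` M" "g \<in> \<phi> ` M"
  then obtain x y where "x \<in> M" "y \<in> M" "f = \<phi> x" "g = \<phi> y" by blast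
  then have "f + g = \<phi> (x + y)" "x + y \<in> M" using FV.subspace_add[OF assms] by (simp_all only: phi_add)
  then show "f + g \<in> \<phi> ` M" by (metis image_eqI)
next
  fix c f assume "f \<in> \<phi> ` M"
  then obtain x where "x \<in> M" "f = \<phi> x" by blast
  then have "fun_scale sT c f = \<phi> (c \<odot> x)" "c \<odot> x \<in> M" using FV.subspace_scale[OF assms] by (simp_all only: phi_scale)
  then show "fun_scale sT c f \<in> \<phi> ` M" by (metis image_eqI)
qed

lemma phi_esum_star: "\<phi> (esum X \<star> x) = (\<Sum>\<mu>\<in>X. \<phi> (eid \<mu> \<star> x))"
proof
  fix y
  have "(\<Sum>\<mu>\<in>X. \<phi> (eid \<mu> \<star> x)) y = (\<Sum>\<mu>\<in>X. \<phi> (eid \<mu> \<star> x) y)"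
    by (induction X rule: infinite_finite_induct) simp_all
  then show "\<phi> (esum X \<star> x) y = (\<Sum>\<mu>\<in>X. \<phi> (eid \<mu> \<star> x)) y"
    unfolding esum_def star_sum_left phi_sum_apply by simp
qed

text \<open>An element fixed by \<open>esum X\<close> is the sum of its products with the
  idempotents \<open>eid \<mu>\<close>, each of which lies in one component.\<close>

lemma sum_of_components:
  assumes X: "X \<subseteq> Par"
  shows "sum_of_subspaces (fun_scale sT) ((\<lambda>\<mu>. \<phi> ` I_comp n \<mu>) ` X) = \<phi> ` comp_space X"
  unfolding sum_of_subspaces_def
proof (rule subset_antisym)
  show "FW.span (\<Union>((\<lambda>\<mu>. \<phi> ` I_comp n \<mu>) ` X)) \<subseteq> \<phi> ` comp_space X"
  proof (rule FW.span_minimal[OF _ phi_subspace[OF comp_space_subspace]], clarify)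
    fix \<mu> x assume mu: "\<mu> \<in> X" and x: "x \<in> I_comp n \<mu>"
    have "x \<in> comp_space X"
      using esum_I_comp[OF X mu x] tsid_supp[OF I_comp_tsid x] mu X by (auto simp: comp_space_def)
    then show "\<phi> x \<in> \<phi> ` comp_space X" by (rule imageI)
  qed
  show "\<phi> ` comp_space X \<subseteq> FW.span (\<Union>((\<lambda>\<mu>. \<phi> ` I_comp n \<mu>) ` X))"
  proof clarify
    fix x assume "x \<in> comp_space X"
    then have x: "x \<in> supp Sym" "esum X \<star> x = x" by (auto simp: comp_space_def)
    have "\<phi> (esum X \<star> x) \<in> FW.span (\<Union>((\<lambda>\<mu>. \<phi> ` I_comp n \<mu>) ` X))"
      unfolding phi_esum_star
    proof (intro FW.span_sum FW.span_base)
      fix \<mu> assume mu: "\<mu> \<in> X"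
      then have "eid \<mu> \<star> x \<in> I_comp n \<mu>"
        using tsid_rmult[OF I_comp_tsid eid(1) x(1)] X by blast
      then show "\<phi> (eid \<mu> \<star> x) \<in> \<Union>((\<lambda>\<mu>. \<phi> ` I_comp n \<mu>) ` X)" using mu by blast
    qed
    then show "\<phi> x \<in> FW.span (\<Union>((\<lambda>\<mu>. \<phi> ` I_comp n \<mu>) ` X))" by (simp only: x(2))
  qed
qed

abbreviation "PP \<equiv> \<phi> ` comp_space H0"
abbreviation "QQ \<equiv> \<phi> ` comp_space H1"
abbreviation "PP' \<equiv> \<phi> ` (comp_space H0 \<inter> supp Alt)"

lemma J_bar_H0: "J_bar n H0 = comp_space H0 \<inter> supp Alt"
proof -
  have "conj_closure H0 = H0" by (simp add: conj_closure_def H0_conj)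
  then show ?thesis
    using J_bar_eq[OF H_subset(1)] supp_Alt_Sym by (auto simp: comp_space_def)
qed

lemma E0_Alt: "esum H0 \<in> supp Alt"
  using esum_conj_closure_Alt[OF H_subset(1)] by (simp add: conj_closure_def H0_conj)

lemma J_bar_H1: "\<phi> ` J_bar n H1 = QQ"
proof -
  let ?C = "conjugate ` H1"
  have C: "?C \<subseteq> Par" "\<And>\<mu>. \<mu> \<in> ?C \<Longrightarrow> \<mu> k > l" using H1_conj by auto
  \<comment> \<open>A conjugate of a partition in \<open>H1\<close> falls outside the hook, so it
    cannot be in \<open>H1\<close>.\<close>
  have disj: "H1 \<inter> ?C = {}" using C(2) H_hook(2) by fastforce
  have cc: "conj_closure H1 = H1 \<union> ?C" "conj_closure H1 \<subseteq> Par"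
    using H_subset(2) C(1) by (auto simp: conj_closure_def)
  have E: "esum (conj_closure H1) = esum H1 + esum ?C"
    unfolding cc(1) by (rule esum_Un[OF H_subset(2) C(1) disj])
  have "\<phi> (esum ?C) = 0" by (rule phi_esum_zero) (use C in blast)+
  then have zero: "\<phi> (esum ?C \<star> x) = 0" for x
    by (intro ext) (simp add: phi_star_apply)
  show ?thesis
  proof (rule subset_antisym)
    show "\<phi> ` J_bar n H1 \<subseteq> QQ"
    proof clarify
      fix x assume "x \<in> J_bar n H1"
      then have x: "x \<in> supp Sym" "esum (conj_closure H1) \<star> x = x"
        using J_bar_eq[OF H_subset(2)] supp_Alt_Sym by auto
      have "\<phi> x = \<phi> (esum H1 \<star> x + esum ?C \<star> x)"
        using x(2) unfolding E star_add_left by simp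
      then have "\<phi> x = \<phi> (esum H1 \<star> x)" by (simp only: phi_add zero add_0_right)
      then show "\<phi> x \<in> QQ" using comp_space_image[OF H_subset(2) x(1)] by (metis image_eqI)
    qed
    show "QQ \<subseteq> \<phi> ` J_bar n H1"
    proof clarify
      fix x assume "x \<in> comp_space H1"
      then have x: "x \<in> supp Sym" "esum H1 \<star> x = x" by (auto simp: comp_space_def)
      have tx: "twist x = esum ?C \<star> twist x"
        using arg_cong[OF x(2), of twist] by (simp add: twist_star twist_esum[OF H_subset(2)])
      \<comment> \<open>The symmetrization is even, and the added term lives in components that act
        as 0, so the image does not change.\<close>
      let ?y = "x + twist x"
      have "twist ?y = ?y" by (simp only: twist_add twist_twist add.commute)
      then have yA: "?y \<in> supp Alt" using x(1) by (simp add: supp_Alt_iff supp_add)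
      have "esum (conj_closure H1) \<star> esum H1 = esum H1" "esum (conj_closure H1) \<star> esum ?C = esum ?C"
        using cc C(1) H_subset(2) by (simp_all add: esum_mult Int_absorb1)
      then have "esum (conj_closure H1) \<star> (esum H1 \<star> x) = esum H1 \<star> x"
        "esum (conj_closure H1) \<star> (esum ?C \<star> twist x) = esum ?C \<star> twist x"
        by (simp_all only: star_assoc[symmetric])
      then have "esum (conj_closure H1) \<star> ?y = ?y"
        unfolding star_add_right by (simp only: x(2) tx[symmetric])
      then have "?y \<in> J_bar n H1" using yA J_bar_eq[OF H_subset(2)] by blast
      moreover have "\<phi> ?y = \<phi> x"
        unfolding phi_add by (subst tx) (simp only: zero add_0_right)
      ultimately show "\<phi> x \<in> \<phi> ` J_bar n H1" by (metis image_eqI)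
    qed
  qed
qed

text \<open>An element of the kernel is split by the idempotents into parts that lie in single
  components and still act as 0; on each component the action is faithful.\<close>

lemma phi_inj_H0: "inj_on \<phi> (comp_space H0)"
proof -
  have ker: "x = 0" if "x \<in> comp_space H0" "\<phi> x = 0" for x
  proof -
    have x: "x \<in> supp Sym" "esum H0 \<star> x = x" using that(1) by (auto simp: comp_space_def)
    have "eid \<mu> \<star> x = 0" if mu: "\<mu> \<in> H0" for \<mu>
    proof (rule phi_I_comp_inj)
      show P: "\<mu> \<in> Par" using mu H_subset by blast
      show "\<mu> k \<le> l" by (rule H_hook(1)[OF mu])
      show "eid \<mu> \<star> x \<in> I_comp n \<mu>" by (rule tsid_rmult[OF I_comp_tsid[OF P] eid(1)[OF P] x(1)])
      show "\<phi> (eid \<mu> \<star> x) = 0" by (rule ext) (simp add: phi_star_apply \<open>\<phi> x = 0\<close> phi_lin_zero)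
    qed
    then have "esum H0 \<star> x = 0" unfolding esum_def star_sum_left by (intro sum.neutral) blast
    then show ?thesis using x(2) by simp
  qed
  show ?thesis
  proof (rule inj_onI)
    fix x y assume xy: "x \<in> comp_space H0" "y \<in> comp_space H0" "\<phi> x = \<phi> y"
    have "\<phi> (x - y) = 0" using xy(3) by (simp only: phi_diff diff_self)
    then have "x - y = 0" using ker FV.subspace_diff[OF comp_space_subspace xy(1,2)] by blast
    then show "x = y" by simp
  qed
qed

lemma PQ_int: "PP \<inter> QQ = {0}"
proof -
  have "f = 0" if "f \<in> PP" "f \<in> QQ" for f
  proof -
    obtain x where x: "f = \<phi> x" "x \<in> comp_space H0" using \<open>f \<in> PP\<close> by (rule imageE)
    obtain y where y: "f = \<phi> y" "y \<in> comp_space H1" using \<open>f \<in> QQ\<close> by (rule imageE)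
    note x = x(1) x(2)[unfolded comp_space_def, THEN CollectD, THEN conjunct2]
    note y = y(1) y(2)[unfolded comp_space_def, THEN CollectD, THEN conjunct2]
    have "f = \<phi> (esum H0 \<star> x)" by (simp only: x)
    also have "\<dots> = \<phi> (esum H0) \<circ> f" by (simp only: phi_star x(1))
    also have "\<dots> = \<phi> (esum H0 \<star> (esum H1 \<star> y))" by (simp only: phi_star[of "esum H0"] y)
    also have "\<dots> = 0" by (simp only: star_assoc[symmetric] E01 star_zero phi_zero)
    finally show ?thesis .
  qed
  moreover have "0 \<in> PP" "0 \<in> QQ"
    using FW.subspace_0[OF phi_subspace[OF comp_space_subspace]] by blast+
  ultimately show ?thesis by blast
qed

lemma direct_sum_S: "direct_sum_of (fun_scale sT) (\<phi> ` supp Sym) PP QQ"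
  unfolding direct_sum_of_def
proof (intro conjI)
  show "\<phi> ` supp Sym = {a + b |a b. a \<in> PP \<and> b \<in> QQ}"
  proof (rule subset_antisym)
    show "\<phi> ` supp Sym \<subseteq> {a + b |a b. a \<in> PP \<and> b \<in> QQ}"
      using phi_split comp_space_image[OF H_subset(1)] comp_space_image[OF H_subset(2)] by blast
    show "{a + b |a b. a \<in> PP \<and> b \<in> QQ} \<subseteq> \<phi> ` supp Sym"
    proof clarify
      fix x y assume "x \<in> comp_space H0" "y \<in> comp_space H1"
      then have "x + y \<in> supp Sym" by (simp add: comp_space_def supp_add)
      then show "\<phi> x + \<phi> y \<in> \<phi> ` supp Sym" unfolding phi_add[symmetric] by (rule imageI)
    qed
  qed
qed (use PQ_int phi_subspace[OF comp_space_subspace] in auto)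

lemma Alt_part_subspace: "FV.subspace (comp_space H0 \<inter> supp Alt)"
  by (rule FV.subspace_inter[OF comp_space_subspace supp_subspace])

text \<open>The idempotent of \<open>H0\<close> is even, so cutting with it stays in the even
  algebra. That of \<open>H1\<close> need not be even; for its half, the even preimages from
  \<open>J_bar_H1\<close> are used.\<close>

lemma direct_sum_A: "direct_sum_of (fun_scale sT) (\<phi> ` supp Alt) PP' QQ"
  unfolding direct_sum_of_def
proof (intro conjI)
  show "FW.subspace PP'" by (rule phi_subspace[OF Alt_part_subspace])
  then have "0 \<in> PP'" by (rule FW.subspace_0)
  then show "PP' \<inter> QQ = {0}" using PQ_int by blast
  show "\<phi> ` supp Alt = {a + b |a b. a \<in> PP' \<and> b \<in> QQ}"
  proof (rule subset_antisym)
    show "\<phi> ` supp Alt \<subseteq> {a + b |a b. a \<in> PP' \<and> b \<in> QQ}"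
    proof clarify
      fix x assume x: "x \<in> supp Alt"
      then have xS: "x \<in> supp Sym" using supp_Alt_Sym by blast
      have "esum H0 \<star> x \<in> comp_space H0 \<inter> supp Alt"
        using comp_space_image[OF H_subset(1) xS] supp_star[OF subgrp_Alt E0_Alt x] by blast
      then show "\<exists>a b. \<phi> x = a + b \<and> a \<in> PP' \<and> b \<in> QQ"
        using phi_split[of x] comp_space_image[OF H_subset(2) xS] by blast
    qed
    show "{a + b |a b. a \<in> PP' \<and> b \<in> QQ} \<subseteq> \<phi> ` supp Alt"
    proof clarify
      fix x y assume x: "x \<in> supp Alt" and y: "y \<in> comp_space H1"
      obtain z where z: "z \<in> J_bar n H1" "\<phi> y = \<phi> z" using J_bar_H1 y by blast
      then have "x + z \<in> supp Alt" using x J_bar_eq[OF H_subset(2)] by (simp add: supp_add)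
      then show "\<phi> x + \<phi> y \<in> \<phi> ` supp Alt" unfolding z(2) phi_add[symmetric] by (rule imageI)
    qed
  qed
qed (rule phi_subspace[OF comp_space_subspace])

lemma finite_dim_PP':
  assumes "FW.independent B" "B \<subseteq> PP'"
  shows "finite B"
proof -
  have "\<phi> x \<in> FW.span ((\<lambda>g. \<phi> (delta g)) ` Sym)" if "x \<in> supp Sym" for x
  proof -
    have "\<phi> x = (\<Sum>g\<in>Sym. fun_scale sT (x g) (\<phi> (delta g)))"
    proof
      fix y
      have s: "(\<Sum>g\<in>A. fun_scale sT (x g) (\<phi> (delta g))) y = (\<Sum>g\<in>A. sT (x g) (\<phi> (delta g) y))" if "finite A" for A
        using that by (induction A rule: finite_induct) (simp_all add: fun_scale_def)
      show "\<phi> x y = (\<Sum>g\<in>Sym. fun_scale sT (x g) (\<phi> (delta g))) y"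
        unfolding s[OF finite_Sym] phi_apply[of x] by (intro sum.cong) (simp_all add: phi_delta)
    qed
    also have "\<dots> \<in> FW.span ((\<lambda>g. \<phi> (delta g)) ` Sym)"
      by (intro FW.span_sum FW.span_scale FW.span_base) blast
    finally show ?thesis .
  qed
  then have "B \<subseteq> FW.span ((\<lambda>g. \<phi> (delta g)) ` Sym)"
    using assms(2) by (auto simp: comp_space_def)
  then have "finite B \<and> card B \<le> card ((\<lambda>g. \<phi> (delta g)) ` Sym)"
    by (intro FW.independent_span_bound assms(1)) simp_all
  then show ?thesis ..
qed

text \<open>Right multiplication by an odd transposition exchanges the eigenspaces of the twist for
  1 and -1 in \<open>comp_space H0\<close>. Faithfulness keeps their images independent, so a basis
  of \<open>PP'\<close> and its translate together form a basis of \<open>PP\<close>.\<close>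

lemma dim_PP:
  assumes n: "n \<ge> 2"
  shows "FW.dim PP = 2 * FW.dim PP'"
proof -
  define g where "g = transpose 1 (2::nat)"
  have N: "1 \<in> N" "2 \<in> N" using n by (auto simp: N_def)
  have gS: "g \<in> Sym" unfolding g_def by (rule transpose_Sym[OF N])
  have sg: "sign g = - 1" by (simp add: g_def sign_swap_id)
  have gg: "g \<circ> g = id" by (simp add: g_def)
  have tg: "twist (delta g) = - delta g" by (simp add: twist_delta sg)
  have dd: "x \<star> delta g \<star> delta g = x" if "x \<in> supp Sym" for x
    using that gS by (simp add: star_assoc delta_star_delta gg)
  \<comment> \<open>The effect of right multiplication by \<open>delta g\<close>, defined on all
    functions; as an involution it is injective on every set.\<close>
  define T where "T f = f \<circ> R g" for f :: "'t \<Rightarrow> 't"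
  have Tphi: "T (\<phi> x) = \<phi> (x \<star> delta g)" for x by (simp add: T_def phi_star phi_delta gS)
  have TT: "T (T f) = f" for f
    using R_comp[OF gS gS] by (simp add: T_def comp_assoc gg R_id)
  have Tlin: "Vector_Spaces.linear (fun_scale sT) (fun_scale sT) T"
    unfolding Vector_Spaces.linear_iff
    using FW.vector_space_axioms by (simp add: T_def fun_eq_iff fun_scale_def)
  interpret T: Vector_Spaces.linear "fun_scale sT" "fun_scale sT" T by (rule Tlin)
  interpret TP: vector_space_pair "fun_scale sT" "fun_scale sT" by unfold_locales
  have Tinj: "inj_on T A" for A by (rule inj_on_inverseI[of _ T]) (rule TT)
  obtain B where B: "B \<subseteq> PP'" "FW.independent B" "PP' \<subseteq> FW.span B" "card B = FW.dim PP'"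
    using FW.basis_exists by blast
  have finB: "finite B" by (rule finite_dim_PP'[OF B(2,1)])
  have spB: "FW.span B = PP'"
    using B(1,3) FW.span_minimal[OF B(1) phi_subspace[OF Alt_part_subspace]] by blast
  have spT: "FW.span (T ` B) = T ` PP'" using T.span_image[of B] spB by simp
  have int: "PP' \<inter> T ` PP' \<subseteq> {0}"
  proof clarify
    fix x y assume x: "x \<in> comp_space H0" "x \<in> supp Alt" and y: "y \<in> comp_space H0" "y \<in> supp Alt"
      and eq: "\<phi> x = T (\<phi> y)"
    have yS: "y \<in> supp Sym" "esum H0 \<star> y = y" using y(1) by (auto simp: comp_space_def)
    have "y \<star> delta g \<in> comp_space H0" using yS by (simp add: comp_space_def star_assoc[symmetric])
    then have xy: "x = y \<star> delta g"
      using eq x(1) phi_inj_H0 unfolding Tphi by (auto simp: inj_on_def)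
    have tx: "twist x = x" and ty: "twist y = y" using x y by (auto simp: supp_Alt_iff)
    have "twist x = - x" by (simp only: xy twist_star ty tg star_minus_right)
    with tx[symmetric] have "x = - x" by (rule trans)
    then have "x = 0" by (rule eq_neg_imp_zero)
    then show "\<phi> x = 0" by (simp only: phi_zero)
  qed
  have ind: "FW.independent (B \<union> T ` B)"
  proof (rule FW.independent_Un[OF B(2)])
    show "FW.independent (T ` B)" by (rule T.independent_injective_image[OF B(2) Tinj])
    show "FW.span B \<inter> FW.span (T ` B) \<subseteq> {0}" unfolding spB spT by (rule int)
  qed
  have "B \<inter> T ` B = {}"
  proof -
    have "B \<inter> T ` B \<subseteq> PP' \<inter> T ` PP'" by (intro Int_mono image_mono B(1))
    then have "B \<inter> T ` B \<subseteq> {0}" using int by (rule subset_trans)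
    moreover have "0 \<notin> B"
    proof
      assume "0 \<in> B"
      then have "FW.dependent B" by (rule FW.dependent_zero)
      then show False using B(2) by contradiction
    qed
    ultimately show ?thesis by (metis Int_iff equals0I singletonD subsetD)
  qed
  then have "card (B \<union> T ` B) = card B + card (T ` B)"
    by (intro card_Un_disjoint finB finite_imageI)
  then have cardB: "card (B \<union> T ` B) = 2 * card B"
    by (simp only: card_image[OF Tinj] mult_2)
  have "FW.span (B \<union> T ` B) = PP"
  proof (rule subset_antisym)
    have TPP: "T ` PP' \<subseteq> PP"
    proof clarify
      fix y assume "y \<in> comp_space H0"
      then have "y \<star> delta g \<in> comp_space H0" by (simp add: comp_space_def star_assoc[symmetric])
      then show "T (\<phi> y) \<in> PP" unfolding Tphi by (rule imageI)
    qed
    have "B \<subseteq> PP" by (rule subset_trans[OF B(1) image_mono[OF Int_lower1]])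
    moreover have "T ` B \<subseteq> PP" by (rule subset_trans[OF image_mono[OF B(1)] TPP])
    ultimately have "B \<union> T ` B \<subseteq> PP" by (rule Un_least)
    then show "FW.span (B \<union> T ` B) \<subseteq> PP" by (rule FW.span_minimal[OF _ phi_subspace[OF comp_space_subspace]])
    show "PP \<subseteq> FW.span (B \<union> T ` B)"
    proof clarify
      fix x assume "x \<in> comp_space H0"
      then have x: "x \<in> supp Sym" "esum H0 \<star> x = x" by (auto simp: comp_space_def)
      have tE: "twist (esum H0) = esum H0" using E0_Alt by (simp add: supp_Alt_iff)
      have Etx: "esum H0 \<star> twist x = twist x"
        using arg_cong[OF x(2), of twist] by (simp add: twist_star tE)
      \<comment> \<open>The even and the odd half of \<open>x\<close>; both stay in
        \<open>comp_space H0\<close> because its idempotent is fixed by the twist.\<close>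
      define u where "u = (1 / 2 :: complex) \<odot> (x + twist x)"
      define v where "v = (1 / 2 :: complex) \<odot> (x - twist x)"
      have uv: "x = u + v"
        unfolding u_def v_def by (simp add: fun_eq_iff fun_scale_def field_simps)
      have supp: "u \<in> supp Sym" "v \<in> supp Sym"
        using x(1) FV.subspace_scale[OF supp_subspace] by (simp_all add: u_def v_def supp_add supp_diff)
      have tu: "twist u = u" unfolding u_def twist_scale twist_add twist_twist by (simp only: add.commute)
      have tv: "twist v = - v"
        unfolding v_def by (simp add: fun_eq_iff fun_scale_def twist_def algebra_simps mult.assoc[symmetric] flip: of_int_mult)
      have Eu: "esum H0 \<star> u = u" "esum H0 \<star> v = v"
        unfolding u_def v_def star_scale_right star_add_right star_diff_right x(2) Etx by simp_all
      have "u \<in> comp_space H0 \<inter> supp Alt" using supp tu Eu by (simp add: comp_space_def supp_Alt_iff)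
      then have 1: "\<phi> u \<in> FW.span B" unfolding spB by (rule imageI)
      \<comment> \<open>An odd element times an odd permutation is even, so the odd half is the
        translate of an even element.\<close>
      have "twist (v \<star> delta g) = v \<star> delta g"
        unfolding twist_star tv tg by (simp only: star_minus_left star_minus_right minus_minus)
      then have "v \<star> delta g \<in> comp_space H0 \<inter> supp Alt"
        using Eu(2) by (simp add: comp_space_def supp_Alt_iff star_assoc[symmetric])
      then have "T (\<phi> (v \<star> delta g)) \<in> FW.span (T ` B)" unfolding spT by (intro imageI)
      then have 2: "\<phi> v \<in> FW.span (T ` B)" unfolding Tphi dd[OF supp(2)] .
      have "\<phi> u + \<phi> v \<in> FW.span (B \<union> T ` B)"
        using 1 2 FW.span_mono[of B "B \<union> T ` B"] FW.span_mono[of "T ` B" "B \<union> T ` B"]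
        by (intro FW.span_add) auto
      then show "\<phi> x \<in> FW.span (B \<union> T ` B)" unfolding uv phi_add .
    qed
  qed
  then have "FW.dim PP = card (B \<union> T ` B)"
    using FW.dim_span_eq_card_independent[OF ind] by simp
  then show ?thesis using cardB B(4) by simp
qed

subsection \<open>Centralizers\<close>

abbreviation "WP \<equiv> range (\<phi> (esum H0))"
abbreviation "WQ \<equiv> range (\<phi> (esum H1))"

lemma range_phi_subspace: "VT.subspace (range (\<phi> a))"
proof -
  interpret L: Vector_Spaces.linear sT sT "\<phi> a" by (rule phi_linear)
  show ?thesis by (rule L.subspace_image[OF VT.subspace_UNIV])
qed

lemma isotypic_sum_eq:
  assumes X: "X \<subseteq> Par"
  shows "isotypic_sum sT \<phi> (I_comp n) X = range (\<phi> (esum X))"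
  unfolding isotypic_sum_def sum_of_subspaces_def
proof (rule subset_antisym)
  show "VT.span (\<Union>((\<lambda>p. VT.span {\<phi> a w |a w. a \<in> I_comp n p}) ` X)) \<subseteq> range (\<phi> (esum X))"
  proof (rule VT.span_minimal[OF _ range_phi_subspace], rule UN_least)
    fix \<mu> assume mu: "\<mu> \<in> X"
    show "VT.span {\<phi> a w |a w. a \<in> I_comp n \<mu>} \<subseteq> range (\<phi> (esum X))"
    proof (rule VT.span_minimal[OF _ range_phi_subspace], clarify)
      fix a w assume "a \<in> I_comp n \<mu>"
      then have "\<phi> a w = \<phi> (esum X) (\<phi> a w)"
        using esum_I_comp[OF X mu] phi_star_apply[of "esum X" a w] by simp
      then show "\<phi> a w \<in> range (\<phi> (esum X))" by (metis rangeI)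
    qed
  qed
  show "range (\<phi> (esum X)) \<subseteq> VT.span (\<Union>((\<lambda>p. VT.span {\<phi> a w |a w. a \<in> I_comp n p}) ` X))"
  proof clarify
    fix x
    show "\<phi> (esum X) x \<in> VT.span (\<Union>((\<lambda>p. VT.span {\<phi> a w |a w. a \<in> I_comp n p}) ` X))"
      unfolding esum_def phi_sum_apply
    proof (rule VT.span_sum)
      fix \<mu> assume mu: "\<mu> \<in> X"
      have "\<phi> (eid \<mu>) x \<in> VT.span {\<phi> a w |a w. a \<in> I_comp n \<mu>}"
        using eid(1) mu X by (intro VT.span_base) blast
      then show "\<phi> (eid \<mu>) x \<in> VT.span (\<Union>((\<lambda>p. VT.span {\<phi> a w |a w. a \<in> I_comp n p}) ` X))"
        using mu by (intro VT.span_base) blast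
    qed
  qed
qed

lemma range_idempotent_iff:
  assumes "\<And>y. F (F y) = F y" shows "x \<in> range F \<longleftrightarrow> F x = x"
proof
  assume "x \<in> range F"
  then obtain y where "x = F y" by blast
  then show "F x = x" using assms by simp
next
  assume "F x = x"
  then show "x \<in> range F" using rangeI[of F x] by simp
qed

lemma WP_iff: "x \<in> WP \<longleftrightarrow> \<phi> (esum H0) x = x" and WQ_iff: "x \<in> WQ \<longleftrightarrow> \<phi> (esum H1) x = x"
proof -
  show "x \<in> WP \<longleftrightarrow> \<phi> (esum H0) x = x" "x \<in> WQ \<longleftrightarrow> \<phi> (esum H1) x = x"
    by (rule range_idempotent_iff, simp only: phi_star_apply[symmetric] E01)+
qed

lemma E_cross: "\<phi> (esum H0) (\<phi> (esum H1) x) = 0" "\<phi> (esum H1) (\<phi> (esum H0) x) = 0"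
  by (simp_all only: phi_star_apply[symmetric] E01 phi_zero zero_fun_apply)

lemma direct_sum_T: "direct_sum_of sT UNIV WP WQ"
  unfolding direct_sum_of_def
proof (intro conjI range_phi_subspace)
  show "WP \<inter> WQ = {0}"
  proof -
    have "x = 0" if "x \<in> WP" "x \<in> WQ" for x
      using that E_cross(1)[of x] by (simp only: WP_iff WQ_iff)
    then show ?thesis using VT.subspace_0[OF range_phi_subspace] by blast
  qed
  show "UNIV = {a + b |a b. a \<in> WP \<and> b \<in> WQ}"
    using phi_E_sum by (metis (mono_tags, lifting) UNIV_eq_I mem_Collect_eq rangeI)
qed

lemma R_phi_central:
  assumes X: "X \<subseteq> Par" and g: "g \<in> Sym"
  shows "R g (\<phi> (esum X) x) = \<phi> (esum X) (R g x)"
  using esum_central[OF X delta_supp[OF g]] phi_star_apply[of "delta g" "esum X" x] phi_star_apply[of "esum X" "delta g" x]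
  by (simp add: phi_delta[OF g])

lemma R_W: "g \<in> Sym \<Longrightarrow> x \<in> WP \<Longrightarrow> R g x \<in> WP" "g \<in> Sym \<Longrightarrow> x \<in> WQ \<Longrightarrow> R g x \<in> WQ"
  unfolding WP_iff WQ_iff
  by (simp_all only: R_phi_central[OF H_subset(1), symmetric] R_phi_central[OF H_subset(2), symmetric])

text \<open>Extends commutation from single permutations to their linear combinations; coefficients
  outside \<open>G\<close> are 0, so only equivariance under \<open>G\<close> enters.\<close>

lemma equivariant_phi:
  assumes f: "f \<in> equivariant_End sT R G W" and W: "VT.subspace W" "\<And>g x. g \<in> Sym \<Longrightarrow> x \<in> W \<Longrightarrow> R g x \<in> W"
    and y: "y \<in> supp G" and x: "x \<in> W"
  shows "f (\<phi> y x) = \<phi> y (f x)"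
proof -
  have add: "f (u + v) = f u + f v" if "u \<in> W" "v \<in> W" for u v using f that by (simp add: equivariant_End_def)
  have sc: "f (sT c u) = sT c (f u)" if "u \<in> W" for c u using f that by (simp add: equivariant_End_def)
  have eqv: "f (R g x) = R g (f x)" if "g \<in> G" for g using f that x by (simp add: equivariant_End_def)
  have f0: "f 0 = 0" using sc[OF x, of 0] by simp
  \<comment> \<open>Membership of the partial sums in \<open>W\<close> is carried along because
    \<open>f\<close> is additive only there.\<close>
  have "f (\<Sum>g\<in>A. sT (y g) (R g x)) = (\<Sum>g\<in>A. sT (y g) (f (R g x))) \<and> (\<Sum>g\<in>A. sT (y g) (R g x)) \<in> W"
    if "finite A" "A \<subseteq> Sym" for A
    using that
  proof (induction A rule: finite_induct)
    case (insert g A)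
    have gW: "R g x \<in> W" using insert.prems W(2) x by blast
    then show ?case
      using insert add[OF VT.subspace_scale[OF W(1) gW]] sc[OF gW] VT.subspace_scale[OF W(1) gW]
      by (simp add: VT.subspace_add[OF W(1)])
  qed (simp add: f0 VT.subspace_0[OF W(1)])
  then have "f (\<phi> y x) = (\<Sum>g\<in>Sym. sT (y g) (f (R g x)))" by (simp add: phi_apply)
  also have "\<dots> = (\<Sum>g\<in>Sym. sT (y g) (R g (f x)))"
  proof (rule sum.cong[OF refl])
    fix g
    show "sT (y g) (f (R g x)) = sT (y g) (R g (f x))"
      using eqv y by (cases "g \<in> G") (auto simp: supp_def)
  qed
  finally show ?thesis by (simp add: phi_apply)
qed

text \<open>The idempotent of \<open>H0\<close> is even, so \<open>f\<close> commutes with its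
  action. The one of \<open>H1\<close> need not be even, but on the tensor power it acts as the
  complementary projection.\<close>

lemma equivariant_preserves:
  assumes f: "f \<in> equivariant_End sT R Alt UNIV"
  shows "f (\<phi> (esum H0) x) = \<phi> (esum H0) (f x)" "f (\<phi> (esum H1) x) = \<phi> (esum H1) (f x)"
proof -
  show 0: "f (\<phi> (esum H0) x) = \<phi> (esum H0) (f x)"
    by (rule equivariant_phi[OF f _ _ E0_Alt]) simp_all
  have "f (\<phi> (esum H0) x + \<phi> (esum H1) x) = f (\<phi> (esum H0) x) + f (\<phi> (esum H1) x)"
    using f by (simp add: equivariant_End_def)
  then have "\<phi> (esum H0) (f x) + f (\<phi> (esum H1) x) = \<phi> (esum H0) (f x) + \<phi> (esum H1) (f x)"
    by (simp add: phi_E_sum 0)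
  then show "f (\<phi> (esum H1) x) = \<phi> (esum H1) (f x)" by simp
qed

lemma equivariant_mono: "G \<subseteq> G' \<Longrightarrow> equivariant_End sT \<rho> G' W \<subseteq> equivariant_End sT \<rho> G W"
  by (auto simp: equivariant_End_def)

lemma Alt_Sym: "Alt \<subseteq> Sym"
  by (auto simp: Alt_iff)

lemma preserves_W:
  assumes "f \<in> equivariant_End sT R Alt UNIV"
  shows "f ` WP \<subseteq> WP" "f ` WQ \<subseteq> WQ"
  using equivariant_preserves[OF assms] by auto

lemma restrict_equivariant:
  assumes f: "f \<in> equivariant_End sT R G UNIV" and G: "G \<subseteq> Sym" and W: "VT.subspace W"
    and RW: "\<And>g x. g \<in> Sym \<Longrightarrow> x \<in> W \<Longrightarrow> R g x \<in> W" and fW: "f ` W \<subseteq> W"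
  shows "restrict f W \<in> equivariant_End sT R G W"
proof -
  have "x + y \<in> W" if "x \<in> W" "y \<in> W" for x y using VT.subspace_add[OF W that] .
  moreover have "sT c x \<in> W" if "x \<in> W" for c x using VT.subspace_scale[OF W that] .
  moreover have "R g x \<in> W" if "g \<in> G" "x \<in> W" for g x using RW G that by blast
  ultimately show ?thesis using f fW by (auto simp: equivariant_End_def)
qed

text \<open>A pair of endomorphisms is glued by applying each to the corresponding projection; the
  projections commute with the whole symmetric group, so equivariance survives.\<close>

lemma restricts:
  assumes G: "Alt \<subseteq> G" "G \<subseteq> Sym"
  shows "restricts_to_sum (equivariant_End sT R G UNIV) WP (equivariant_End sT R G WP)
    WQ (equivariant_End sT R G WQ)"
  unfolding restricts_to_sum_def
proof (rule bij_betwI[of _ _ _ "\<lambda>(g, h) x. g (\<phi> (esum H0) x) + h (\<phi> (esum H1) x)"])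
  have A: "f \<in> equivariant_End sT R Alt UNIV" if "f \<in> equivariant_End sT R G UNIV" for f
    using that equivariant_mono[OF G(1)] by blast
  show "(\<lambda>f. (restrict f WP, restrict f WQ)) \<in> equivariant_End sT R G UNIV \<rightarrow>
      equivariant_End sT R G WP \<times> equivariant_End sT R G WQ"
  proof
    fix f assume f: "f \<in> equivariant_End sT R G UNIV"
    have "restrict f WP \<in> equivariant_End sT R G WP"
      by (rule restrict_equivariant[OF f G(2) range_phi_subspace R_W(1) preserves_W(1)[OF A[OF f]]])
    moreover have "restrict f WQ \<in> equivariant_End sT R G WQ"
      by (rule restrict_equivariant[OF f G(2) range_phi_subspace R_W(2) preserves_W(2)[OF A[OF f]]])
    ultimately show "(restrict f WP, restrict f WQ) \<in> equivariant_End sT R G WP \<times> equivariant_End sT R G WQ"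
      by blast
  qed
  show "(\<lambda>(g, h) x. g (\<phi> (esum H0) x) + h (\<phi> (esum H1) x)) \<in>
      equivariant_End sT R G WP \<times> equivariant_End sT R G WQ \<rightarrow> equivariant_End sT R G UNIV"
  proof (rule funcsetI, clarify)
    fix g h assume g: "g \<in> equivariant_End sT R G WP" and h: "h \<in> equivariant_End sT R G WQ"
    have ga: "g (x + y) = g x + g y" if "x \<in> WP" "y \<in> WP" for x y
      using g that unfolding equivariant_End_def by blast
    have ha: "h (x + y) = h x + h y" if "x \<in> WQ" "y \<in> WQ" for x y
      using h that unfolding equivariant_End_def by blast
    have gs: "g (sT c x) = sT c (g x)" if "x \<in> WP" for x c
      using g that unfolding equivariant_End_def by blast
    have hs: "h (sT c x) = sT c (h x)" if "x \<in> WQ" for x c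
      using h that unfolding equivariant_End_def by blast
    have ge: "g (R s x) = R s (g x)" if "s \<in> G" "x \<in> WP" for s x
      using g that unfolding equivariant_End_def by blast
    have he: "h (R s x) = R s (h x)" if "s \<in> G" "x \<in> WQ" for s x
      using h that unfolding equivariant_End_def by blast
    let ?f = "\<lambda>x. g (\<phi> (esum H0) x) + h (\<phi> (esum H1) x)"
    have "?f (x + y) = ?f x + ?f y" for x y
      unfolding phi_lin using ga ha by (simp add: add_ac)
    moreover have "?f (sT c x) = sT c (?f x)" for c x
      unfolding phi_lin using gs hs by (simp add: VT.scale_right_distrib)
    moreover have "?f (R s x) = R s (?f x)" if s: "s \<in> G" for s x
    proof -
      have sS: "s \<in> Sym" using s G(2) by blast
      show ?thesis
        unfolding R_linear(1)[OF sS] R_phi_central[OF H_subset(1) sS, symmetric]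
          R_phi_central[OF H_subset(2) sS, symmetric]
        by (simp add: ge he s)
    qed
    ultimately show "?f \<in> equivariant_End sT R G UNIV"
      by (simp add: equivariant_End_def)
  qed
  show "(case (restrict f WP, restrict f WQ) of (g, h) \<Rightarrow> \<lambda>x. g (\<phi> (esum H0) x) + h (\<phi> (esum H1) x)) = f"
    if f: "f \<in> equivariant_End sT R G UNIV" for f
  proof -
    have "f (x + y) = f x + f y" for x y using f by (simp add: equivariant_End_def)
    then show ?thesis by (simp add: fun_eq_iff phi_E_sum flip: \<open>\<And>x y. f (x + y) = f x + f y\<close>)
  qed
  fix p assume "p \<in> equivariant_End sT R G WP \<times> equivariant_End sT R G WQ"
  then obtain g h where p: "p = (g, h)" and g: "g \<in> equivariant_End sT R G WP" and h: "h \<in> equivariant_End sT R G WQ"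
    by blast
  have 0: "0 \<in> WP" "0 \<in> WQ" using VT.subspace_0[OF range_phi_subspace] by blast+
  \<comment> \<open>\<open>g\<close> and \<open>h\<close> are linear only on their subspaces; the
    scalar 0 yields their value at 0, needed where one projection vanishes.\<close>
  have "g (sT 0 0) = sT 0 (g 0)" "h (sT 0 0) = sT 0 (h 0)"
    using g h 0 by (simp_all only: equivariant_End_def mem_Collect_eq)
  then have g0: "g 0 = 0" "h 0 = 0" by simp_all
  have ext: "g \<in> extensional WP" "h \<in> extensional WQ" using g h by (simp_all add: equivariant_End_def)
  let ?f = "\<lambda>x. g (\<phi> (esum H0) x) + h (\<phi> (esum H1) x)"
  have "restrict ?f WP = g"
  proof
    fix x show "restrict ?f WP x = g x"
    proof (cases "x \<in> WP")
      case True
      then have "\<phi> (esum H0) x = x" by (simp only: WP_iff)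
      moreover from this have "\<phi> (esum H1) x = 0" using E_cross(2)[of x] by simp
      ultimately show ?thesis using True g0 by simp
    qed (use ext in \<open>simp add: extensional_def\<close>)
  qed
  moreover have "restrict ?f WQ = h"
  proof
    fix x show "restrict ?f WQ x = h x"
    proof (cases "x \<in> WQ")
      case True
      then have "\<phi> (esum H1) x = x" by (simp only: WQ_iff)
      moreover from this have "\<phi> (esum H0) x = 0" using E_cross(1)[of x] by simp
      ultimately show ?thesis using True g0 by simp
    qed (use ext in \<open>simp add: extensional_def\<close>)
  qed
  ultimately show "(restrict (case p of (g, h) \<Rightarrow> \<lambda>x. g (\<phi> (esum H0) x) + h (\<phi> (esum H1) x)) WP,
      restrict (case p of (g, h) \<Rightarrow> \<lambda>x. g (\<phi> (esum H0) x) + h (\<phi> (esum H1) x)) WQ) = p"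
    by (simp add: p)
qed

text \<open>On \<open>WQ\<close> every \<open>\<phi> (delta g)\<close> agrees with the image of an element of \<open>\<complex>A\<^sub>n\<close>,
  because \<open>Q' = Q\<close>.\<close>

lemma equivariant_WQ: "equivariant_End sT R Sym WQ = equivariant_End sT R Alt WQ"
proof (rule subset_antisym[OF equivariant_mono[OF Alt_Sym]], rule subsetI)
  fix f assume f: "f \<in> equivariant_End sT R Alt WQ"
  have "f (R g x) = R g (f x)" if g: "g \<in> Sym" and x: "x \<in> WQ" for g x
  proof -
    have fx: "f x \<in> WQ" using f x by (auto simp: equivariant_End_def)
    have "esum H1 \<star> delta g \<in> comp_space H1"
      by (rule comp_space_image[OF H_subset(2) delta_supp[OF g]])
    then obtain y where y: "y \<in> J_bar n H1" "\<phi> (esum H1 \<star> delta g) = \<phi> y"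
      using J_bar_H1 by blast
    then have yA: "y \<in> supp Alt" using J_bar_eq[OF H_subset(2)] by blast
    have Rg: "R g z = \<phi> y z" if "z \<in> WQ" for z
    proof -
      have "\<phi> y z = R g (\<phi> (esum H1) z)"
        by (simp only: y(2)[symmetric] phi_star_apply phi_delta[OF g] R_phi_central[OF H_subset(2) g])
      then show ?thesis using that by (simp only: WQ_iff)
    qed
    show ?thesis
      using equivariant_phi[OF f range_phi_subspace R_W(2) yA x] Rg[OF x] Rg[OF fx] by simp
  qed
  then show "f \<in> equivariant_End sT R Sym WQ" using f by (simp add: equivariant_End_def)
qed

end

text \<open>The dimension formula is confined to \<open>n \<ge> 2\<close>: for \<open>n = 1\<close>
  both groups are trivial, the only partition lies in \<open>hook0 k l n\<close> as
  \<open>k \<noteq> l\<close>, and \<open>P = P'\<close> consists of the scalar maps, of dimension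
  1.\<close>

theorem theorem3p2:
  fixes sV :: "complex \<Rightarrow> 'v::ab_group_add \<Rightarrow> 'v"
    and sT :: "complex \<Rightarrow> 't::ab_group_add \<Rightarrow> 't"
    and V0 V1 :: "'v set"
    and \<tau> :: "(nat \<Rightarrow> 'v) \<Rightarrow> 't"
    and k l n :: nat
  defines "\<rho> \<equiv> sign_perm n sT \<tau> V0 V1"
    and "\<phi> \<equiv> sign_rep n sT \<tau> V0 V1"
    and "S \<equiv> carrier (sym_group n)"
    and "Alt \<equiv> carrier (alt_group n)"
  defines "P \<equiv> sum_of_subspaces (fun_scale sT) ((\<lambda>\<mu>. \<phi> ` I_comp n \<mu>) ` hook0 k l n)"
    and "Q \<equiv> sum_of_subspaces (fun_scale sT) ((\<lambda>\<mu>. \<phi> ` I_comp n \<mu>) ` hook1 k l n)"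
    and "P' \<equiv> \<phi> ` J_bar n (hook0 k l n)"
    and "Q' \<equiv> \<phi> ` J_bar n (hook1 k l n)"
    and "WP \<equiv> isotypic_sum sT \<phi> (I_comp n) (hook0 k l n)"
    and "WQ \<equiv> isotypic_sum sT \<phi> (I_comp n) (hook1 k l n)"
  defines "\<A> \<equiv> equivariant_End sT \<rho> Alt UNIV"
    and "\<B> \<equiv> equivariant_End sT \<rho> S UNIV"
    and "\<A>P \<equiv> equivariant_End sT \<rho> Alt WP"
    and "\<A>Q \<equiv> equivariant_End sT \<rho> Alt WQ"
    and "\<B>P \<equiv> equivariant_End sT \<rho> S WP"
    and "\<B>Q \<equiv> equivariant_End sT \<rho> S WQ"
  assumes "vector_space sV" and "vector_space sT"
    and "direct_sum_of sV UNIV V0 V1"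
    and "has_dimension sV V0 k" and "has_dimension sV V1 l" and "k \<noteq> l"
    and "n \<ge> 1"
    and "is_tensor_power n sV sT \<tau>"
  shows
    "(direct_sum_of (fun_scale sT) (\<phi> ` carrier (CS n)) P Q \<and>
      direct_sum_of (fun_scale sT) (\<phi> ` carrier (CA n)) P' Q' \<and>
      Q' = Q \<and> P' \<subseteq> P \<and>
      (n \<ge> 2 \<longrightarrow>
         vector_space.dim (fun_scale sT) P = 2 * vector_space.dim (fun_scale sT) P'))
     \<and>
     (direct_sum_of sT UNIV WP WQ \<and>
      (\<forall>f\<in>\<A>. f ` WP \<subseteq> WP \<and> f ` WQ \<subseteq> WQ) \<and>
      (\<forall>f\<in>\<B>. f ` WP \<subseteq> WP \<and> f ` WQ \<subseteq> WQ) \<and>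
      restricts_to_sum \<A> WP \<A>P WQ \<A>Q \<and>
      restricts_to_sum \<B> WP \<B>P WQ \<B>Q \<and>
      \<B>P \<subseteq> \<A>P \<and> \<B>Q = \<A>Q)"
proof -
  interpret X: tensor_rep n sV sT V0 V1 \<tau> k l
    by (rule tensor_rep.intro) fact+
  have phi: "\<phi> = X.\<phi>" and rho: "\<rho> = X.R" and S: "S = X.Sym" and Alt: "Alt = X.Alt"
    by (simp_all add: \<phi>_def \<rho>_def S_def Alt_def X.\<phi>_def X.R_def X.Alt_def X.carrier_sym)
  have P: "P = X.\<phi> ` X.comp_space (hook0 k l n)" and Q: "Q = X.\<phi> ` X.comp_space (hook1 k l n)"
    unfolding P_def Q_def phi by (rule X.sum_of_components[OF X.H_subset(1)], rule X.sum_of_components[OF X.H_subset(2)])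
  have P': "P' = X.\<phi> ` (X.comp_space (hook0 k l n) \<inter> X.supp X.Alt)"
    and Q': "Q' = X.\<phi> ` X.comp_space (hook1 k l n)"
    unfolding P'_def Q'_def phi by (simp_all only: X.J_bar_H0 X.J_bar_H1)
  have WP: "WP = range (X.\<phi> (X.esum (hook0 k l n)))" and WQ: "WQ = range (X.\<phi> (X.esum (hook1 k l n)))"
    unfolding WP_def WQ_def phi by (rule X.isotypic_sum_eq[OF X.H_subset(1)], rule X.isotypic_sum_eq[OF X.H_subset(2)])
  show ?thesis
    unfolding \<A>_def \<B>_def \<A>P_def \<A>Q_def \<B>P_def \<B>Q_def
    unfolding phi rho S Alt P Q P' Q' WP WQ X.CS_simps
  proof (intro conjI impI ballI)
    fix f assume f: "f \<in> equivariant_End sT X.R X.Alt UNIV"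
    show "f ` X.WP \<subseteq> X.WP" "f ` X.WQ \<subseteq> X.WQ" by (rule X.preserves_W[OF f])+
  next
    fix f assume "f \<in> equivariant_End sT X.R X.Sym UNIV"
    then have f: "f \<in> equivariant_End sT X.R X.Alt UNIV"
      by (rule subsetD[OF X.equivariant_mono[OF X.Alt_Sym]])
    show "f ` X.WP \<subseteq> X.WP" "f ` X.WQ \<subseteq> X.WQ" by (rule X.preserves_W[OF f])+
  next
    show "X.PP' \<subseteq> X.PP" by (rule image_mono[OF Int_lower1])
    show "X.FW.dim X.PP = 2 * X.FW.dim X.PP'" if "2 \<le> n" by (rule X.dim_PP[OF that])
  qed (rule X.direct_sum_S X.direct_sum_A X.direct_sum_T refl X.restricts[OF subset_refl X.Alt_Sym]
      X.restricts[OF X.Alt_Sym subset_refl] X.equivariant_mono[OF X.Alt_Sym] X.equivariant_WQ)+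
qed

end
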